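(* Let $\{a_{ij}: i\le j,\ i,j\in\mathbb{N}\}$ be jointly independent, identically distributed real random variables with all moments finite, $X_k:=\mathbb{E}a_{ij}^k<\infty$ for all $k\in\mathbb{N}$, and set $a_{ji}=a_{ij}$ for $i\le j$. Fix $p>0$ and $\alpha\in(0,1)$. For $N\ge p$ let $\{d^{(N,p)}_{ij}: i\le j,\ i,j\in\{1,\dots,N\}\}$ be jointly independent random variables, independent of the family $\{a_{ij}\}$, with $d^{(N,p)}_{ij}=1$ with probability $p/N$ and $d^{(N,p)}_{ij}=0$ with probability $1-p/N$; set $d^{(N,p)}_{ji}=d^{(N,p)}_{ij}$. Let $I_{\alpha,N}=\{1,\dots,\lfloor \alpha N\rfloor\}$ and define the real symmetric $N\times N$ matrix $A^{(N,p,\alpha)}$ by $$[A^{(N,p,\alpha)}]_{ij}=\begin{cases} a_{ij}d^{(N,p)}_{ij}, & \text{if exactly one of } i,j \text{ lies in } I_{\alpha,N},\\ 0,& \text{otherwise.}\end{cases}$$ Let $\sigma(\cdot\,;A^{(N,p,\alpha)})$ be its normalized eigenvalue counting measure, i.e. $\sigma(\lambda;A^{(N,p,\alpha)})=\frac1N\#\{j:\lambda_j^{(N,p,\alpha)}<\lambda\}$ where $\lambda^{(N,p,\alpha)}_1\le\dots\le\lambda^{(N,p,\alpha)}_N$ are the eigenvalues. Define numbers $S^{(1)}(l,r),S^{(2)}(l,r)$ for integers $0\le r\le l$ by the initial conditions $S^{(1)}(l,0)=\alpha\,\delta_{l,0}$, $S^{(2)}(l,0)=(1-\alpha)\,\delta_{l,0}$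 and, for $r\ge1$, $$S^{(1)}(l,r)=p\sum_{f=1}^{r}\binom{r-1}{f-1}X_{2f}\sum_{u=0}^{l-r}S^{(1)}(l-u-f,r-f)\sum_{v=0}^{u}\binom{f+v-1}{f-1}S^{(2)}(u,v),$$ $$S^{(2)}(l,r)=p\sum_{f=1}^{r}\binom{r-1}{f-1}X_{2f}\sum_{u=0}^{l-r}S^{(2)}(l-u-f,r-f)\sum_{v=0}^{u}\binom{f+v-1}{f-1}S^{(1)}(u,v).$$ Assume that there is a constant $C$ such that $X_{2m}\le (Cm)^{2m}$ for all $m\in\mathbb{N}$. Then there is a nonrandom measure $\sigma_{p,\alpha}$, uniquely determined by its moments $$\int\lambda^s\,d\sigma_{p,\alpha}(\lambda)=\begin{cases} m^{(p,\alpha)}_k:=\sum_{i=0}^{k}\big(S^{(1)}(k,i)+S^{(2)}(k,i)\big), & s=2k,\\ 0, & s=2k-1,\end{cases}$$ such that $\sigma(\cdot\,;A^{(N,p,\alpha)})$ converges weakly in probability to $\sigma_{p,\alpha}$ as $N\to\infty$.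
   Context: Weak convergence in probability means: for every bounded continuous function $\varphi:\mathbb{R}\to\mathbb{R}$, $\int\varphi\,d\sigma(\cdot\,;A^{(N,p,\alpha)})\to\int\varphi\,d\sigma_{p,\alpha}$ in probability as $N\to\infty$. Here $\delta_{l,0}$ is the Kronecker delta and $\lfloor\cdot\rfloor$ is the floor function. *)

theory Defs
  imports "HOL-Probability.Probability" "Jordan_Normal_Form.Char_Poly"
begin

text \<open>The numbers S^(1)(l,r) = Snum p alpha X True l r and S^(2)(l,r) = Snum p alpha X False l r,
  for 0 <= r <= l (set to 0 when r > l, a case never used by the recursion).\<close>
function Snum :: "real \<Rightarrow> real \<Rightarrow> (nat \<Rightarrow> real) \<Rightarrow> bool \<Rightarrow> nat \<Rightarrow> nat \<Rightarrow> real" where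
  "Snum p \<alpha> X b l r =
     (if r = 0 then (if l = 0 then (if b then \<alpha> else 1 - \<alpha>) else 0)
      else if l < r then 0
      else p * (\<Sum>f=1..r. real ((r - 1) choose (f - 1)) * X (2 * f) *
             (\<Sum>u=0..l-r. Snum p \<alpha> X b (l - u - f) (r - f) *
                (\<Sum>v=0..u. real ((f + v - 1) choose (f - 1)) * Snum p \<alpha> X (\<not> b) u v))))"
  by pat_completeness auto
termination
  by (relation "Wellfounded.measure (\<lambda>(p, \<alpha>, X, b, l, r). l)") auto

definition lim_moment :: "real \<Rightarrow> real \<Rightarrow> (nat \<Rightarrow> real) \<Rightarrow> nat \<Rightarrow> real" where
  "lim_moment p \<alpha> X s =
     (if even s then (\<Sum>i=0..s div 2. Snum p \<alpha> X True (s div 2) i + Snum p \<alpha> X False (s div 2) i)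
      else 0)"

definition A_entry :: "real \<Rightarrow> nat \<Rightarrow> (nat \<times> nat \<Rightarrow> real) \<Rightarrow> (nat \<times> nat \<Rightarrow> real) \<Rightarrow> nat \<Rightarrow> nat \<Rightarrow> real" where
  "A_entry \<alpha> N a d i j =
     (let I = {1..nat \<lfloor>\<alpha> * real N\<rfloor>} in
      if (i \<in> I) \<noteq> (j \<in> I) then a (min i j, max i j) * d (min i j, max i j) else 0)"

text \<open>As an N x N matrix (Jordan_Normal_Form indices 0..N-1 correspond to 1..N).\<close>
definition A_mat :: "real \<Rightarrow> nat \<Rightarrow> (nat \<times> nat \<Rightarrow> real) \<Rightarrow> (nat \<times> nat \<Rightarrow> real) \<Rightarrow> real mat" where
  "A_mat \<alpha> N a d = mat N N (\<lambda>(i, j). A_entry \<alpha> N a d (i + 1) (j + 1))"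

text \<open>Normalized eigenvalue counting measure of a real square matrix: each eigenvalue
  (real root of the characteristic polynomial) gets mass (algebraic multiplicity)/N.
  For real symmetric matrices all eigenvalues are real, so this is the usual measure.\<close>
definition eig_count_measure :: "real mat \<Rightarrow> real measure" where
  "eig_count_measure A =
     density (count_space UNIV) (\<lambda>x. ennreal (real (order x (char_poly A)) / real (dim_row A)))"

end

(* The moments of the eigenvalue measure are normalized traces, that is, sums over closed walks w on
   {1..N} in which every distinct edge e, traversed n_e times, contributes (p/N) X_(n_e). If a step
   joins two already visited vertices by a new edge, a factor 1/N is lost, so up to O(1/N) only walks
   whose trace is a tree matter; these are the walks on the tree of label stacks that never
   repeat a label. On that tree, put iid weights on the edges: the generating function G of
   closed walks at a vertex satisfies G = 1 / (1 - L) with L = t * sum_j A_j^2 G_j over the children j,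
   and the G_j are independent copies. Expanding L^r by the child carrying the first factor gives the
   recursion for S, with S(l,r) the limit of E[t^l] L^r. Two walks correlate only if they meet, which
   again costs 1/N, so the traces concentrate. Finally S(l,r) <= K^l (l!)^2, hence the limit moments
   m_k grow at most like R^k k!, the moment problem is determinate, and convergence of moments in
   probability upgrades to weak convergence in probability. *)
theory Submission
  imports Defs "Jordan_Normal_Form.Jordan_Normal_Form" "Jordan_Normal_Form.Schur_Decomposition"
begin

section \<open>Walks and their multiplicities\<close>

text \<open>One balance drives all walk estimates. A step to an unvisited vertex has at most about N
  choices and weight of order 1/N, so the walks from a fixed start have total weight bounded
  independently of N. A defect, or a first meeting with another walk, has the same weight but only
  boundedly many targets. Hence each root contributes an error O(1/N), and the variance of the
  unnormalized trace is O(N). Labels may recur along a branch of the tree so that all vertices of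
  one class have equally many children and subtrees are exact independent copies. The recursion
  therefore closes already at finite N, where splitting off a child only lowers the number of root
  children by one. Its limit is S(l,r) divided by the frequency \<alpha> or 1 - \<alpha> of the root
  class; averaging over the roots restores that factor. The limit law is obtained as a weak limit of
  eigenvalue measures at selected sample points. For a given test function and tolerance,
  compactness and determinacy yield finitely many moments whose closeness suffices, so a union bound
  over these moments finishes the proof.\<close>

fun edges :: "('v \<Rightarrow> 'v \<Rightarrow> 'e) \<Rightarrow> 'v list \<Rightarrow> 'e list" where
  "edges ed (u # v # w) = ed u v # edges ed (v # w)"
| "edges ed w = []"

text \<open>Walks are stored in reverse: the head of the list is the current position.\<close>

fun walks :: "('v \<Rightarrow> 'v set) \<Rightarrow> 'v \<Rightarrow> nat \<Rightarrow> 'v list set" where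
  "walks nb x 0 = {[x]}"
| "walks nb x (Suc n) = (\<Union>t\<in>walks nb x n. (\<lambda>u. u # t) ` nb (hd t))"

definition walk_val :: "('v \<Rightarrow> 'v \<Rightarrow> 'e) \<Rightarrow> ('e \<Rightarrow> real) \<Rightarrow> 'v list \<Rightarrow> real" where
  "walk_val ed A w = prod_list (map A (edges ed w))"

text \<open>For independent weights with k-th moment \<open>m k\<close>, this is the expectation of
  the product of the weights along \<open>es\<close>; see
  \<open>expectation_prod_list\<close>.\<close>

definition multi_wt :: "(nat \<Rightarrow> real) \<Rightarrow> 'e list \<Rightarrow> real" where
  "multi_wt m es = (\<Prod>e\<in>set es. m (count_list es e))"

lemma walks_length: "w \<in> walks nb x n \<Longrightarrow> length w = Suc n"
  by (induction n arbitrary: w) auto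

lemma walks_not_Nil: "w \<in> walks nb x n \<Longrightarrow> w \<noteq> []"
  using walks_length[of w nb x n] by auto

lemma edges_Cons: "t \<noteq> [] \<Longrightarrow> edges ed (u # t) = ed u (hd t) # edges ed t"
  by (metis edges.simps(1) list.collapse)

lemma length_edges: "length (edges ed w) = length w - 1"
  by (induction ed w rule: edges.induct) auto

lemma finite_walks: "(\<And>v. finite (nb v)) \<Longrightarrow> finite (walks nb x n)"
  by (induction n) auto

lemma sum_walks_Suc:
  assumes "\<And>v. finite (nb v)"
  shows "(\<Sum>w\<in>walks nb x (Suc n). f w) = (\<Sum>t\<in>walks nb x n. \<Sum>u\<in>nb (hd t). f (u # t))"
proof -
  have "(\<Sum>w\<in>walks nb x (Suc n). f w) = (\<Sum>t\<in>walks nb x n. sum f ((\<lambda>u. u # t) ` nb (hd t)))"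
    unfolding walks.simps by (rule sum.UNION_disjoint) (auto intro: finite_walks assms)
  also have "\<dots> = (\<Sum>t\<in>walks nb x n. \<Sum>u\<in>nb (hd t). f (u # t))"
    by (intro sum.cong refl, subst sum.reindex) (auto simp: inj_on_def)
  finally show ?thesis .
qed

lemma edges_in_walk:
  assumes "w \<in> walks nb x n" "e \<in> set (edges ed w)"
  shows "\<exists>u v. u \<in> set w \<and> v \<in> set w \<and> u \<in> nb v \<and> e = ed u v"
  using assms
proof (induction n arbitrary: w)
  case (Suc n)
  then obtain t u where t: "t \<in> walks nb x n" "u \<in> nb (hd t)" "w = u # t" by auto
  have ne: "t \<noteq> []" by (rule walks_not_Nil[OF t(1)])
  show ?case
  proof (cases "e = ed u (hd t)")
    case True
    then show ?thesis using t ne by (intro exI[of _ u] exI[of _ "hd t"]) auto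
  next
    case False
    then have "e \<in> set (edges ed t)" using Suc.prems t ne by (auto simp: edges_Cons)
    from Suc.IH[OF t(1) this] show ?thesis using t by auto
  qed
qed auto

text \<open>Splitting off the last step shows that the walk sums obey the same recursion as
  \<open>V\<close>, with the same start. It serves twice: for entries of matrix powers and for
  coefficients of the generating functions on the tree.\<close>

lemma walk_sum_unique:
  assumes fin: "\<And>v. finite (nb v)" and sym: "\<And>x y. y \<in> nb x \<longleftrightarrow> x \<in> nb y"
    and V0: "\<And>x. V 0 x = (if x = x0 then 1 else 0)"
    and VS: "\<And>n x. V (Suc n) x = (\<Sum>y\<in>nb x. A (ed x y) * V n y)"
  shows "(\<Sum>w\<in>walks nb x0 n. if hd w = x then walk_val ed A w else 0) = V n x"
proof (induction n arbitrary: x)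
  case 0
  then show ?case by (auto simp: V0 walk_val_def)
next
  case (Suc n)
  have "(\<Sum>w\<in>walks nb x0 (Suc n). if hd w = x then walk_val ed A w else 0)
      = (\<Sum>t\<in>walks nb x0 n. \<Sum>u\<in>nb (hd t). if u = x then A (ed x (hd t)) * walk_val ed A t else 0)"
    by (subst sum_walks_Suc[OF fin], intro sum.cong refl)
       (auto simp: walk_val_def edges_Cons walks_not_Nil)
  also have "\<dots> = (\<Sum>t\<in>walks nb x0 n. \<Sum>y\<in>nb x. if hd t = y then A (ed x y) * walk_val ed A t else 0)"
  proof (rule sum.cong[OF refl])
    fix t
    show "(\<Sum>u\<in>nb (hd t). if u = x then A (ed x (hd t)) * walk_val ed A t else 0)
        = (\<Sum>y\<in>nb x. if hd t = y then A (ed x y) * walk_val ed A t else 0)"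
      using sym[of "hd t" x] fin by simp
  qed
  also have "\<dots> = (\<Sum>y\<in>nb x. A (ed x y) * (\<Sum>t\<in>walks nb x0 n. if hd t = y then walk_val ed A t else 0))"
    by (subst sum.swap) (auto simp: sum_distrib_left intro!: sum.cong)
  also have "\<dots> = V (Suc n) x" by (simp add: Suc.IH VS)
  finally show ?case .
qed

section \<open>Weighted counts of walks, of defects and of meetings\<close>

fun pair_const :: "nat \<Rightarrow> nat \<Rightarrow> real" where
  "pair_const L 0 = real L"
| "pair_const L (Suc n) = (real n + L + 3) * pair_const L n + real L * fact (n + 2)"

lemma pair_const_nonneg: "pair_const L n \<ge> 0"
  by (induction n) auto

text \<open>Here \<open>q\<close> stands for 1/N. The bound 2 instead of 1 leaves room for the tree,
  where every vertex has its parent as one more neighbour. Edge names need to be unambiguous for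
  adjacent pairs only, which is all that \<open>tree_ed\<close> provides.\<close>

locale walk_graph =
  fixes nb :: "'v \<Rightarrow> 'v set" and ed :: "'v \<Rightarrow> 'v \<Rightarrow> 'e" and q :: real
  assumes fin: "\<And>v. finite (nb v)"
    and card_q: "\<And>v. real (card (nb v)) * q \<le> 2"
    and edinj: "\<And>u v u' v'. u \<in> nb v \<Longrightarrow> u' \<in> nb v' \<Longrightarrow> ed u v = ed u' v' \<Longrightarrow> {u, v} = {u', v'}"
    and q: "0 < q" "q \<le> 1"
begin

abbreviation wq :: "'v list \<Rightarrow> real" where "wq w \<equiv> q ^ card (set (edges ed w))"

lemma fresh_edge:
  assumes "t \<in> walks nb x n" "u \<in> nb (hd t)" "u \<notin> set t"
  shows "ed u (hd t) \<notin> set (edges ed t)"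
proof
  assume "ed u (hd t) \<in> set (edges ed t)"
  from edges_in_walk[OF assms(1) this] obtain a b where
    "a \<in> set t" "b \<in> set t" "a \<in> nb b" "ed u (hd t) = ed a b" by auto
  with edinj[OF assms(2), of a b] assms(3) show False by (auto simp: doubleton_eq_iff)
qed

lemma pow_insert_le: "finite E \<Longrightarrow> q ^ card (insert e E) \<le> q ^ card E"
  using q by (intro power_decreasing card_mono) auto

text \<open>Old targets are few, at most \<open>card S\<close>, and may be free of charge; new
  targets number up to 2/q, but each brings a new edge and hence a factor \<open>q\<close>. The two
  kinds add up to \<open>card S + 2\<close>.\<close>

lemma step_bound:
  assumes S: "finite S" and E: "finite E" and fr: "\<And>u. u \<in> nb v \<Longrightarrow> u \<notin> S \<Longrightarrow> ed u v \<notin> E"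
  shows "(\<Sum>u\<in>nb v. q ^ card (insert (ed u v) E)) \<le> (real (card S) + 2) * q ^ card E"
proof -
  have "(\<Sum>u\<in>nb v. q ^ card (insert (ed u v) E))
      = (\<Sum>u\<in>nb v \<inter> S. q ^ card (insert (ed u v) E)) + (\<Sum>u\<in>nb v - S. q ^ card (insert (ed u v) E))"
    using fin by (subst sum.union_disjoint[symmetric]) (auto intro: sum.cong)
  also have "(\<Sum>u\<in>nb v \<inter> S. q ^ card (insert (ed u v) E)) \<le> (\<Sum>u\<in>nb v \<inter> S. q ^ card E)"
    by (intro sum_mono pow_insert_le E)
  also have "\<dots> \<le> real (card S) * q ^ card E"
    using S q by (auto intro!: mult_right_mono card_mono)
  also have "(\<Sum>u\<in>nb v - S. q ^ card (insert (ed u v) E)) = (\<Sum>u\<in>nb v - S. q * q ^ card E)"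
    using fr E by (intro sum.cong refl) auto
  also have "\<dots> \<le> (real (card (nb v)) * q) * q ^ card E"
    using q fin by (auto intro!: mult_right_mono card_mono simp: mult.assoc[symmetric])
  also have "\<dots> \<le> 2 * q ^ card E"
    using card_q q by (intro mult_right_mono) auto
  finally show ?thesis by (simp add: algebra_simps)
qed

lemma walk_step:
  assumes t: "t \<in> walks nb x n"
  shows "(\<Sum>u\<in>nb (hd t). wq (u # t)) \<le> (real n + 3) * wq t"
proof -
  have "(\<Sum>u\<in>nb (hd t). wq (u # t)) = (\<Sum>u\<in>nb (hd t). q ^ card (insert (ed u (hd t)) (set (edges ed t))))"
    using walks_not_Nil[OF t] by (simp add: edges_Cons)
  also have "\<dots> \<le> (real (card (set t)) + 2) * wq t"
    using fresh_edge[OF t] by (intro step_bound) auto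
  also have "\<dots> \<le> (real n + 3) * wq t"
    using card_length[of t] walks_length[OF t] q by (intro mult_right_mono) auto
  finally show ?thesis .
qed

text \<open>The factors n + 3 of \<open>walk_step\<close> (n + 1 visited entries plus 2) multiply to
  a factorial. The point is that the bound does not involve \<open>q\<close>.\<close>

lemma walk_bound: "(\<Sum>w\<in>walks nb x n. wq w) \<le> fact (n + 2)"
proof (induction n)
  case (Suc n)
  have "(\<Sum>w\<in>walks nb x (Suc n). wq w) \<le> (\<Sum>t\<in>walks nb x n. (real n + 3) * wq t)"
    unfolding sum_walks_Suc[OF fin] by (intro sum_mono walk_step)
  also have "\<dots> = (real n + 3) * (\<Sum>t\<in>walks nb x n. wq t)" by (simp add: sum_distrib_left)
  also have "\<dots> \<le> (real n + 3) * fact (n + 2)" by (intro mult_left_mono Suc) auto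
  finally show ?case by (simp add: algebra_simps)
qed auto

text \<open>At the step where a walk turns bad it pays \<open>q\<close> for a new edge, but has at
  most \<open>length t\<close> targets to choose from, so this \<open>q\<close> is not compensated.
  Walks that are already bad grow at the ordinary rate of \<open>walk_step\<close>; the factor n
  accounts for the possible times of the defect.\<close>

lemma defect_bound:
  assumes Bd0: "\<not> Bd [x]"
    and Bd: "\<And>t u n. t \<in> walks nb x n \<Longrightarrow> u \<in> nb (hd t) \<Longrightarrow> Bd (u # t) \<Longrightarrow> \<not> Bd t \<Longrightarrow>
          u \<in> D t \<and> ed u (hd t) \<notin> set (edges ed t)"
    and D: "\<And>t. finite (D t)" "\<And>t. card (D t) \<le> length t"
  shows "(\<Sum>w\<in>walks nb x n. if Bd w then wq w else 0) \<le> real n * fact (n + 2) * q"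
proof (induction n)
  case (Suc n)
  have "(\<Sum>u\<in>nb (hd t). if Bd (u # t) then wq (u # t) else 0)
      \<le> (real n + 3) * (if Bd t then wq t else 0) + (real n + 1) * q * wq t" if t: "t \<in> walks nb x n" for t
  proof (cases "Bd t")
    case True
    have "(\<Sum>u\<in>nb (hd t). if Bd (u # t) then wq (u # t) else 0) \<le> (\<Sum>u\<in>nb (hd t). wq (u # t))"
      using q by (intro sum_mono) auto
    also have "\<dots> \<le> (real n + 3) * wq t" by (rule walk_step[OF t])
    also have "\<dots> \<le> (real n + 3) * wq t + (real n + 1) * q * wq t" using q by auto
    finally show ?thesis using True by auto
  next
    case False
    have "(\<Sum>u\<in>nb (hd t). if Bd (u # t) then wq (u # t) else 0) \<le> (\<Sum>u\<in>nb (hd t). if u \<in> D t then q * wq t else 0)"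
    proof (intro sum_mono)
      fix u assume u: "u \<in> nb (hd t)"
      show "(if Bd (u # t) then wq (u # t) else 0) \<le> (if u \<in> D t then q * wq t else 0)"
        using Bd[OF t u] False walks_not_Nil[OF t] q by (auto simp: edges_Cons)
    qed
    also have "\<dots> = real (card (nb (hd t) \<inter> D t)) * (q * wq t)"
      using fin by (simp add: sum.inter_restrict[symmetric])
    also have "card (nb (hd t) \<inter> D t) \<le> n + 1"
      using card_mono[OF D(1)[of t], of "nb (hd t) \<inter> D t"] D(2)[of t] walks_length[OF t] by auto
    then have "real (card (nb (hd t) \<inter> D t)) * (q * wq t) \<le> (real n + 1) * (q * wq t)"
      using q by (intro mult_right_mono) auto
    finally show ?thesis using False by (simp add: mult.assoc)
  qed
  then have "(\<Sum>w\<in>walks nb x (Suc n). if Bd w then wq w else 0)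
      \<le> (\<Sum>t\<in>walks nb x n. (real n + 3) * (if Bd t then wq t else 0) + (real n + 1) * q * wq t)"
    unfolding sum_walks_Suc[OF fin] by (intro sum_mono)
  also have "\<dots> = (real n + 3) * (\<Sum>t\<in>walks nb x n. if Bd t then wq t else 0)
       + (real n + 1) * q * (\<Sum>t\<in>walks nb x n. wq t)"
    by (simp add: sum.distrib sum_distrib_left)
  also have "\<dots> \<le> (real n + 3) * (real n * fact (n + 2) * q) + (real n + 1) * q * fact (n + 2)"
    using q by (intro add_mono mult_left_mono Suc walk_bound) auto
  also have "\<dots> \<le> (real n + 1) * ((real n + 3) * fact (n + 2)) * q"
    using q by (simp add: algebra_simps)
  finally show ?case by (simp add: algebra_simps)
qed (use Bd0 in auto)

text \<open>Without the condition of meeting, the sum over all starts would be of order 1/q. A walk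
  meets \<open>w0\<close> either at its start, which leaves k + 1 starts, or by a step along a new
  edge to one of k + 1 vertices, whose factor \<open>q\<close> absorbs the sum over starts. In
  \<open>pair_const\<close> the first summand continues walks that have met, the second counts first
  meetings.\<close>

lemma meeting_bound:
  assumes Vs: "finite Vs" "real (card Vs) * q \<le> 1" and w0: "w0 \<in> walks nb x0 k"
  shows "(\<Sum>x\<in>Vs. \<Sum>w\<in>walks nb x n. if set w \<inter> set w0 \<noteq> {}
            then q ^ card (set (edges ed w) \<union> set (edges ed w0)) else 0)
         \<le> pair_const (Suc k) n * wq w0"
proof (induction n)
  case 0
  have "(\<Sum>x\<in>Vs. if x \<in> set w0 then wq w0 else 0) = real (card (Vs \<inter> set w0)) * wq w0"
    using Vs by (simp add: sum.inter_restrict[symmetric])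
  also have "card (Vs \<inter> set w0) \<le> Suc k"
    using card_mono[of "set w0" "Vs \<inter> set w0"] card_length[of w0] walks_length[OF w0] by auto
  then have "real (card (Vs \<inter> set w0)) * wq w0 \<le> real (Suc k) * wq w0"
    using q by (intro mult_right_mono) auto
  finally show ?case by (simp add: if_distrib cong: if_cong)
next
  case (Suc n)
  let ?E = "set (edges ed w0)"
  let ?h = "\<lambda>w. q ^ card (set (edges ed w) \<union> ?E)"
  \<comment> \<open>An edge of \<open>w0\<close> has both ends on \<open>w0\<close>; hence a walk
    that has not met \<open>w0\<close> cannot have used any of its edges.\<close>
  have E0: "u \<in> set w0 \<and> v \<in> set w0" if uv: "u \<in> nb v" "ed u v \<in> ?E" for u v
  proof -
    obtain a b where ab: "a \<in> set w0" "b \<in> set w0" "a \<in> nb b" "ed u v = ed a b"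
      using edges_in_walk[OF w0 uv(2)] by blast
    have "{u, v} = {a, b}" by (rule edinj[OF uv(1) ab(3,4)])
    then show ?thesis using ab by (auto simp: doubleton_eq_iff)
  qed
  have step: "(\<Sum>u\<in>nb (hd t). if set (u # t) \<inter> set w0 \<noteq> {} then ?h (u # t) else 0)
      \<le> (real n + Suc k + 3) * (if set t \<inter> set w0 \<noteq> {} then ?h t else 0) + Suc k * q * (wq t * wq w0)"
    if t: "t \<in> walks nb x n" for t x
  proof (cases "set t \<inter> set w0 = {}")
    case False
    have "(\<Sum>u\<in>nb (hd t). if set (u # t) \<inter> set w0 \<noteq> {} then ?h (u # t) else 0)
        = (\<Sum>u\<in>nb (hd t). q ^ card (insert (ed u (hd t)) (set (edges ed t) \<union> ?E)))"
      using False walks_not_Nil[OF t] by (intro sum.cong) (auto simp: edges_Cons)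
    also have "\<dots> \<le> (real (card (set t \<union> set w0)) + 2) * ?h t"
      using fresh_edge[OF t] E0 by (intro step_bound) auto
    also have "\<dots> \<le> (real n + Suc k + 3) * ?h t"
    proof (intro mult_right_mono)
      have "card (set t \<union> set w0) \<le> length t + length w0"
        using card_Un_le[of "set t" "set w0"] card_length[of t] card_length[of w0] by linarith
      then show "real (card (set t \<union> set w0)) + 2 \<le> real n + Suc k + 3"
        using walks_length[OF t] walks_length[OF w0] by simp
    qed (use q in auto)
    also have "\<dots> \<le> (real n + Suc k + 3) * ?h t + Suc k * q * (wq t * wq w0)"
      using q by auto
    finally show ?thesis using False by simp
  next
    case True
    have disj: "set (edges ed t) \<inter> ?E = {}"
    proof (rule ccontr)
      assume "\<not> ?thesis"
      then obtain e where e: "e \<in> set (edges ed t)" "e \<in> ?E" by blast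
      from edges_in_walk[OF t e(1)] obtain a b where ab: "a \<in> set t" "a \<in> nb b" "e = ed a b" by blast
      then have "a \<in> set w0" using E0[of a b] e by simp
      then show False using ab True by blast
    qed
    have "(\<Sum>u\<in>nb (hd t). if set (u # t) \<inter> set w0 \<noteq> {} then ?h (u # t) else 0)
        \<le> (\<Sum>u\<in>nb (hd t). if u \<in> set w0 then q * (wq t * wq w0) else 0)"
    proof (intro sum_mono)
      fix u assume u: "u \<in> nb (hd t)"
      have "ed u (hd t) \<notin> ?E" using E0[OF u] True walks_not_Nil[OF t] by (cases t) auto
      moreover have "u \<in> set w0 \<Longrightarrow> ed u (hd t) \<notin> set (edges ed t)" 
        using True fresh_edge[OF t u] by auto
      ultimately show "(if set (u # t) \<inter> set w0 \<noteq> {} then ?h (u # t) else 0)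
         \<le> (if u \<in> set w0 then q * (wq t * wq w0) else 0)"
        using True walks_not_Nil[OF t] disj by (auto simp: edges_Cons card_Un_disjoint power_add)
    qed
    also have "\<dots> = real (card (nb (hd t) \<inter> set w0)) * (q * (wq t * wq w0))"
      using fin by (simp add: sum.inter_restrict[symmetric])
    also have "card (nb (hd t) \<inter> set w0) \<le> Suc k"
      using card_mono[of "set w0" "nb (hd t) \<inter> set w0"] card_length[of w0] walks_length[OF w0] by auto
    then have "real (card (nb (hd t) \<inter> set w0)) * (q * (wq t * wq w0)) \<le> real (Suc k) * (q * (wq t * wq w0))"
      using q by (intro mult_right_mono) auto
    finally show ?thesis using True by (simp add: mult.assoc)
  qed
  have "(\<Sum>x\<in>Vs. \<Sum>w\<in>walks nb x (Suc n). if set w \<inter> set w0 \<noteq> {} then ?h w else 0)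
     \<le> (\<Sum>x\<in>Vs. \<Sum>t\<in>walks nb x n. (real n + Suc k + 3) * (if set t \<inter> set w0 \<noteq> {} then ?h t else 0)
           + Suc k * q * (wq t * wq w0))"
    unfolding sum_walks_Suc[OF fin] by (intro sum_mono step)
  also have "\<dots> = (real n + Suc k + 3) * (\<Sum>x\<in>Vs. \<Sum>t\<in>walks nb x n. if set t \<inter> set w0 \<noteq> {} then ?h t else 0)
           + Suc k * q * (\<Sum>x\<in>Vs. \<Sum>t\<in>walks nb x n. wq t) * wq w0"
    by (simp only: sum.distrib sum_distrib_left sum_distrib_right mult.assoc)
  also have "\<dots> \<le> (real n + Suc k + 3) * (pair_const (Suc k) n * wq w0)
           + real (Suc k) * (fact (n + 2)) * wq w0"
  proof (intro add_mono mult_left_mono mult_right_mono Suc)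
    \<comment> \<open>The free choice of the start costs \<open>card Vs\<close>, and the new edge of
      the first meeting step pays for it.\<close>
    have "q * (\<Sum>x\<in>Vs. \<Sum>t\<in>walks nb x n. wq t) \<le> q * (\<Sum>x\<in>Vs. fact (n + 2))"
      using q by (intro mult_left_mono sum_mono walk_bound) auto
    also have "\<dots> = (card Vs * q) * fact (n + 2)" by simp
    also have "\<dots> \<le> 1 * fact (n + 2)" using Vs by (intro mult_right_mono) auto
    finally have "real (Suc k) * (q * (\<Sum>x\<in>Vs. \<Sum>t\<in>walks nb x n. wq t)) \<le> real (Suc k) * fact (n + 2)"
      by (intro mult_left_mono) auto
    then show "real (Suc k) * q * (\<Sum>x\<in>Vs. \<Sum>t\<in>walks nb x n. wq t) \<le> real (Suc k) * fact (n + 2)"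
      by (simp only: mult.assoc)
  qed (use q in auto)
  also have "\<dots> = pair_const (Suc k) (Suc n) * wq w0"
    by (simp add: algebra_simps)
  finally show ?case .
qed

end

text \<open>All moments of positive order are O(q), whatever the multiplicity, so only the number of
  distinct edges enters the power of \<open>q\<close>. The constant \<open>B\<close> per distinct
  edge is relaxed to \<open>B\<close> per step.\<close>

lemma multi_wt_bound:
  assumes m: "\<And>k. 1 \<le> k \<Longrightarrow> k \<le> length es \<Longrightarrow> \<bar>m k\<bar> \<le> B * q" and B: "B \<ge> 1" and q: "q \<ge> 0"
  shows "\<bar>multi_wt m es\<bar> \<le> B ^ length es * q ^ card (set es)"
proof -
  have "\<bar>multi_wt m es\<bar> = (\<Prod>e\<in>set es. \<bar>m (count_list es e)\<bar>)"
    by (simp add: multi_wt_def abs_prod)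
  also have "\<dots> \<le> (\<Prod>e\<in>set es. B * q)"
  proof (intro prod_mono conjI m)
    fix e assume "e \<in> set es"
    then show "1 \<le> count_list es e" using count_list_0_iff[of es e] by (cases "count_list es e") auto
    show "count_list es e \<le> length es" by (rule count_le_length)
  qed auto
  also have "\<dots> = B ^ card (set es) * q ^ card (set es)" by (simp add: power_mult_distrib)
  also have "\<dots> \<le> B ^ length es * q ^ card (set es)"
    using B q by (intro mult_right_mono power_increasing card_length) auto
  finally show ?thesis .
qed

lemma count_list_map_inj: "inj_on f (insert e (set es)) \<Longrightarrow> count_list (map f es) (f e) = count_list es e"
proof (induction es)
  case (Cons a es)
  have "inj_on f (insert e (set es))" by (rule inj_on_subset[OF Cons.prems]) auto
  then have "count_list (map f es) (f e) = count_list es e" by (rule Cons.IH)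
  moreover have "f a = f e \<longleftrightarrow> a = e" using inj_on_eq_iff[OF Cons.prems] by simp
  ultimately show ?case by simp
qed auto

lemma multi_wt_map:
  assumes "inj_on f (set es)"
  shows "multi_wt m (map f es) = multi_wt m es"
proof -
  have "multi_wt m (map f es) = (\<Prod>e\<in>set es. m (count_list (map f es) (f e)))"
    using assms by (simp add: multi_wt_def prod.reindex)
  also have "\<dots> = multi_wt m es"
    unfolding multi_wt_def using assms by (intro prod.cong refl) (simp add: count_list_map_inj insert_absorb)
  finally show ?thesis .
qed

section \<open>The tree of label stacks\<close>

text \<open>A vertex of the tree is a stack of labels, the current vertex of the graph on top and the root
  at the bottom (a child may carry the label of its grandparent). An edge is named by its lower
  endpoint, i.e. by the longer of the two stacks.\<close>

definition tree_nb :: "('v \<Rightarrow> 'v set) \<Rightarrow> 'v list \<Rightarrow> 'v list set" where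
  "tree_nb nb x = {k # x | k. x \<noteq> [] \<and> k \<in> nb (hd x)} \<union> {y. \<exists>k. x = k # y \<and> y \<noteq> [] \<and> k \<in> nb (hd y)}"

definition tree_ed :: "'v list \<Rightarrow> 'v list \<Rightarrow> 'v list" where
  "tree_ed x y = (if length y < length x then x else y)"

definition pair_ed :: "nat \<Rightarrow> nat \<Rightarrow> nat \<times> nat" where
  "pair_ed i j = (min i j, max i j)"

lemma tree_nb_sym: "y \<in> tree_nb nb x \<longleftrightarrow> x \<in> tree_nb nb y"
  by (auto simp: tree_nb_def)

lemma tree_nb_subset: "tree_nb nb x \<subseteq> insert (tl x) ((\<lambda>k. k # x) ` nb (hd x))"
  by (auto simp: tree_nb_def)

lemma finite_tree_nb: "(\<And>v. finite (nb v)) \<Longrightarrow> finite (tree_nb nb x)"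
  by (rule finite_subset[OF tree_nb_subset]) auto

lemma card_tree_nb:
  fixes nb :: "'v \<Rightarrow> 'v set"
  assumes "\<And>v. finite (nb v)"
  shows "card (tree_nb nb x) \<le> Suc (card (nb (hd x)))"
proof -
  have "card (tree_nb nb x) \<le> card (insert (tl x) ((\<lambda>k. k # x) ` nb (hd x)))"
    by (intro card_mono tree_nb_subset) (auto intro: assms)
  also have "\<dots> \<le> Suc (card (nb (hd x)))"
    by (intro card_insert_le_m1) (auto intro: card_image_le assms)
  finally show ?thesis .
qed

lemma tree_edinj:
  assumes "u \<in> tree_nb nb v" "u' \<in> tree_nb nb v'" "tree_ed u v = tree_ed u' v'"
  shows "{u, v} = {u', v'}"
  using assms unfolding tree_nb_def tree_ed_def by (auto split: if_splits)

lemma pair_ed_eq_iff: "pair_ed u v = pair_ed u' v' \<longleftrightarrow> {u, v} = {u', v'}"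
  by (auto simp: pair_ed_def doubleton_eq_iff min_def max_def split: if_splits)

lemma pair_ed_commute: "pair_ed u v = pair_ed v u"
  by (simp add: pair_ed_def min.commute max.commute)

locale label_graph =
  fixes nb :: "nat \<Rightarrow> nat set" and q :: real
  assumes nb_fin: "\<And>v. finite (nb v)"
    and nb_sym: "\<And>x y. y \<in> nb x \<longleftrightarrow> x \<in> nb y"
    and nb_card: "\<And>v. real (card (nb v)) * q \<le> 1"
    and q_pos: "0 < q" and q_le: "q \<le> 1"
begin

sublocale G: walk_graph nb pair_ed q
proof
  show "real (card (nb v)) * q \<le> 2" for v using nb_card[of v] by simp
qed (use nb_fin q_pos q_le pair_ed_eq_iff in auto)

sublocale T: walk_graph "tree_nb nb" tree_ed q
proof
  show "real (card (tree_nb nb v)) * q \<le> 2" for v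
  proof -
    have "real (card (tree_nb nb v)) * q \<le> (real (card (nb (hd v))) + 1) * q"
      using card_tree_nb[of nb v, OF nb_fin] q_pos by (intro mult_right_mono) auto
    also have "\<dots> \<le> 2" using nb_card[of "hd v"] q_le by (simp add: algebra_simps)
    finally show ?thesis .
  qed
  show "{u, v} = {u', v'}" if "u \<in> tree_nb nb v" "u' \<in> tree_nb nb v'" "tree_ed u v = tree_ed u' v'" for u v u' v'
    by (rule tree_edinj[OF that])
qed (use finite_tree_nb[OF nb_fin] q_pos q_le in auto)

abbreviation twalks :: "nat \<Rightarrow> nat \<Rightarrow> nat list list set" where
  "twalks x n \<equiv> walks (tree_nb nb) [x] n"

text \<open>Visited tree vertices are told apart by their top labels, so forgetting the stacks
  embeds the trace of the walk into the label graph.\<close>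

definition good :: "nat list list \<Rightarrow> bool" where
  "good t \<longleftrightarrow> inj_on hd (set t)"

text \<open>A walk from the root discovers a vertex only from its parent. So the visited set is
  closed under parents, and a step towards the root never reaches a new vertex.\<close>

lemma twalk_parents:
  "t \<in> twalks x n \<Longrightarrow> (\<forall>u\<in>set t. u \<noteq> [] \<and> (\<forall>k y. u = k # y \<longrightarrow> y \<noteq> [] \<longrightarrow> y \<in> set t))"
proof (induction n arbitrary: t)
  case (Suc n)
  then obtain s u where s: "s \<in> twalks x n" "u \<in> tree_nb nb (hd s)" "t = u # s" by auto
  have ne: "s \<noteq> []" by (rule walks_not_Nil[OF s(1)])
  then have hs: "hd s \<in> set s" by simp
  note IH = Suc.IH[OF s(1)]
  have u: "u \<noteq> [] \<and> (\<forall>k y. u = k # y \<longrightarrow> y \<noteq> [] \<longrightarrow> y \<in> set s)"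
  proof -
    from s(2) consider k where "u = k # hd s" | k where "hd s = k # u" "u \<noteq> []"
      by (auto simp: tree_nb_def)
    then show ?thesis
    proof cases
      case 1
      then show ?thesis using hs by simp
    next
      case 2
      then have "u \<in> set s" using IH hs by blast
      then show ?thesis using IH by blast
    qed
  qed
  show ?case
  proof (rule ballI)
    fix v assume "v \<in> set t"
    then have "v = u \<or> v \<in> set s" using s(3) by simp
    then have "v \<noteq> [] \<and> (\<forall>k y. v = k # y \<longrightarrow> y \<noteq> [] \<longrightarrow> y \<in> set s)" using u IH by blast
    then show "v \<noteq> [] \<and> (\<forall>k y. v = k # y \<longrightarrow> y \<noteq> [] \<longrightarrow> y \<in> set t)" using s(3) by simp
  qed
qed auto

lemma hd_tree_nb: "u \<in> tree_nb nb v \<Longrightarrow> hd u \<in> nb (hd v)"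
  using nb_sym by (auto simp: tree_nb_def)

lemma twalk_map_hd: "t \<in> twalks x n \<Longrightarrow> map hd t \<in> walks nb x n"
proof (induction n arbitrary: t)
  case (Suc n)
  then obtain s u where s: "s \<in> twalks x n" "u \<in> tree_nb nb (hd s)" "t = u # s" by auto
  have "hd (map hd s) = hd (hd s)" using walks_not_Nil[OF s(1)] by (simp add: hd_map)
  then have "hd u \<in> nb (hd (map hd s))" using hd_tree_nb[OF s(2)] by simp
  then show ?case using Suc.IH[OF s(1)] s(3) by force
qed auto

text \<open>Given the current stack, the next label leaves at most two options, the child with that
  label and the parent; goodness excludes that both carry it.\<close>

lemma good_map_inj:
  "\<lbrakk>t \<in> twalks x n; t' \<in> twalks x n; good t; good t'; map hd t = map hd t'\<rbrakk> \<Longrightarrow> t = t'"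
proof (induction n arbitrary: t t')
  case (Suc n)
  obtain s u where s: "s \<in> twalks x n" "u \<in> tree_nb nb (hd s)" "t = u # s" using Suc.prems(1) by auto
  obtain s' u' where s': "s' \<in> twalks x n" "u' \<in> tree_nb nb (hd s')" "t' = u' # s'" using Suc.prems(2) by auto
  have "good s" "good s'" using Suc.prems s s' by (auto simp: good_def)
  then have ss: "s = s'" using Suc.IH[OF s(1) s'(1)] Suc.prems(5) s s' by simp
  have hu: "hd u = hd u'" using Suc.prems(5) s s' by simp
  have ne: "s \<noteq> []" by (rule walks_not_Nil[OF s(1)])
  \<comment> \<open>A child labelled like the parent of the current vertex would be a second visited
    vertex with that label, since the parent has been visited.\<close>
  have clash: False if a: "hd s = j # v'" "v' \<noteq> []" "v = k # hd s" "hd v = hd v'" "good (v # s)" for j k v v'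
  proof -
    have "hd s \<in> set s" using ne by simp
    then have "v' \<in> set s" using twalk_parents[OF s(1)] a by blast
    then have "v = v'" using a(4,5) by (auto simp: good_def dest: inj_onD)
    then show False using a by simp
  qed
  have c: "v = hd v # hd s \<or> (\<exists>j. hd s = j # v \<and> v \<noteq> [])" if "v \<in> tree_nb nb (hd s)" for v
    using that by (auto simp: tree_nb_def)
  have gu: "good (u # s)" "good (u' # s)" using Suc.prems(3,4) s(3) s'(3) ss by simp_all
  have "u = u'"
  proof (cases "u = hd u # hd s")
    case True
    then show ?thesis using c[of u'] s'(2) ss hu clash[of _ u' u, OF _ _ True hu gu(1)] by auto
  next
    case False
    then obtain j where j: "hd s = j # u" "u \<noteq> []" using c[OF s(2)] by blast
    then show ?thesis using c[of u'] s'(2) ss clash[OF j _ hu[symmetric] gu(2)] by auto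
  qed
  then show ?case using s s' ss by simp
qed auto

text \<open>An edge is named by its longer stack \<open>e\<close>, whose other end is
  \<open>tl e\<close>; this gives its pair of labels.\<close>

lemma edges_map_hd:
  assumes "t \<in> twalks x n"
  shows "edges pair_ed (map hd t) = map (\<lambda>e. pair_ed (hd e) (hd (tl e))) (edges tree_ed t)"
  using assms
proof (induction n arbitrary: t)
  case (Suc n)
  then obtain s u where s: "s \<in> twalks x n" "u \<in> tree_nb nb (hd s)" "t = u # s" by auto
  have ne: "s \<noteq> []" by (rule walks_not_Nil[OF s(1)])
  have "pair_ed (hd u) (hd (hd s)) = pair_ed (hd (tree_ed u (hd s))) (hd (tl (tree_ed u (hd s))))"
    using s(2) by (auto simp: tree_nb_def tree_ed_def pair_ed_commute)
  then show ?case using s(3) Suc.IH[OF s(1)] ne by (simp add: edges_Cons hd_map)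
qed auto

text \<open>By goodness, equal label pairs mean equal end points. Then either the edges agree, or
  the ends are swapped and \<open>e = tl (tl e)\<close>, which fails by length.\<close>

lemma good_edges_inj:
  assumes t: "t \<in> twalks x n" and g: "good t"
  shows "inj_on (\<lambda>e. pair_ed (hd e) (hd (tl e))) (set (edges tree_ed t))"
proof (rule inj_onI)
  fix e e' assume e: "e \<in> set (edges tree_ed t)" "e' \<in> set (edges tree_ed t)"
    and eq: "pair_ed (hd e) (hd (tl e)) = pair_ed (hd e') (hd (tl e'))"
  have *: "e \<in> set t \<and> tl e \<in> set t \<and> e \<noteq> []" if "e \<in> set (edges tree_ed t)" for e
    using edges_in_walk[OF t that] by (auto simp: tree_nb_def tree_ed_def)
  note 1 = *[OF e(1)] and 2 = *[OF e(2)]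
  have inj: "hd a = hd b \<Longrightarrow> a = b" if "a \<in> set t" "b \<in> set t" for a b
    using g that by (auto simp: good_def dest: inj_onD)
  from eq have "{hd e, hd (tl e)} = {hd e', hd (tl e')}" by (simp add: pair_ed_eq_iff)
  then have "hd e = hd e' \<and> hd (tl e) = hd (tl e') \<or> hd e = hd (tl e') \<and> hd (tl e) = hd e'"
    by (simp only: doubleton_eq_iff)
  then have "e = e' \<or> (e = tl e' \<and> tl e = e')"
    using inj[of e e'] inj[of e "tl e'"] inj[of "tl e" e'] 1 2 by blast
  moreover have "e \<noteq> tl (tl e)"
  proof
    assume "e = tl (tl e)"
    then have "length e = length (tl (tl e))" by (rule arg_cong)
    moreover have "length e > 0" using 1 by simp
    ultimately show False unfolding length_tl by linarith
  qed
  ultimately show "e = e'" by auto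
qed

lemma good_wt:
  assumes "t \<in> twalks x n" "good t"
  shows "multi_wt m (edges pair_ed (map hd t)) = multi_wt m (edges tree_ed t)"
  unfolding edges_map_hd[OF assms(1)] by (rule multi_wt_map[OF good_edges_inj[OF assms]])

text \<open>Only pushing a label already in use can destroy goodness: returning to a visited vertex
  changes nothing, and the parent is always visited. The bad targets are thus children of the
  current vertex whose labels have occurred.\<close>

lemma bad_bound: "(\<Sum>t\<in>twalks x n. if \<not> good t then T.wq t else 0) \<le> real n * fact (n + 2) * q"
proof (rule T.defect_bound[where D = "\<lambda>t. (\<lambda>k. k # hd t) ` hd ` set t"])
  show "\<not> \<not> good [[x]]" by (simp add: good_def)
  fix t u n assume t: "t \<in> twalks x n" "u \<in> tree_nb nb (hd t)" "\<not> good (u # t)" "\<not> \<not> good t"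
  have ne: "t \<noteq> []" by (rule walks_not_Nil[OF t(1)])
  have u: "u \<notin> set t"
  proof
    assume "u \<in> set t"
    then have "set (u # t) = set t" by auto
    then show False using t(3,4) by (simp add: good_def)
  qed
  have "hd u \<in> hd ` (set t - {u})" using t(3,4) by (simp add: good_def)
  then have "hd u \<in> hd ` set t" by blast
  moreover have "u = hd u # hd t"
  proof -
    from t(2) consider k where "u = k # hd t" | k where "hd t = k # u" "u \<noteq> []"
      by (auto simp: tree_nb_def)
    then show ?thesis
    proof cases
      case 2
      have "hd t \<in> set t" using ne by simp
      then show ?thesis using 2 u twalk_parents[OF t(1)] by blast
    qed auto
  qed
  ultimately show "u \<in> (\<lambda>k. k # hd t) ` hd ` set t \<and> tree_ed u (hd t) \<notin> set (edges tree_ed t)"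
    using T.fresh_edge[OF t(1,2) u] by blast
next
  fix t :: "nat list list"
  show "card ((\<lambda>k. k # hd t) ` hd ` set t) \<le> length t"
    unfolding image_image by (rule order_trans[OF card_image_le card_length]) auto
qed auto

definition lifted :: "nat \<Rightarrow> nat list \<Rightarrow> bool" where
  "lifted x w \<longleftrightarrow> (\<exists>t\<in>twalks x (length w - 1). good t \<and> w = map hd t)"

text \<open>A lifted walk can be lifted one step further if the next label is new (push it) or if
  the edge is old (follow the same tree edge). Failure therefore needs an old label reached by a new
  edge, a defect in the sense of \<open>defect_bound\<close>.\<close>

lemma unlifted_bound: "(\<Sum>w\<in>walks nb x n. if \<not> lifted x w then G.wq w else 0) \<le> real n * fact (n + 2) * q"
proof (rule G.defect_bound[where D = set])
  show "\<not> \<not> lifted x [x]" by (auto simp: lifted_def good_def)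
  fix w k n assume w: "w \<in> walks nb x n" "k \<in> nb (hd w)" and kw: "\<not> lifted x (k # w)" and "\<not> \<not> lifted x w"
  then obtain t where t: "t \<in> twalks x n" "good t" "w = map hd t"
    using walks_length[OF w(1)] by (auto simp: lifted_def)
  have ne: "t \<noteq> []" by (rule walks_not_Nil[OF t(1)])
  have hw: "hd w = hd (hd t)" using t ne by (simp add: hd_map)
  have ext: "lifted x (k # w)" if u: "u \<in> tree_nb nb (hd t)" "hd u = k" "good (u # t)" for u
  proof -
    have "u # t \<in> twalks x (Suc n)" using t u by auto
    then show ?thesis using u t walks_length[OF w(1)] unfolding lifted_def
      by (intro bexI[of _ "u # t"]) auto
  qed
  have tne: "hd t \<noteq> []" using twalk_parents[OF t(1)] ne by auto
  have "k \<in> set w"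
  proof (rule ccontr)
    assume k: "k \<notin> set w"
    have "good (((k # hd t) # t))" using t k by (auto simp: good_def inj_on_def)
    moreover have "k # hd t \<in> tree_nb nb (hd t)" using w(2) hw tne by (auto simp: tree_nb_def)
    ultimately show False using ext[of "k # hd t"] kw by simp
  qed
  moreover have "pair_ed k (hd w) \<notin> set (edges pair_ed w)"
  proof
    assume "pair_ed k (hd w) \<in> set (edges pair_ed w)"
    then obtain e where e: "e \<in> set (edges tree_ed t)" "pair_ed k (hd w) = pair_ed (hd e) (hd (tl e))"
      unfolding t(3) edges_map_hd[OF t(1)] by auto
    obtain u v where uv: "u \<in> set t" "v \<in> set t" "u \<in> tree_nb nb v" "e = tree_ed u v"
      using edges_in_walk[OF t(1) e(1)] by blast
    have "pair_ed (hd e) (hd (tl e)) = pair_ed (hd u) (hd v)"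
      using uv(3,4) by (auto simp: tree_nb_def tree_ed_def pair_ed_commute)
    then have eq: "{k, hd (hd t)} = {hd u, hd v}" using e(2) hw pair_ed_eq_iff by metis
    have inj: "hd a = hd b \<Longrightarrow> a = b" if "a \<in> set t" "b \<in> set t" for a b
      using t(2) that by (auto simp: good_def dest: inj_onD)
    have ht: "hd t \<in> set t" using ne by simp
    have gt: "good (a # t)" if "a \<in> set t" for a using that t(2) by (simp add: good_def insert_absorb)
    from eq consider "k = hd u" "hd (hd t) = hd v" | "k = hd v" "hd (hd t) = hd u"
      by (auto simp: doubleton_eq_iff)
    then show False
    proof cases
      case 1
      then have "hd t = v" using inj[OF ht uv(2)] by simp
      then show False using ext[of u] uv gt[OF uv(1)] 1 kw by simp
    next
      case 2
      then have "hd t = u" using inj[OF ht uv(1)] by simp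
      then show False using ext[of v] uv tree_nb_sym[of u nb v] gt[OF uv(2)] 2 kw by simp
    qed
  qed
  ultimately show "k \<in> set w \<and> pair_ed k (hd w) \<notin> set (edges pair_ed w)" ..
qed (auto intro: card_length)

text \<open>A walk on the tree that never repeats a label is the same as a walk on the graph whose
  trace is a tree; all other walks on either side use an edge joining two old labels for the first
  time and hence cost a factor \<open>q\<close>.\<close>

lemma walks_vs_twalks:
  assumes m: "\<And>k. 1 \<le> k \<Longrightarrow> k \<le> n \<Longrightarrow> \<bar>m k\<bar> \<le> B * q" and B: "B \<ge> 1"
  shows "\<bar>(\<Sum>w\<in>walks nb x n. if hd w = x then multi_wt m (edges pair_ed w) else 0)
        - (\<Sum>t\<in>twalks x n. if hd t = [x] then multi_wt m (edges tree_ed t) else 0)\<bar>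
       \<le> 2 * B ^ n * (real n * fact (n + 2)) * q"
proof -
  let ?g = "\<lambda>w. if hd w = x then multi_wt m (edges pair_ed w) else 0"
  let ?h = "\<lambda>t. if hd t = [x] then multi_wt m (edges tree_ed t) else 0"
  have finG: "finite (walks nb x n)" by (intro finite_walks nb_fin)
  have finT: "finite (twalks x n)" by (intro finite_walks finite_tree_nb nb_fin)
  have G: "\<bar>?g w\<bar> \<le> B ^ n * G.wq w" if "w \<in> walks nb x n" for w
    using multi_wt_bound[of "edges pair_ed w" m B q] m B q_pos walks_length[OF that]
    by (auto simp: length_edges)
  have T: "\<bar>?h t\<bar> \<le> B ^ n * T.wq t" if "t \<in> twalks x n" for t
    using multi_wt_bound[of "edges tree_ed t" m B q] m B q_pos walks_length[OF that]
    by (auto simp: length_edges)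
  have lifted_iff: "{w \<in> walks nb x n. lifted x w} = map hd ` {t \<in> twalks x n. good t}"
  proof (intro equalityI subsetI)
    fix w assume "w \<in> {w \<in> walks nb x n. lifted x w}"
    then show "w \<in> map hd ` {t \<in> twalks x n. good t}"
      using walks_length[of w nb x n] by (auto simp: lifted_def)
  next
    fix w assume "w \<in> map hd ` {t \<in> twalks x n. good t}"
    then obtain t where t: "t \<in> twalks x n" "good t" "w = map hd t" by blast
    show "w \<in> {w \<in> walks nb x n. lifted x w}"
      using twalk_map_hd[OF t(1)] walks_length[OF t(1)] t by (auto simp: lifted_def intro!: bexI[of _ t])
  qed
  have "(\<Sum>w | w \<in> walks nb x n \<and> lifted x w. ?g w) = (\<Sum>t | t \<in> twalks x n \<and> good t. ?g (map hd t))"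
    using lifted_iff good_map_inj by (subst lifted_iff, subst sum.reindex) (auto simp: inj_on_def)
  also have "\<dots> = (\<Sum>t | t \<in> twalks x n \<and> good t. ?h t)"
  proof (intro sum.cong refl)
    fix t assume "t \<in> {t. t \<in> twalks x n \<and> good t}"
    then have t: "t \<in> twalks x n" "good t" by auto
    have ne: "t \<noteq> []" by (rule walks_not_Nil[OF t(1)])
    have x: "[x] \<in> set t" using t(1)
      by (induction n arbitrary: t) auto
    \<comment> \<open>In a good walk the label \<open>x\<close> belongs to the root alone, so being
      closed means the same in the graph and on the tree.\<close>
    have "hd (map hd t) = x \<longleftrightarrow> hd t = [x]"
      using t(2) x ne by (auto simp: good_def hd_map inj_on_def)
    then show "?g (map hd t) = ?h t" using good_wt[OF t] by simp
  qed
  finally have eq: "(\<Sum>w | w \<in> walks nb x n \<and> lifted x w. ?g w) = (\<Sum>t | t \<in> twalks x n \<and> good t. ?h t)" .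
  have split: "sum f S = (\<Sum>a | a \<in> S \<and> P a. f a) + (\<Sum>a\<in>S. if \<not> P a then f a else 0)"
    if "finite S" for f :: "'b \<Rightarrow> real" and S P
    unfolding sum.inter_filter[OF that] sum.distrib[symmetric] by (intro sum.cong) auto
  have "\<bar>sum ?g (walks nb x n) - sum ?h (twalks x n)\<bar>
      = \<bar>(\<Sum>w\<in>walks nb x n. if \<not> lifted x w then ?g w else 0) - (\<Sum>t\<in>twalks x n. if \<not> good t then ?h t else 0)\<bar>"
    by (subst split[OF finG, of ?g "lifted x"], subst split[OF finT, of ?h good]) (simp add: eq)
  also have "\<dots> \<le> \<bar>\<Sum>w\<in>walks nb x n. if \<not> lifted x w then ?g w else 0\<bar> + \<bar>\<Sum>t\<in>twalks x n. if \<not> good t then ?h t else 0\<bar>"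
    by (rule abs_triangle_ineq4)
  also have "\<bar>\<Sum>w\<in>walks nb x n. if \<not> lifted x w then ?g w else 0\<bar>
      \<le> (\<Sum>w\<in>walks nb x n. B ^ n * (if \<not> lifted x w then G.wq w else 0))"
    by (rule order_trans[OF sum_abs]) (intro sum_mono, use G in auto)
  also have "\<dots> \<le> B ^ n * (real n * fact (n + 2) * q)"
    unfolding sum_distrib_left[symmetric] using B by (intro mult_left_mono unlifted_bound) auto
  also have "\<bar>\<Sum>t\<in>twalks x n. if \<not> good t then ?h t else 0\<bar>
      \<le> (\<Sum>t\<in>twalks x n. B ^ n * (if \<not> good t then T.wq t else 0))"
    by (rule order_trans[OF sum_abs]) (intro sum_mono, use T in auto)
  also have "\<dots> \<le> B ^ n * (real n * fact (n + 2) * q)"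
    unfolding sum_distrib_left[symmetric] using B by (intro mult_left_mono bad_bound) auto
  finally show ?thesis by (simp add: algebra_simps)
qed

end

section \<open>Generating functions of weighted trees\<close>

unbundle no vec_syntax
no_notation Matrix.vec_index (infixl "$" 100)
unbundle fps_syntax

text \<open>Total weight of the closed walks of 2n steps at a root of class \<open>b\<close>, whose
  children are labelled by \<open>C (\<not> b)\<close>, split at the first return to the root: the
  first excursion uses child \<open>j\<close> and makes 2i steps above it. Paths are read from the
  root outwards here, so \<open>[j]\<close> is the edge to \<open>j\<close> and \<open>j # l\<close>
  lies beyond it.\<close>

fun gcoef :: "(bool \<Rightarrow> nat set) \<Rightarrow> nat \<Rightarrow> bool \<Rightarrow> (nat list \<Rightarrow> real) \<Rightarrow> real" where
  "gcoef C 0 b A = 1"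
| "gcoef C (Suc n) b A =
     (\<Sum>i=0..n. (\<Sum>j\<in>C (\<not> b). A [j] ^ 2 * gcoef C i (\<not> b) (\<lambda>l. A (j # l))) * gcoef C (n - i) b A)"

definition Gf :: "(bool \<Rightarrow> nat set) \<Rightarrow> bool \<Rightarrow> (nat list \<Rightarrow> real) \<Rightarrow> real fps" where
  "Gf C b A = Abs_fps (\<lambda>n. gcoef C n b A)"

definition Yf :: "(bool \<Rightarrow> nat set) \<Rightarrow> bool \<Rightarrow> nat \<Rightarrow> (nat list \<Rightarrow> real) \<Rightarrow> real fps" where
  "Yf C b j A = fps_X * (fps_const (A [j] ^ 2) * Gf C (\<not> b) (\<lambda>l. A (j # l)))"

text \<open>A single excursion from the root. The set \<open>J\<close> of admissible children is a
  parameter because the recursion removes children from it.\<close>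

definition Lf :: "(bool \<Rightarrow> nat set) \<Rightarrow> bool \<Rightarrow> nat set \<Rightarrow> (nat list \<Rightarrow> real) \<Rightarrow> real fps" where
  "Lf C b J A = (\<Sum>j\<in>J. Yf C b j A)"

lemma Lf_eq_X_mult:
  "Lf C b J A = fps_X * (\<Sum>j\<in>J. fps_const (A [j] ^ 2) * Gf C (\<not> b) (\<lambda>l. A (j # l)))"
  by (simp add: Lf_def Yf_def sum_distrib_left)

lemma Lf_0 [simp]: "Lf C b J A $ 0 = 0"
  by (simp add: Lf_eq_X_mult)

lemma Gf_eq: "Gf C b A = 1 + Lf C b (C (\<not> b)) A * Gf C b A"
proof (rule fps_ext)
  fix n
  show "Gf C b A $ n = (1 + Lf C b (C (\<not> b)) A * Gf C b A) $ n"
  proof (cases n)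
    case (Suc k)
    have "(Lf C b (C (\<not> b)) A * Gf C b A) $ n
       = ((\<Sum>j\<in>C (\<not> b). fps_const (A [j] ^ 2) * Gf C (\<not> b) (\<lambda>l. A (j # l))) * Gf C b A) $ k"
      unfolding Lf_eq_X_mult Suc mult.assoc by simp
    also have "\<dots> = gcoef C (Suc k) b A"
      unfolding fps_mult_nth[of _ "Gf C b A"] by (simp add: fps_sum_nth Gf_def)
    finally show ?thesis using Suc by (simp add: Gf_def)
  qed (simp add: Gf_def)
qed

text \<open>By \<open>Gf_eq\<close>, G^f = (1 - L)^(-f), and the negative binomial series supplies
  the binomials of the recursion for S. Powers of L beyond u do not reach the coefficient u.\<close>

lemma Gf_power_nth:
  assumes "f \<ge> 1"
  shows "(Gf C b A ^ f) $ u = (\<Sum>v=0..u. real ((f + v - 1) choose (f - 1)) * (Lf C b (C (\<not> b)) A ^ v) $ u)"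
proof -
  define L where "L = Lf C b (C (\<not> b)) A"
  define R where "R = inverse (1 - fps_X :: real fps)"
  have L0: "L $ 0 = 0" by (simp add: L_def)
  have "(1 - L) * Gf C b A = 1" using Gf_eq[of C b A] by (simp add: L_def algebra_simps)
  moreover have "(1 - L) * (R oo L) = 1"
  proof -
    have "(1 - fps_X) * R = 1" unfolding R_def by (intro inverse_mult_eq_1') simp
    then have "((1 - fps_X) * R) oo L = 1 oo L" by simp
    then show ?thesis using L0 by (simp add: fps_compose_mult_distrib fps_compose_sub_distrib)
  qed
  ultimately have "(1 - L) * Gf C b A = (1 - L) * (R oo L)" by simp
  moreover have "1 - L \<noteq> 0" using L0 by (metis cancel_comm_monoid_add_class.diff_cancel eq_iff_diff_eq_0 fps_one_nth fps_zero_nth zero_neq_one)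
  ultimately have G: "Gf C b A = R oo L" by simp
  have "R ^ f = Abs_fps (\<lambda>k. real ((f + k - 1) choose k))"
    using one_minus_const_fps_X_neg_power'[of f "1::real"] assms by (simp add: R_def fps_inverse_power)
  then have "(Gf C b A ^ f) $ u = (\<Sum>v=0..u. real ((f + v - 1) choose v) * (L ^ v) $ u)"
    unfolding G fps_compose_power[OF L0] by (simp add: fps_compose_nth)
  also have "\<dots> = (\<Sum>v=0..u. real ((f + v - 1) choose (f - 1)) * (L ^ v) $ u)"
  proof (intro sum.cong refl)
    fix v
    have "(f + v - 1) choose v = (f + v - 1) choose (f - 1)"
      using assms binomial_symmetric[of v "f + v - 1"] by simp
    then show "real ((f + v - 1) choose v) * (L ^ v) $ u = real ((f + v - 1) choose (f - 1)) * (L ^ v) $ u" by simp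
  qed
  finally show ?thesis by (simp add: L_def)
qed

section \<open>Walks on the tree, resolved by their end vertex\<close>

locale bipartite_labels =
  fixes cls :: "nat \<Rightarrow> bool" and Vs :: "nat set"
  assumes finV: "finite Vs"
begin

definition nb :: "nat \<Rightarrow> nat set" where "nb i = {j. i \<in> Vs \<and> j \<in> Vs \<and> cls j \<noteq> cls i}"

definition C :: "bool \<Rightarrow> nat set" where "C b = {j \<in> Vs. cls j = b}"

lemma nb_eq_C: "i \<in> Vs \<Longrightarrow> nb i = C (\<not> cls i)"
  by (auto simp: nb_def C_def)

lemma finite_nb: "finite (nb i)" and finite_C: "finite (C b)"
  using finV by (auto simp: nb_def C_def)

lemma nb_symmetric: "j \<in> nb i \<longleftrightarrow> i \<in> nb j"
  by (auto simp: nb_def)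

text \<open>The stacks in the connected component of the root \<open>[x0]\<close>.\<close>

fun valid :: "nat \<Rightarrow> nat list \<Rightarrow> bool" where
  "valid x0 [] \<longleftrightarrow> False"
| "valid x0 [z] \<longleftrightarrow> z = x0"
| "valid x0 (k # y) \<longleftrightarrow> valid x0 y \<and> k \<in> nb (hd y)"

text \<open>The weights of the subtree at \<open>x\<close>, translated from stacks (top first) to
  the outward reading used by \<open>gcoef\<close>.\<close>

definition Bsub :: "(nat list \<Rightarrow> real) \<Rightarrow> nat list \<Rightarrow> nat list \<Rightarrow> real" where
  "Bsub A x l = A (rev l @ x)"

text \<open>Generating function of the weighted walks from the root to \<open>x\<close>; the exponent counts
  pairs of steps beyond the depth of \<open>x\<close>.\<close>

fun Hf :: "(nat list \<Rightarrow> real) \<Rightarrow> nat list \<Rightarrow> real fps" where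
  "Hf A [] = 0"
| "Hf A [z] = Gf C (cls z) (Bsub A [z])"
| "Hf A (k # y) = Gf C (cls k) (Bsub A (k # y)) * (fps_const (A (k # y)) * Hf A y)"

lemma valid_Cons: "y \<noteq> [] \<Longrightarrow> valid x0 (k # y) \<longleftrightarrow> valid x0 y \<and> k \<in> nb (hd y)"
  by (cases y) auto

lemma Hf_Cons: "y \<noteq> [] \<Longrightarrow> Hf A (k # y) = Gf C (cls k) (Bsub A (k # y)) * (fps_const (A (k # y)) * Hf A y)"
  by (cases y) auto

lemma valid_hd: "valid x0 x \<Longrightarrow> x0 \<in> Vs \<Longrightarrow> hd x \<in> Vs"
  by (induction x0 x rule: valid.induct) (auto simp: nb_def)

text \<open>\<open>Hf\<close> cuts a walk at its last arrival from the parent, after which it stays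
  above \<open>x\<close>. So \<open>Hf A x = G * R\<close>, where R ends with that arrival (or is 1
  at the root), and the terms of the children add up to L * G * R; the claim is \<open>Gf_eq\<close>
  times R. It describes the last step of a walk; the power series variable accounts for the greater
  depth of a child.\<close>

lemma Hf_eq:
  assumes x: "x \<noteq> []" "hd x \<in> Vs"
  shows "Hf A x = (if tl x = [] then 1 else fps_const (A x) * Hf A (tl x))
            + fps_X * (\<Sum>k\<in>nb (hd x). fps_const (A (k # x)) * Hf A (k # x))"
proof -
  define R where "R = (if tl x = [] then 1 else fps_const (A x) * Hf A (tl x))"
  define G where "G = Gf C (cls (hd x)) (Bsub A x)"
  have H: "Hf A x = G * R"
    using x by (cases x) (auto simp: R_def G_def Hf_Cons)
  have "fps_X * (\<Sum>k\<in>nb (hd x). fps_const (A (k # x)) * Hf A (k # x))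
      = fps_X * (\<Sum>k\<in>nb (hd x). fps_const (Bsub A x [k] ^ 2) * Gf C (\<not> cls (hd x)) (\<lambda>l. Bsub A x (k # l))) * Hf A x"
    unfolding sum_distrib_left sum_distrib_right
  proof (intro sum.cong refl)
    fix k assume "k \<in> nb (hd x)"
    then have "cls k = (\<not> cls (hd x))" by (auto simp: nb_def)
    moreover have "(\<lambda>l. Bsub A x (k # l)) = Bsub A (k # x)" by (auto simp: Bsub_def)
    ultimately show "fps_X * (fps_const (A (k # x)) * Hf A (k # x))
        = fps_X * (fps_const ((Bsub A x [k])\<^sup>2) * Gf C (\<not> cls (hd x)) (\<lambda>l. Bsub A x (k # l))) * Hf A x"
      using x by (simp add: Hf_Cons Bsub_def power2_eq_square fps_const_mult[symmetric] mult_ac del: fps_const_mult)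
  qed
  also have "\<dots> = Lf C (cls (hd x)) (C (\<not> cls (hd x))) (Bsub A x) * Hf A x"
    using x by (simp add: Lf_eq_X_mult nb_eq_C)
  also have "R + \<dots> = (1 + Lf C (cls (hd x)) (C (\<not> cls (hd x))) (Bsub A x) * G) * R"
    unfolding H by (simp add: algebra_simps)
  also have "\<dots> = Hf A x" unfolding H G_def Gf_eq[symmetric] ..
  finally show ?thesis unfolding R_def by simp
qed

text \<open>The depth of \<open>x\<close> is \<open>length x - 1\<close>. It can be reached in n
  steps only if n minus the depth is even and non-negative, and half of this difference is the
  exponent in \<open>Hf\<close>. This is the \<open>V\<close> for
  \<open>walk_sum_unique\<close>.\<close>

definition Vt :: "(nat list \<Rightarrow> real) \<Rightarrow> nat \<Rightarrow> nat \<Rightarrow> nat list \<Rightarrow> real" where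
  "Vt A x0 n x = (if valid x0 x \<and> length x \<le> Suc n \<and> odd (n + length x)
       then Hf A x $ ((Suc n - length x) div 2) else 0)"

lemma tree_nb_valid:
  assumes "y \<in> tree_nb nb x"
  shows "valid x0 y \<longleftrightarrow> valid x0 x"
  using assms by (auto simp: tree_nb_def valid_Cons nb_symmetric)

lemma Vt_Suc:
  assumes x0: "x0 \<in> Vs"
  shows "Vt A x0 (Suc n) x = (\<Sum>y\<in>tree_nb nb x. A (tree_ed x y) * Vt A x0 n y)"
proof (cases "valid x0 x")
  case False
  then show ?thesis using tree_nb_valid by (simp add: Vt_def)
next
  case True
  have xne: "x \<noteq> []" using True by auto
  have hx: "hd x \<in> Vs" by (rule valid_hd[OF True x0])
  have kids: "valid x0 (k # x)" if "k \<in> nb (hd x)" for k using that True xne by (simp add: valid_Cons)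
  have par: "tl x \<noteq> [] \<Longrightarrow> valid x0 (tl x) \<and> hd x \<in> nb (hd (tl x))"
    using True xne by (cases x) (auto simp: valid_Cons)
  have set_eq: "tree_nb nb x = (\<lambda>k. k # x) ` nb (hd x) \<union> (if tl x = [] then {} else {tl x})"
    using xne par by (cases x) (auto simp: tree_nb_def)
  have "(\<Sum>y\<in>tree_nb nb x. A (tree_ed x y) * Vt A x0 n y)
     = (\<Sum>y\<in>(\<lambda>k. k # x) ` nb (hd x). A (tree_ed x y) * Vt A x0 n y)
       + (\<Sum>y\<in>(if tl x = [] then {} else {tl x}). A (tree_ed x y) * Vt A x0 n y)"
    unfolding set_eq
    by (rule sum.union_disjoint) (use finite_nb xne in \<open>auto split: if_splits\<close>, metis Suc_n_not_le_n diff_le_self length_Cons length_tl)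
  also have "(\<Sum>y\<in>(\<lambda>k. k # x) ` nb (hd x). A (tree_ed x y) * Vt A x0 n y)
      = (\<Sum>k\<in>nb (hd x). A (k # x) * Vt A x0 n (k # x))"
    by (subst sum.reindex) (auto simp: inj_on_def tree_ed_def)
  also have "(\<Sum>y\<in>(if tl x = [] then {} else {tl x}). A (tree_ed x y) * Vt A x0 n y)
      = (if tl x = [] then 0 else A x * Vt A x0 n (tl x))"
    using xne by (auto simp: tree_ed_def)
  finally have sum_eq: "(\<Sum>y\<in>tree_nb nb x. A (tree_ed x y) * Vt A x0 n y)
    = (\<Sum>k\<in>nb (hd x). A (k # x) * Vt A x0 n (k # x)) + (if tl x = [] then 0 else A x * Vt A x0 n (tl x))" .
  show ?thesis
  proof (cases "length x \<le> Suc (Suc n) \<and> odd (Suc n + length x)")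
    case False
    have "Vt A x0 n (k # x) = 0" for k using False by (auto simp: Vt_def)
    moreover have "Vt A x0 n (tl x) = 0" if "tl x \<noteq> []"
      using False xne by (cases x) (auto simp: Vt_def)
    moreover have "Vt A x0 (Suc n) x = 0" using False by (auto simp: Vt_def)
    ultimately show ?thesis unfolding sum_eq by simp
  next
    case T: True
    \<comment> \<open>Half of the surplus of steps over depth. One step earlier it is the same at
      the parent and smaller by one at a child.\<close>
    define q where "q = (Suc (Suc n) - length x) div 2"
    have q: "Suc (Suc n) = length x + 2 * q" using T unfolding q_def by presburger
    have lhs: "Vt A x0 (Suc n) x = Hf A x $ q" using T True by (simp add: Vt_def q_def)
    have kid: "Vt A x0 n (k # x) = (if q = 0 then 0 else Hf A (k # x) $ (q - 1))" if "k \<in> nb (hd x)" for k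
    proof (cases q)
      case (Suc r)
      then have "n = length x + 2 * r" using q by simp
      then have "Suc n - length (k # x) = 2 * r" "length (k # x) \<le> Suc n" "odd (n + length (k # x))"
        by simp_all
      then show ?thesis using kids[OF that] Suc by (simp add: Vt_def)
    qed (use q in \<open>auto simp: Vt_def\<close>)
    have pa: "Vt A x0 n (tl x) = Hf A (tl x) $ q" if "tl x \<noteq> []"
    proof -
      have "Suc n - length (tl x) = 2 * q" "length (tl x) \<le> Suc n" "odd (n + length (tl x))"
        using q xne by (cases x; auto; presburger)+
      then show ?thesis using par[OF that] by (simp add: Vt_def)
    qed
    have "tl x = [] \<Longrightarrow> q \<noteq> 0" using q xne by (cases x) auto
    then have "Hf A x $ q = (\<Sum>k\<in>nb (hd x). A (k # x) * (if q = 0 then 0 else Hf A (k # x) $ (q - 1)))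
        + (if tl x = [] then 0 else A x * Hf A (tl x) $ q)"
      by (subst Hf_eq[OF xne hx]) (auto simp: fps_sum_nth)
    then show ?thesis unfolding sum_eq lhs using kid pa by (auto intro!: sum.cong)
  qed
qed

lemma Vt_0: "x0 \<in> Vs \<Longrightarrow> Vt A x0 0 x = (if x = [x0] then 1 else 0)"
  by (cases x; cases "tl x") (auto simp: Vt_def Gf_def)

lemma tree_walk_sum:
  assumes "x0 \<in> Vs"
  shows "(\<Sum>t\<in>walks (tree_nb nb) [x0] n. if hd t = [x0] then walk_val tree_ed A t else 0)
       = (if even n then gcoef C (n div 2) (cls x0) (Bsub A [x0]) else 0)"
proof (subst walk_sum_unique[where V = "Vt A x0"])
  show "Vt A x0 n [x0] = (if even n then gcoef C (n div 2) (cls x0) (Bsub A [x0]) else 0)"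
    by (simp add: Vt_def Gf_def)
qed (simp_all add: finite_tree_nb finite_nb tree_nb_sym Vt_0[OF assms] Vt_Suc[OF assms])

end

section \<open>Random weights on the tree\<close>

text \<open>Unlike integrability, this property is stable under products as well as sums, so it
  settles integrability of every polynomial in the weights.\<close>

definition all_mom :: "'a measure \<Rightarrow> ('a \<Rightarrow> real) \<Rightarrow> bool" where
  "all_mom M X \<longleftrightarrow> X \<in> borel_measurable M \<and> (\<forall>k. integrable M (\<lambda>\<omega>. X \<omega> ^ k))"

lemma prod_list_map_count:
  fixes f :: "'e \<Rightarrow> real"
  shows "finite S \<Longrightarrow> set es \<subseteq> S \<Longrightarrow> prod_list (map f es) = (\<Prod>e\<in>S. f e ^ count_list es e)"
proof (induction es)
  case (Cons a es)
  have "(\<Prod>e\<in>S. f e ^ count_list (a # es) e) = (\<Prod>e\<in>S. (if e = a then f e else 1) * f e ^ count_list es e)"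
    by (intro prod.cong) auto
  also have "\<dots> = f a * (\<Prod>e\<in>S. f e ^ count_list es e)"
    using Cons.prems by (simp add: prod.distrib)
  finally show ?case using Cons by simp
qed auto

context prob_space
begin

lemma all_mom_abs: "all_mom M X \<Longrightarrow> integrable M (\<lambda>\<omega>. \<bar>X \<omega>\<bar> ^ k)"
  using integrable_abs[of M "\<lambda>\<omega>. X \<omega> ^ k"] by (simp add: all_mom_def power_abs)

lemma all_mom_integrable:
  assumes "all_mom M X"
  shows "integrable M X"
proof -
  have "integrable M (\<lambda>\<omega>. X \<omega> ^ 1)" using assms unfolding all_mom_def by blast
  then show ?thesis by simp
qed

lemma all_mom_const: "all_mom M (\<lambda>_. c)"
  by (simp add: all_mom_def)

lemma all_mom_mult:
  assumes X: "all_mom M X" and Y: "all_mom M Y"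
  shows "all_mom M (\<lambda>\<omega>. X \<omega> * Y \<omega>)"
  unfolding all_mom_def
proof (intro conjI allI)
  have [measurable]: "X \<in> borel_measurable M" "Y \<in> borel_measurable M"
    using X Y by (auto simp: all_mom_def)
  show "(\<lambda>\<omega>. X \<omega> * Y \<omega>) \<in> borel_measurable M" by simp
  fix k
  show "integrable M (\<lambda>\<omega>. (X \<omega> * Y \<omega>) ^ k)"
  proof (rule Bochner_Integration.integrable_bound)
    show "integrable M (\<lambda>\<omega>. X \<omega> ^ (2 * k) + Y \<omega> ^ (2 * k))"
      using X Y by (simp add: all_mom_def)
    have "\<bar>a * b\<bar> \<le> a^2 + b^2" for a b :: real
      using zero_le_power2[of "a - b"] zero_le_power2[of "a + b"]
      by (simp add: abs_if power2_eq_square algebra_simps)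
    then have *: "\<bar>a ^ k * b ^ k\<bar> \<le> \<bar>a ^ (2 * k) + b ^ (2 * k)\<bar>" for a b :: real
      by (metis abs_ge_self mult.commute order_trans power_mult)
    show "AE x in M. norm ((X x * Y x) ^ k) \<le> norm (X x ^ (2 * k) + Y x ^ (2 * k))"
      using * by (simp add: power_mult_distrib)
  qed measurable
qed

lemma all_mom_add:
  assumes X: "all_mom M X" and Y: "all_mom M Y"
  shows "all_mom M (\<lambda>\<omega>. X \<omega> + Y \<omega>)"
  unfolding all_mom_def
proof (intro conjI allI)
  have [measurable]: "X \<in> borel_measurable M" "Y \<in> borel_measurable M"
    using X Y by (auto simp: all_mom_def)
  show "(\<lambda>\<omega>. X \<omega> + Y \<omega>) \<in> borel_measurable M" by simp
  fix k
  show "integrable M (\<lambda>\<omega>. (X \<omega> + Y \<omega>) ^ k)"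
  proof (rule Bochner_Integration.integrable_bound)
    show "integrable M (\<lambda>\<omega>. 2 ^ k * (\<bar>X \<omega>\<bar> ^ k + \<bar>Y \<omega>\<bar> ^ k))"
      using X Y all_mom_abs by simp
    have "\<bar>(a + b) ^ k\<bar> \<le> 2 ^ k * (\<bar>a\<bar> ^ k + \<bar>b\<bar> ^ k)" for a b :: real
    proof -
      have "\<bar>a + b\<bar> ^ k \<le> (2 * max \<bar>a\<bar> \<bar>b\<bar>) ^ k" by (intro power_mono) auto
      also have "\<dots> = 2 ^ k * max \<bar>a\<bar> \<bar>b\<bar> ^ k" by (simp add: power_mult_distrib)
      also have "\<dots> \<le> 2 ^ k * (\<bar>a\<bar> ^ k + \<bar>b\<bar> ^ k)" by (intro mult_left_mono) (auto simp: max_def)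
      finally show ?thesis by (simp add: power_abs)
    qed
    then show "AE x in M. norm ((X x + Y x) ^ k) \<le> norm (2 ^ k * (\<bar>X x\<bar> ^ k + \<bar>Y x\<bar> ^ k))"
      by simp
  qed measurable
qed

lemma all_mom_sum: "(\<And>i. i \<in> S \<Longrightarrow> all_mom M (X i)) \<Longrightarrow> all_mom M (\<lambda>\<omega>. \<Sum>i\<in>S. X i \<omega>)"
  by (induction S rule: infinite_finite_induct) (auto intro: all_mom_const all_mom_add)

lemma all_mom_power: "all_mom M X \<Longrightarrow> all_mom M (\<lambda>\<omega>. X \<omega> ^ n)"
  by (induction n) (auto intro: all_mom_const all_mom_mult)

lemma all_mom_prod_list: "(\<And>e. e \<in> set es \<Longrightarrow> all_mom M (X e)) \<Longrightarrow> all_mom M (\<lambda>\<omega>. prod_list (map (\<lambda>e. X e \<omega>) es))"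
  by (induction es) (auto intro: all_mom_const all_mom_mult)

lemma fps_mom_mult:
  "(\<And>n. all_mom M (\<lambda>\<omega>. F \<omega> $ n)) \<Longrightarrow> (\<And>n. all_mom M (\<lambda>\<omega>. G \<omega> $ n)) \<Longrightarrow> all_mom M (\<lambda>\<omega>. (F \<omega> * G \<omega>) $ n)"
  unfolding fps_mult_nth by (intro all_mom_sum all_mom_mult)

lemma fps_mom_power:
  assumes "\<And>n. all_mom M (\<lambda>\<omega>. F \<omega> $ n)"
  shows "all_mom M (\<lambda>\<omega>. (F \<omega> ^ k) $ n)"
proof (induction k arbitrary: n)
  case (Suc k)
  show ?case unfolding power_Suc by (rule fps_mom_mult[OF assms Suc])
qed (auto intro: all_mom_const)

lemma expectation_prod_list:
  fixes Z :: "'e \<Rightarrow> 'a \<Rightarrow> real"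
  assumes ind: "indep_vars (\<lambda>_. borel) Z I" and es: "set es \<subseteq> I"
    and mom: "\<And>e. e \<in> I \<Longrightarrow> all_mom M (Z e)"
    and m: "\<And>e k. e \<in> I \<Longrightarrow> expectation (\<lambda>\<omega>. Z e \<omega> ^ k) = m k"
  shows "expectation (\<lambda>\<omega>. prod_list (map (\<lambda>e. Z e \<omega>) es)) = multi_wt m es"
proof -
  have pl: "prod_list (map f es) = (\<Prod>e\<in>set es. f e ^ count_list es e)" for f :: "'e \<Rightarrow> real"
    using prod_list_map_count[of "set es" es] by simp
  have "indep_vars (\<lambda>_. borel) (\<lambda>e \<omega>. Z e \<omega> ^ count_list es e) (set es)"
    by (rule indep_vars_compose2[where Y = "\<lambda>e x. x ^ count_list es e", OF indep_vars_subset[OF ind es]]) simp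
  then have "expectation (\<lambda>\<omega>. \<Prod>e\<in>set es. Z e \<omega> ^ count_list es e) = (\<Prod>e\<in>set es. expectation (\<lambda>\<omega>. Z e \<omega> ^ count_list es e))"
    using es mom by (intro indep_vars_lebesgue_integral) (auto simp: all_mom_def)
  also have "\<dots> = multi_wt m es" unfolding multi_wt_def using es m by (intro prod.cong) auto
  finally show ?thesis by (simp add: pl)
qed

end

text \<open>Every stack carries a weight. One product measure then serves all trees, and the weights
  of a subtree are a reindexed copy of the family.\<close>

locale tree_law =
  fixes \<nu> :: "real measure"
  assumes prob_nu: "prob_space \<nu>" and sets_nu: "sets \<nu> = sets borel"
    and mom_nu: "\<And>k. integrable \<nu> (\<lambda>x. x ^ k)"
begin

abbreviation T :: "(nat list \<Rightarrow> real) measure" where "T \<equiv> \<Pi>\<^sub>M l\<in>UNIV. \<nu>"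

sublocale PT: prob_space T
  by (rule prob_space_PiM) (rule prob_nu)

definition mnu :: "nat \<Rightarrow> real" where "mnu k = (\<integral>x. x ^ k \<partial>\<nu>)"

lemma coord_meas: "(\<lambda>A. A l) \<in> measurable T \<nu>"
  by (rule measurable_component_singleton) simp

lemma distr_coord: "distr T \<nu> (\<lambda>A. A l) = \<nu>"
  by (rule distr_PiM_component) (auto intro: prob_nu)

lemma coord_borel: "(\<lambda>A. A l) \<in> borel_measurable T"
  using coord_meas measurable_cong_sets[OF refl sets_nu] by blast

lemma coord_mom: "all_mom T (\<lambda>A. A l)"
  unfolding all_mom_def
proof (intro conjI allI coord_borel)
  fix k
  have "integrable (distr T \<nu> (\<lambda>A. A l)) (\<lambda>x. x ^ k)" unfolding distr_coord by (rule mom_nu)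
  then show "integrable T (\<lambda>A. A l ^ k)" by (rule integrable_distr[OF coord_meas])
qed

lemma coord_expectation: "(\<integral>A. A l ^ k \<partial>T) = mnu k"
proof -
  have "mnu k = (\<integral>x. x ^ k \<partial>distr T \<nu> (\<lambda>A. A l))" unfolding distr_coord mnu_def ..
  also have "\<dots> = (\<integral>A. A l ^ k \<partial>T)"
    by (rule integral_distr[OF coord_meas]) (simp add: measurable_cong_sets[OF sets_nu refl])
  finally show ?thesis by simp
qed

lemma indep_coord: "PT.indep_vars (\<lambda>_. \<nu>) (\<lambda>l A. A l) UNIV"
proof (subst PT.indep_vars_iff_distr_eq_PiM')
  show "distr T T (\<lambda>A. \<lambda>l\<in>UNIV. A l) = (\<Pi>\<^sub>M l\<in>UNIV. distr T \<nu> (\<lambda>A. A l))"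
    unfolding distr_coord by (simp add: restrict_UNIV distr_id2)
qed (auto intro: coord_meas)

lemma indep_coord_borel: "PT.indep_vars (\<lambda>_. borel) (\<lambda>l A. A l) UNIV"
  using PT.indep_vars_compose2[OF indep_coord, where Y = "\<lambda>_ x. x" and N = "\<lambda>_. borel"]
  by (simp add: measurable_cong_sets[OF sets_nu refl])

definition depends :: "((nat list \<Rightarrow> real) \<Rightarrow> 'b) \<Rightarrow> nat list set \<Rightarrow> bool" where
  "depends f K \<longleftrightarrow> (\<forall>A A'. (\<forall>l\<in>K. A l = A' l) \<longrightarrow> f A = f A')"

lemma dependsD: "depends f K \<Longrightarrow> (\<And>l. l \<in> K \<Longrightarrow> A l = A' l) \<Longrightarrow> f A = f A'"
  by (simp add: depends_def)

text \<open>Both functions factor through restrictions to disjoint sets of coordinates, which are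
  independent. Padding by 0 in \<open>ext\<close> makes these factorizations measurable.\<close>

lemma indep_expectation:
  fixes f g :: "(nat list \<Rightarrow> real) \<Rightarrow> real"
  assumes f: "all_mom T f" "depends f K" and g: "all_mom T g" "depends g K'" and disj: "K \<inter> K' = {}"
  shows "(\<integral>A. f A * g A \<partial>T) = (\<integral>A. f A \<partial>T) * (\<integral>A. g A \<partial>T)"
proof -
  define ext where "ext K B = (\<lambda>l. if l \<in> K then B l else 0)" for K and B :: "nat list \<Rightarrow> real"
  have ext_meas: "ext K \<in> measurable (\<Pi>\<^sub>M l\<in>K. \<nu>) T" for K
    unfolding ext_def
  proof (rule measurable_PiM_single')
    fix l :: "nat list"
    show "(\<lambda>B. if l \<in> K then B l else 0) \<in> measurable (\<Pi>\<^sub>M l\<in>K. \<nu>) \<nu>"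
      using sets_eq_imp_space_eq[OF sets_nu] by (cases "l \<in> K") (auto intro: measurable_component_singleton)
  qed (auto simp: space_PiM sets_eq_imp_space_eq[OF sets_nu])
  have f_eq: "f A = f (ext K (restrict A K))" for A
    using f(2) unfolding depends_def by (auto simp: ext_def)
  have g_eq: "g A = g (ext K' (restrict A K'))" for A
    using g(2) unfolding depends_def by (auto simp: ext_def)
  have "PT.indep_var (\<Pi>\<^sub>M l\<in>K. \<nu>) (\<lambda>A. restrict (\<lambda>l. A l) K) (\<Pi>\<^sub>M l\<in>K'. \<nu>) (\<lambda>A. restrict (\<lambda>l. A l) K')"
    by (rule PT.indep_var_restrict[OF indep_coord disj]) auto
  then have "PT.indep_var borel ((f \<circ> ext K) \<circ> (\<lambda>A. restrict (\<lambda>l. A l) K)) borel ((g \<circ> ext K') \<circ> (\<lambda>A. restrict (\<lambda>l. A l) K'))"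
    by (rule PT.indep_var_compose)
      (use f(1) g(1) in \<open>auto simp: all_mom_def intro!: measurable_comp[OF ext_meas]\<close>)
  moreover have "(f \<circ> ext K) \<circ> (\<lambda>A. restrict (\<lambda>l. A l) K) = f" using f_eq by (auto simp: fun_eq_iff)
  moreover have "(g \<circ> ext K') \<circ> (\<lambda>A. restrict (\<lambda>l. A l) K') = g" using g_eq by (auto simp: fun_eq_iff)
  ultimately have "PT.indep_var borel f borel g" by simp
  then show ?thesis
    using f(1) g(1) by (intro PT.indep_var_lebesgue_integral PT.all_mom_integrable) auto
qed

text \<open>A product of equal laws is invariant under injective reindexing. Subtrees thereby have
  the same expectations as the whole tree.\<close>

lemma shift_expectation:
  fixes f :: "(nat list \<Rightarrow> real) \<Rightarrow> real"
  assumes h: "inj h" and f: "f \<in> borel_measurable T"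
  shows "(\<integral>A. f (\<lambda>l. A (h l)) \<partial>T) = (\<integral>A. f A \<partial>T)"
proof -
  have "distr T T (\<lambda>A. \<lambda>l\<in>UNIV. A (h l)) = T"
    using distr_PiM_reindex[of UNIV "\<lambda>_. \<nu>" h UNIV] h prob_nu by auto
  then have d: "distr T T (\<lambda>A l. A (h l)) = T" by (simp add: restrict_UNIV)
  have meas: "(\<lambda>A l. A (h l)) \<in> measurable T T"
    by (rule measurable_PiM_single') (auto simp: space_PiM intro: coord_meas)
  have "(\<integral>A. f A \<partial>T) = (\<integral>A. f A \<partial>distr T T (\<lambda>A l. A (h l)))" unfolding d ..
  also have "\<dots> = (\<integral>A. f (\<lambda>l. A (h l)) \<partial>T)"
    by (rule integral_distr[OF meas f])
  finally show ?thesis by simp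
qed

text \<open>The reindexing \<open>h\<close> is part of the claim because recursive calls see the
  weights through \<open>j # l\<close>.\<close>

lemma gcoef_mom: "all_mom T (\<lambda>A. gcoef C n b (\<lambda>l. A (h l)))"
proof (induction n arbitrary: b h rule: less_induct)
  case (less n)
  show ?case
  proof (cases n)
    case (Suc k)
    show ?thesis unfolding Suc gcoef.simps
      using less Suc by (intro PT.all_mom_sum PT.all_mom_mult PT.all_mom_power coord_mom) auto
  qed (simp add: PT.all_mom_const)
qed

lemma Yf_mom: "all_mom T (\<lambda>A. Yf C b j (\<lambda>l. A (h l)) $ n)"
  unfolding Yf_def
  by (cases n) (auto simp: Gf_def intro!: PT.all_mom_const PT.all_mom_mult PT.all_mom_power coord_mom gcoef_mom)

lemma Lf_mom: "all_mom T (\<lambda>A. Lf C b J (\<lambda>l. A (h l)) $ n)"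
  unfolding Lf_def fps_sum_nth by (intro PT.all_mom_sum Yf_mom)

lemma Lf_power_mom: "all_mom T (\<lambda>A. (Lf C b J A ^ r) $ n)"
  using PT.fps_mom_power[OF Lf_mom[where h = "\<lambda>l. l"]] by simp

lemma Gf_power_mom: "all_mom T (\<lambda>A. (Gf C b (\<lambda>l. A (h l)) ^ r) $ n)"
  by (rule PT.fps_mom_power) (simp add: Gf_def gcoef_mom)

definition eL :: "(bool \<Rightarrow> nat set) \<Rightarrow> bool \<Rightarrow> nat set \<Rightarrow> nat \<Rightarrow> nat \<Rightarrow> real" where
  "eL C b J l r = (\<integral>A. (Lf C b J A ^ r) $ l \<partial>T)"

text \<open>The empty path names no edge. Applied above a child \<open>j\<close>, where it becomes
  \<open>[j]\<close>, this makes the weight of the edge to \<open>j\<close> independent of the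
  series of its subtree.\<close>

lemma gcoef_depends: "depends (gcoef C n b) (UNIV - {[]})"
proof -
  have eq: "gcoef C n b A = gcoef C n b A'" if A: "\<And>l. l \<noteq> [] \<Longrightarrow> A l = A' l" for A A'
  proof (induction n rule: less_induct)
    case (less n)
    show ?case
    proof (cases n)
      case (Suc k)
      have e: "(\<lambda>l. A (j # l)) = (\<lambda>l. A' (j # l))" "A [j] = A' [j]" for j using A by auto
      have "gcoef C (k - i) b A = gcoef C (k - i) b A'" for i by (rule less) (simp add: Suc)
      then show ?thesis unfolding Suc gcoef.simps e by simp
    qed simp
  qed
  show ?thesis
    unfolding depends_def
  proof (intro allI impI)
    fix A A' :: "nat list \<Rightarrow> real" assume "\<forall>l\<in>UNIV - {[]}. A l = A' l"
    then have "A l = A' l" if "l \<noteq> []" for l using that by simp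
    then show "gcoef C n b A = gcoef C n b A'" by (rule eq)
  qed
qed

lemma Gf_expectation:
  assumes "f \<ge> 1"
  shows "(\<integral>A. (Gf C b A ^ f) $ u \<partial>T) = (\<Sum>v=0..u. real ((f + v - 1) choose (f - 1)) * eL C b (C (\<not> b)) u v)"
  unfolding Gf_power_nth[OF assms] eL_def
  using PT.all_mom_integrable[OF Lf_power_mom] by (subst Bochner_Integration.integral_sum) auto

lemma eL_0: "eL C b J l 0 = (if l = 0 then 1 else 0)"
  by (simp add: eL_def PT.prob_space)

lemma eL_less:
  assumes "l < r" shows "eL C b J l r = 0"
proof -
  have "(Lf C b J A ^ r) $ l = 0" for A
    using startsby_zero_power_prefix[of "Lf C b J A" r] assms by simp
  then show ?thesis by (simp add: eL_def)
qed

text \<open>\<open>j\<close> is the child contributing to the first of the \<open>r\<close> factors and \<open>f\<close> the number of factors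
  to which it contributes.\<close>

lemma Lf_power_expand:
  assumes J: "finite J" and r: "r \<ge> 1"
  shows "Lf C b J A ^ r = (\<Sum>j\<in>J. \<Sum>f=1..r. of_nat ((r - 1) choose (f - 1)) * (Yf C b j A ^ f * Lf C b (J - {j}) A ^ (r - f)))"
proof -
  obtain k where k: "r = Suc k" using r by (cases r) auto
  have "Lf C b J A ^ r = (\<Sum>j\<in>J. Yf C b j A * Lf C b J A ^ k)"
    by (simp add: k Lf_def sum_distrib_right)
  also have "\<dots> = (\<Sum>j\<in>J. \<Sum>f=1..r. of_nat ((r - 1) choose (f - 1)) * (Yf C b j A ^ f * Lf C b (J - {j}) A ^ (r - f)))"
  proof (intro sum.cong refl)
    fix j assume "j \<in> J"
    then have "Lf C b J A = Yf C b j A + Lf C b (J - {j}) A"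
      using J by (simp add: Lf_def sum.remove)
    then have "Yf C b j A * Lf C b J A ^ k = (\<Sum>i\<le>k. of_nat (k choose i) * (Yf C b j A ^ Suc i * Lf C b (J - {j}) A ^ (k - i)))"
      by (simp only: binomial_ring sum_distrib_left) (intro sum.cong refl, simp add: mult_ac)
    also have "\<dots> = (\<Sum>f=1..r. of_nat ((r - 1) choose (f - 1)) * (Yf C b j A ^ f * Lf C b (J - {j}) A ^ (r - f)))"
      unfolding k by (rule sum.reindex_bij_witness[of _ "\<lambda>f. f - 1" Suc]) auto
    finally show "Yf C b j A * Lf C b J A ^ k = \<dots>" .
  qed
  finally show ?thesis .
qed

text \<open>In \<open>Lf_power_expand\<close> the edge to \<open>j\<close>, the subtree above it and
  the excursions through other children involve disjoint sets of weights, so the expectation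
  factorizes. The f crossings of that edge shift the coefficient by f and give the moment of order
  2f.\<close>

lemma eL_rec:
  assumes J: "finite J" and r: "1 \<le> r" "r \<le> l"
  shows "eL C b J l r = (\<Sum>j\<in>J. \<Sum>f=1..r. real ((r - 1) choose (f - 1)) * mnu (2 * f) *
      (\<Sum>u=0..l-r. eL C b (J - {j}) (l - u - f) (r - f) *
         (\<Sum>v=0..u. real ((f + v - 1) choose (f - 1)) * eL C (\<not> b) (C b) u v)))"
proof -
  let ?W = "\<lambda>f u. \<Sum>v=0..u. real ((f + v - 1) choose (f - 1)) * eL C (\<not> b) (C b) u v"
  let ?G = "\<lambda>j A. Gf C (\<not> b) (\<lambda>l. A (j # l))"
  define t where "t j f u A = (?G j A ^ f) $ u * (Lf C b (J - {j}) A ^ (r - f)) $ (l - f - u)"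
    for j f u and A :: "nat list \<Rightarrow> real"
  let ?I = "\<lambda>j f u. \<integral>A. A [j] ^ (2 * f) * t j f u A \<partial>T"
  have t_mom: "all_mom T (t j f u)" for j f u
    unfolding t_def by (intro PT.all_mom_mult Gf_power_mom Lf_power_mom)
  have coeff: "(Lf C b J A ^ r) $ l =
      (\<Sum>j\<in>J. \<Sum>f=1..r. real ((r - 1) choose (f - 1)) * (\<Sum>u=0..l-f. A [j] ^ (2 * f) * t j f u A))" for A
  proof -
    have Yp: "Yf C b j A ^ f * F = fps_X ^ f * (fps_const (A [j] ^ (2 * f)) * (Gf C (\<not> b) (\<lambda>l. A (j # l)) ^ f * F))" for j f and F :: "real fps"
      by (simp add: Yf_def power_mult_distrib fps_const_power power_mult mult.assoc)
    have "(Yf C b j A ^ f * Lf C b (J - {j}) A ^ (r - f)) $ l = (\<Sum>u=0..l-f. A [j] ^ (2 * f) * t j f u A)"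
      if "f \<in> {1..r}" for j f
      unfolding Yp using that r
      by (subst fps_X_power_mult_nth) (simp add: fps_mult_nth[of "Gf _ _ _ ^ _"] t_def sum_distrib_left)
    then show ?thesis
      unfolding Lf_power_expand[OF J r(1)]
      by (simp add: fps_sum_nth fps_of_nat[symmetric] del: fps_of_nat)
  qed
  have term_eq: "?I j f u
      = mnu (2 * f) * (?W f u * eL C b (J - {j}) (l - f - u) (r - f))"
    if f: "f \<ge> 1" for j f u
  proof -
    have G_dep: "depends (\<lambda>A. (?G j A ^ f) $ u) {j # l | l. l \<noteq> []}"
    proof -
      have "?G j A = ?G j A'"
        if "\<forall>l\<in>{j # l | l. l \<noteq> []}. A l = A' l" for A A' :: "nat list \<Rightarrow> real"
      proof -
        have "gcoef C n (\<not> b) (\<lambda>l. A (j # l)) = gcoef C n (\<not> b) (\<lambda>l. A' (j # l))" for n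
        proof -
          have "A (j # l) = A' (j # l)" if "l \<in> UNIV - {[]}" for l
            using that \<open>\<forall>l\<in>_. A l = A' l\<close> by simp
          then show ?thesis by (rule dependsD[OF gcoef_depends])
        qed
        then show ?thesis by (simp add: Gf_def)
      qed
      then show ?thesis unfolding depends_def by (intro allI impI arg_cong[where f = "\<lambda>F. (F ^ f) $ u"])
    qed
    have L_dep: "depends (\<lambda>A. (Lf C b (J - {j}) A ^ (r - f)) $ n) {i # l | i l. i \<noteq> j}" for n
    proof -
      have "Lf C b (J - {j}) A = Lf C b (J - {j}) A'"
        if "\<forall>l\<in>{i # l | i l. i \<noteq> j}. A l = A' l" for A A' :: "nat list \<Rightarrow> real"
        unfolding Lf_def
      proof (intro sum.cong refl)
        fix i assume "i \<in> J - {j}"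
        then have "A (i # l) = A' (i # l)" for l using that by blast
        then show "Yf C b i A = Yf C b i A'" by (simp add: Yf_def)
      qed
      then show ?thesis unfolding depends_def by (intro allI impI arg_cong[where f = "\<lambda>F. (F ^ (r - f)) $ n"])
    qed
    have t_dep: "depends (t j f u) (UNIV - {[j]})"
      unfolding depends_def t_def
    proof (intro allI impI arg_cong2[where f = "(*)"])
      fix A A' :: "nat list \<Rightarrow> real" assume A: "\<forall>l\<in>UNIV - {[j]}. A l = A' l"
      show "(?G j A ^ f) $ u = (?G j A' ^ f) $ u"
        by (rule dependsD[OF G_dep]) (use A in auto)
      show "(Lf C b (J - {j}) A ^ (r - f)) $ (l - f - u) = (Lf C b (J - {j}) A' ^ (r - f)) $ (l - f - u)"
        by (rule dependsD[OF L_dep]) (use A in auto)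
    qed
    have "?I j f u = (\<integral>A. A [j] ^ (2 * f) \<partial>T) * (\<integral>A. t j f u A \<partial>T)"
      by (rule indep_expectation[OF _ _ t_mom t_dep, of _ "{[j]}"])
         (auto simp: depends_def intro: PT.all_mom_power coord_mom)
    also have "(\<integral>A. A [j] ^ (2 * f) \<partial>T) = mnu (2 * f)" by (rule coord_expectation)
    also have "(\<integral>A. t j f u A \<partial>T) = (\<integral>A. (?G j A ^ f) $ u \<partial>T) * eL C b (J - {j}) (l - f - u) (r - f)"
      unfolding t_def eL_def by (rule indep_expectation[OF Gf_power_mom G_dep Lf_power_mom L_dep]) auto
    also have "(\<integral>A. (?G j A ^ f) $ u \<partial>T) = (\<integral>A. (Gf C (\<not> b) A ^ f) $ u \<partial>T)"
      by (rule shift_expectation[where h = "(#) j" and f = "\<lambda>A. (Gf C (\<not> b) A ^ f) $ u"])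
         (use Gf_power_mom[where h = "\<lambda>l. l"] in \<open>auto simp: all_mom_def\<close>)
    also have "\<dots> = ?W f u"
      using Gf_expectation[OF f, of C "\<not> b" u] by simp
    finally show ?thesis .
  qed
  have int: "integrable T (\<lambda>A. A [j] ^ (2 * f) * t j f u A)" for j f u
    by (intro PT.all_mom_integrable PT.all_mom_mult PT.all_mom_power coord_mom t_mom)
  have "eL C b J l r = (\<Sum>j\<in>J. \<Sum>f=1..r. real ((r - 1) choose (f - 1)) * (\<Sum>u=0..l-f. ?I j f u))"
    unfolding eL_def coeff using int by (simp add: Bochner_Integration.integral_sum)
  also have "\<dots> = (\<Sum>j\<in>J. \<Sum>f=1..r. real ((r - 1) choose (f - 1)) * mnu (2 * f) *
      (\<Sum>u=0..l-r. eL C b (J - {j}) (l - u - f) (r - f) *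
         ?W f u))"
  proof (intro sum.cong refl)
    fix j f assume f: "f \<in> {1..r}"
    \<comment> \<open>The remaining r - f excursions need degree at least r - f, which leaves at
      most l - r for the subtree of \<open>j\<close>.\<close>
    have "(\<Sum>u=0..l-f. ?I j f u) = (\<Sum>u=0..l-r. ?I j f u)"
    proof (rule sum.mono_neutral_right)
      show "\<forall>u\<in>{0..l-f} - {0..l-r}. ?I j f u = 0"
      proof
        fix u assume "u \<in> {0..l-f} - {0..l-r}"
        then have "l - f - u < r - f" using f r by auto
        then show "?I j f u = 0" using f by (simp add: term_eq eL_less)
      qed
    qed (use f r in auto)
    also have "\<dots> = mnu (2 * f) * (\<Sum>u=0..l-r. eL C b (J - {j}) (l - u - f) (r - f) *
         ?W f u)"
      unfolding sum_distrib_left[of "mnu (2 * f)"]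
    proof (intro sum.cong refl)
      fix u
      have "f \<ge> 1" using f by simp
      then show "?I j f u = mnu (2 * f) * (eL C b (J - {j}) (l - u - f) (r - f) *
         ?W f u)"
        using diff_commute[of l f u] by (simp add: term_eq)
    qed
    finally show "real ((r - 1) choose (f - 1)) * (\<Sum>u=0..l-f. ?I j f u)
      = real ((r - 1) choose (f - 1)) * mnu (2 * f) * (\<Sum>u=0..l-r. eL C b (J - {j}) (l - u - f) (r - f) *
         ?W f u)"
      by simp
  qed
  finally show ?thesis .
qed

end

text \<open>Finite-size version of the recursion for \<open>S\<close>: the root has \<open>k\<close> children, every other
  vertex of class \<open>b\<close> has \<open>n b\<close> children.\<close>

function SF :: "(nat \<Rightarrow> real) \<Rightarrow> (bool \<Rightarrow> nat) \<Rightarrow> bool \<Rightarrow> nat \<Rightarrow> nat \<Rightarrow> nat \<Rightarrow> real" where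
  "SF m n b k l r =
     (if r = 0 then (if l = 0 then 1 else 0)
      else if l < r then 0
      else real k * (\<Sum>f=1..r. real ((r - 1) choose (f - 1)) * m (2 * f) *
             (\<Sum>u=0..l-r. SF m n b (k - 1) (l - u - f) (r - f) *
                (\<Sum>v=0..u. real ((f + v - 1) choose (f - 1)) * SF m n (\<not> b) (n (\<not> b)) u v))))"
  by pat_completeness auto
termination
  by (relation "Wellfounded.measure (\<lambda>(m, n, b, k, l, r). l)") auto

declare SF.simps [simp del] Snum.simps [simp del]

text \<open>By symmetry \<open>J\<close> matters only through its size: all children give the same
  term, the sum over \<open>J\<close> becomes a factor, and \<open>J - {j}\<close> becomes
  \<open>k - 1\<close>.\<close>

lemma (in tree_law) eL_eq_SF:
  assumes fin: "\<And>b. finite (C b)" and J: "finite J"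
  shows "eL C b J l r = SF mnu (\<lambda>b. card (C (\<not> b))) b (card J) l r"
  using J
proof (induction l arbitrary: b J r rule: less_induct)
  case (less l)
  show ?case
  proof (cases "r = 0 \<or> l < r")
    case True
    then show ?thesis by (subst SF.simps) (auto simp: eL_0 eL_less)
  next
    case False
    then have r: "1 \<le> r" "r \<le> l" by auto
    show ?thesis
      unfolding eL_rec[OF less.prems r] SF.simps[of _ _ _ _ l r]
      using less r fin
      by (simp add: sum_distrib_left[symmetric] card_Diff_singleton)
  qed
qed

section \<open>The limiting recursion\<close>

text \<open>\<open>SF\<close> starts from a fixed root, whereas \<open>Snum\<close> includes the
  frequency \<open>fr b\<close> of the root class; hence the quotient. One child fewer is negligible
  on the scale N.\<close>

lemma SF_tendsto:
  fixes m :: "nat \<Rightarrow> nat \<Rightarrow> real" and n :: "nat \<Rightarrow> bool \<Rightarrow> nat" and fr :: "bool \<Rightarrow> real"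
  assumes fr: "fr True = \<alpha>" "fr False = 1 - \<alpha>" and pos: "\<And>b. fr b > 0"
    and m: "\<And>f. f \<ge> 1 \<Longrightarrow> (\<lambda>N. real N * m N (2 * f)) \<longlonglongrightarrow> p * X (2 * f)"
    and n: "\<And>b. (\<lambda>N. real (n N b) / real N) \<longlonglongrightarrow> fr (\<not> b)"
    and k: "(\<lambda>N. real (k N) / real N) \<longlonglongrightarrow> fr (\<not> b)"
  shows "(\<lambda>N. SF (m N) (n N) b (k N) l r) \<longlonglongrightarrow> Snum p \<alpha> X b l r / fr b"
  using k
proof (induction l arbitrary: b k r rule: less_induct)
  case (less l)
  have fb: "fr b = (if b then \<alpha> else 1 - \<alpha>)" using fr by simp
  show ?case
  proof (cases "r = 0 \<or> l < r")
    case True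
    then show ?thesis unfolding SF.simps[of _ _ _ _ l r] Snum.simps[of _ _ _ _ l r]
      using pos[of b] fb by (auto split: if_splits)
  next
    case False
    then have r: "r \<noteq> 0" "\<not> l < r" by auto
    let ?A = "\<lambda>N. \<Sum>f=1..r. real ((r - 1) choose (f - 1)) * ((real (k N) / real N) * (real N * m N (2 * f))) *
             (\<Sum>u=0..l-r. SF (m N) (n N) b (k N - 1) (l - u - f) (r - f) *
                (\<Sum>v=0..u. real ((f + v - 1) choose (f - 1)) * SF (m N) (n N) (\<not> b) (n N (\<not> b)) u v))"
    let ?B = "\<Sum>f=1..r. real ((r - 1) choose (f - 1)) * (fr (\<not> b) * (p * X (2 * f))) *
             (\<Sum>u=0..l-r. (Snum p \<alpha> X b (l - u - f) (r - f) / fr b) *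
                (\<Sum>v=0..u. real ((f + v - 1) choose (f - 1)) * (Snum p \<alpha> X (\<not> b) u v / fr (\<not> b))))"
    have km: "(\<lambda>N. real (k N - 1) / real N) \<longlonglongrightarrow> fr (\<not> b)"
    proof (rule tendsto_sandwich)
      show "(\<lambda>N. real (k N) / real N - 1 / real N) \<longlonglongrightarrow> fr (\<not> b)"
        using tendsto_diff[OF less.prems lim_1_over_n] by simp
      show "(\<lambda>N. real (k N) / real N) \<longlonglongrightarrow> fr (\<not> b)" by (rule less.prems)
      show "\<forall>\<^sub>F N in sequentially. real (k N) / real N - 1 / real N \<le> real (k N - 1) / real N"
        by (intro always_eventually allI) (simp add: diff_divide_distrib[symmetric] divide_right_mono)
      show "\<forall>\<^sub>F N in sequentially. real (k N - 1) / real N \<le> real (k N) / real N"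
        by (intro always_eventually allI) (simp add: divide_right_mono)
    qed
    have nb: "(\<lambda>N. real (n N (\<not> b)) / real N) \<longlonglongrightarrow> fr (\<not> \<not> b)" using n[of "\<not> b"] by simp
    have lim: "(\<lambda>N. ?A N)
       \<longlonglongrightarrow> ?B"
      using r by (intro tendsto_sum tendsto_mult tendsto_const less.prems m less.IH km nb) auto
    \<comment> \<open>The factor \<open>fr (\<not> b)\<close>, the relative number of children,
      cancels the denominator that belongs to the subtree of the child.\<close>
    have val: "?B
        = Snum p \<alpha> X b l r / fr b"
    proof -
      have nz: "fr b \<noteq> 0" "fr (\<not> b) \<noteq> 0" using pos[of b] pos[of "\<not> b"] by auto
      have "Snum p \<alpha> X b l r / fr b = (\<Sum>f=1..r. real ((r - 1) choose (f - 1)) * (p * X (2 * f)) *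
             (\<Sum>u=0..l-r. (Snum p \<alpha> X b (l - u - f) (r - f) / fr b) *
                (\<Sum>v=0..u. real ((f + v - 1) choose (f - 1)) * Snum p \<alpha> X (\<not> b) u v)))"
        using r by (subst Snum.simps) (simp add: sum_distrib_left sum_divide_distrib mult_ac)
      also have "\<dots> = ?B"
        using nz by (simp add: sum_divide_distrib[symmetric] times_divide_eq_right[symmetric] del: times_divide_eq_right)
          (simp add: sum_divide_distrib[symmetric] mult.assoc)
      finally show ?thesis by simp
    qed
    show ?thesis
    proof (rule Lim_transform_eventually[OF lim[unfolded val]])
      show "\<forall>\<^sub>F N in sequentially. ?A N
          = SF (m N) (n N) b (k N) l r"
        using eventually_gt_at_top[of 0]
      proof eventually_elim
        case (elim N)
        then have e: "real (k N) / real N * (real N * x) = real (k N) * x" for x by simp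
        show ?case
          using r unfolding e by (subst (3) SF.simps) (simp add: sum_distrib_left mult_ac)
      qed
    qed
  qed
qed

section \<open>Growth of the limit coefficients\<close>

lemma choose_ge_self: "1 \<le> u \<Longrightarrow> u < n \<Longrightarrow> n \<le> n choose u"
proof (induction n)
  case (Suc n)
  obtain w where w: "u = Suc w" using Suc by (cases u) auto
  show ?case
  proof (cases "u = n")
    case True
    then show ?thesis by (simp add: binomial_Suc_n)
  next
    case False
    then have "n \<le> n choose u" using Suc by simp
    moreover have "1 \<le> n choose w" using w Suc by (simp add: Suc_le_eq)
    ultimately show ?thesis using w by simp
  qed
qed auto

text \<open>For positive n the two end terms are at most 1 each and the n - 1 inner ones at most 1/n
  each.\<close>

lemma sum_inverse_choose: "(\<Sum>u=0..n. 1 / real (n choose u)) \<le> 3"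
proof (cases "n = 0")
  case False
  show ?thesis
  proof -
    have "(\<Sum>u=0..n. 1 / real (n choose u)) = 1 + (\<Sum>u=1..n. 1 / real (n choose u))"
      by (simp add: sum.atLeast_Suc_atMost)
    also have "\<dots> = 1 + ((\<Sum>u=1..<n. 1 / real (n choose u)) + 1)"
      using False by (simp add: sum.last_plus)
    also have "(\<Sum>u=1..<n. 1 / real (n choose u)) \<le> (\<Sum>u=1..<n. 1 / real n)"
      using choose_ge_self[of _ n] by (intro sum_mono divide_left_mono) auto
    also have "\<dots> \<le> 1" using False by (simp add: field_simps)
    finally show ?thesis by simp
  qed
qed simp

text \<open>The multinomial coefficient l! / g splits as (l choose f) ((l-f) choose u) and as ((f+u)
  choose f) (l choose (f+u)). One copy of l! absorbs (r-1) choose (f-1), which is at most l choose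
  f, together with (l-f) choose u; the other absorbs (f+u) choose f.\<close>

lemma choose_fact_bound:
  assumes "1 \<le> f" "f \<le> r" "r \<le> l" "u \<le> l - r"
  shows "((r - 1) choose (f - 1)) * (fact f)\<^sup>2 * (fact (l - u - f))\<^sup>2 * (fact u)\<^sup>2 * ((f + u) choose f) * ((l - f) choose u)
      \<le> (fact l :: nat)\<^sup>2"
proof -
  define g where "g = fact f * fact u * (fact (l - u - f) :: nat)"
  have e: "l - f - u = l - u - f" "l - (f + u) = l - u - f" by auto
  have "fact f * fact (l - f) * (l choose f) = fact l"
    using assms by (intro binomial_fact_lemma) auto
  moreover have "fact u * fact (l - f - u) * ((l - f) choose u) = fact (l - f)"
    using assms by (intro binomial_fact_lemma) auto
  ultimately have "fact l = fact f * (fact u * fact (l - u - f) * ((l - f) choose u)) * (l choose f)"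
    by (simp add: e)
  then have A: "g * (l choose f) * ((l - f) choose u) = fact l"
    by (simp add: g_def mult_ac)
  have "fact (f + u) * fact (l - (f + u)) * (l choose (f + u)) = fact l"
    using assms by (intro binomial_fact_lemma) auto
  moreover have "fact f * fact (f + u - f) * ((f + u) choose f) = fact (f + u)"
    by (intro binomial_fact_lemma) auto
  ultimately have "fact l = (fact f * fact u * ((f + u) choose f)) * fact (l - u - f) * (l choose (f + u))"
    by (simp add: e)
  then have B: "g * ((f + u) choose f) * (l choose (f + u)) = fact l"
    by (simp add: g_def mult_ac)
  have "1 \<le> l choose (f + u)" using assms by (simp add: Suc_le_eq)
  then have B': "g * ((f + u) choose f) \<le> fact l" using B mult_le_mono2[of 1 "l choose (f + u)" "g * ((f + u) choose f)"] by simp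
  have "(r - 1) choose (f - 1) \<le> (l - 1) choose (f - 1)" using assms by (intro binomial_right_mono) auto
  also have "\<dots> \<le> l choose f" using assms by (cases l; cases f) auto
  finally have A': "g * ((r - 1) choose (f - 1)) * ((l - f) choose u) \<le> fact l"
    using A by (metis mult_le_mono1 mult_le_mono2)
  have "((r - 1) choose (f - 1)) * (fact f)\<^sup>2 * (fact (l - u - f))\<^sup>2 * (fact u)\<^sup>2 * ((f + u) choose f) * ((l - f) choose u)
     = (g * ((r - 1) choose (f - 1)) * ((l - f) choose u)) * (g * ((f + u) choose f))"
    by (simp add: g_def power2_eq_square mult_ac)
  also have "\<dots> \<le> fact l * fact l" by (intro mult_le_mono A' B')
  finally show ?thesis by (simp add: power2_eq_square)
qed

text \<open>Hockey-stick identity; it disposes of the sum over v in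
  \<open>Snum_bound\<close>.\<close>

lemma sum_choose_shift: "f \<ge> 1 \<Longrightarrow> (\<Sum>v=0..u. ((f + v - 1) choose (f - 1))) = (f + u) choose f"
proof (induction u)
  case (Suc u)
  obtain g where "f = Suc g" using Suc by (cases f) auto
  then show ?case using Suc by simp
qed simp

text \<open>The factors \<open>1 / binomial\<close> gained from \<open>choose_fact_bound\<close> make the sum over \<open>u\<close> bounded,
  so that the constant does not grow with the depth of the recursion.\<close>

lemma Snum_bound:
  fixes p \<alpha> c K :: real
  assumes \<alpha>: "0 \<le> \<alpha>" "\<alpha> \<le> 1" and p: "p > 0" and c: "c > 0"
    and X: "\<And>f. f \<ge> 1 \<Longrightarrow> \<bar>X (2 * f)\<bar> \<le> c ^ f * (fact f)\<^sup>2"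
    and K: "K = c * (1 + 3 * p)"
  shows "\<bar>Snum p \<alpha> X b l r\<bar> \<le> K ^ l * (fact l)\<^sup>2"
proof (induction l arbitrary: b r rule: less_induct)
  case (less l)
  have K0: "K > 0" using K c p by simp
  show ?case
  proof (cases "r = 0 \<or> l < r")
    case True
    then show ?thesis using \<alpha> K0 by (subst Snum.simps) (auto simp: abs_if)
  next
    case False
    then have r: "r \<noteq> 0" "\<not> l < r" by auto
    let ?V = "\<lambda>f u. \<Sum>v=0..u. real ((f + v - 1) choose (f - 1)) * Snum p \<alpha> X (\<not> b) u v"
    have inner: "\<bar>?V f u\<bar>
        \<le> real ((f + u) choose f) * (K ^ u * (fact u)\<^sup>2)" if "u \<in> {0..l - r}" "f \<in> {1..r}" for u f
    proof -
      have "\<bar>?V f u\<bar>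
          \<le> (\<Sum>v=0..u. real ((f + v - 1) choose (f - 1)) * (K ^ u * (fact u)\<^sup>2))"
        using that r
        by (intro order_trans[OF sum_abs] sum_mono) (auto simp: abs_mult intro!: mult_left_mono less)
      also have "\<dots> = real (\<Sum>v=0..u. (f + v - 1) choose (f - 1)) * (K ^ u * (fact u)\<^sup>2)"
        by (simp add: sum_distrib_right)
      also have "(\<Sum>v=0..u. (f + v - 1) choose (f - 1)) = (f + u) choose f"
        by (rule sum_choose_shift) (use that in auto)
      finally show ?thesis .
    qed
    have term_bound: "real ((r - 1) choose (f - 1)) * \<bar>X (2 * f)\<bar> *
             \<bar>\<Sum>u=0..l-r. Snum p \<alpha> X b (l - u - f) (r - f) *
                ?V f u\<bar>
          \<le> 3 * (c / K) ^ f * (K ^ l * (fact l)\<^sup>2)" if f: "f \<in> {1..r}" for f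
    proof -
      have "real ((r - 1) choose (f - 1)) * \<bar>X (2 * f)\<bar> *
             \<bar>\<Sum>u=0..l-r. Snum p \<alpha> X b (l - u - f) (r - f) *
                ?V f u\<bar>
        \<le> real ((r - 1) choose (f - 1)) * (c ^ f * (fact f)\<^sup>2) *
             (\<Sum>u=0..l-r. (K ^ (l - u - f) * (fact (l - u - f))\<^sup>2) * (real ((f + u) choose f) * (K ^ u * (fact u)\<^sup>2)))"
        using f X[of f] K0 c r
        by (intro mult_mono mult_nonneg_nonneg order_trans[OF sum_abs] sum_mono sum_nonneg)
           (auto simp: abs_mult intro!: mult_mono less inner[simplified])
      also have "\<dots> = (\<Sum>u=0..l-r. c ^ f * K ^ (l - f) *
           real (((r - 1) choose (f - 1)) * (fact f)\<^sup>2 * (fact (l - u - f))\<^sup>2 * (fact u)\<^sup>2 * ((f + u) choose f)))"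
        unfolding sum_distrib_left
      proof (intro sum.cong refl)
        fix u assume "u \<in> {0..l - r}"
        then have "l - f = (l - u - f) + u" using f r by auto
        then have "K ^ (l - f) = K ^ (l - u - f) * K ^ u" by (metis power_add)
        then show "real ((r - 1) choose (f - 1)) * (c ^ f * (fact f)\<^sup>2) *
            ((K ^ (l - u - f) * (fact (l - u - f))\<^sup>2) * (real ((f + u) choose f) * (K ^ u * (fact u)\<^sup>2)))
          = c ^ f * K ^ (l - f) *
           real (((r - 1) choose (f - 1)) * (fact f)\<^sup>2 * (fact (l - u - f))\<^sup>2 * (fact u)\<^sup>2 * ((f + u) choose f))"
          by (simp add: mult_ac)
      qed
      also have "\<dots> \<le> (\<Sum>u=0..l-r. c ^ f * K ^ (l - f) * ((fact l)\<^sup>2 * (1 / real ((l - f) choose u))))"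
      proof (intro sum_mono mult_left_mono)
        fix u assume u: "u \<in> {0..l - r}"
        have pos: "0 < (l - f) choose u" using u f r by auto
        have "real (((r - 1) choose (f - 1)) * (fact f)\<^sup>2 * (fact (l - u - f))\<^sup>2 * (fact u)\<^sup>2 * ((f + u) choose f) * ((l - f) choose u)) \<le> real ((fact l)\<^sup>2)"
          using u f r by (intro of_nat_mono choose_fact_bound) auto
        then show "real (((r - 1) choose (f - 1)) * (fact f)\<^sup>2 * (fact (l - u - f))\<^sup>2 * (fact u)\<^sup>2 * ((f + u) choose f))
            \<le> (fact l)\<^sup>2 * (1 / real ((l - f) choose u))"
          using pos by (simp add: pos_le_divide_eq)
      qed (use c K0 in auto)
      also have "\<dots> = c ^ f * K ^ (l - f) * (fact l)\<^sup>2 * (\<Sum>u=0..l-r. 1 / real ((l - f) choose u))"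
        by (simp add: sum_distrib_left)
      also have "\<dots> \<le> c ^ f * K ^ (l - f) * (fact l)\<^sup>2 * (\<Sum>u=0..l-f. 1 / real ((l - f) choose u))"
        using f c K0 by (intro mult_left_mono sum_mono2) auto
      also have "\<dots> \<le> c ^ f * K ^ (l - f) * (fact l)\<^sup>2 * 3"
        using c K0 by (intro mult_left_mono sum_inverse_choose) auto
      also have "c ^ f * K ^ (l - f) = (c / K) ^ f * K ^ l"
      proof -
        have "K ^ l = K ^ f * K ^ (l - f)" using f r by (simp add: power_add[symmetric])
        then show ?thesis using K0 by (simp add: power_divide)
      qed
      finally show ?thesis by (simp add: mult_ac)
    qed
    have "\<bar>Snum p \<alpha> X b l r\<bar> = p * \<bar>\<Sum>f=1..r. real ((r - 1) choose (f - 1)) * X (2 * f) *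
             (\<Sum>u=0..l-r. Snum p \<alpha> X b (l - u - f) (r - f) *
                ?V f u)\<bar>"
      using r p by (subst Snum.simps) (simp add: abs_mult)
    also have "\<dots> \<le> p * (\<Sum>f=1..r. 3 * (c / K) ^ f * (K ^ l * (fact l)\<^sup>2))"
      using p term_bound
      by (intro mult_left_mono order_trans[OF sum_abs] sum_mono) (auto simp: abs_mult)
    also have "\<dots> = (3 * p * (\<Sum>f=1..r. (c / K) ^ f)) * (K ^ l * (fact l)\<^sup>2)"
      by (simp add: sum_distrib_left sum_distrib_right mult_ac)
    also have "\<dots> \<le> 1 * (K ^ l * (fact l)\<^sup>2)"
    proof (intro mult_right_mono)
      \<comment> \<open>The choice of \<open>K\<close> makes 3p times the infinite series of x^f
        over f >= 1 equal to 1, which closes the induction.\<close>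
      define x where "x = c / K"
      have x: "x = 1 / (1 + 3 * p)" using c p by (simp add: x_def K)
      have geo: "(\<Sum>f=1..r. x ^ f) * (3 * p) = 1 - x ^ r"
      proof (induction r)
        case (Suc r)
        have "x * (1 + 3 * p) = 1" using p by (simp add: x)
        then have "x ^ Suc r * (1 + 3 * p) = x ^ r" by (metis mult.assoc mult.commute mult_1_right power_Suc2)
        then show ?case using Suc by (simp add: algebra_simps)
      qed simp
      have "x ^ r \<ge> 0" using p by (simp add: x)
      then show "3 * p * (\<Sum>f=1..r. (c / K) ^ f) \<le> 1" using geo by (simp add: x_def mult_ac)
    qed (use K0 in auto)
    finally show ?thesis by simp
  qed
qed

section \<open>Eigenvalues of symmetric matrices\<close>

text \<open>The quadratic form S = v* A v equals c |v|^2, and symmetry makes S equal to its own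
  conjugate.\<close>

lemma real_symmetric_eigenvalue_real:
  fixes A :: "real mat" and c :: complex
  assumes A: "A \<in> carrier_mat n n" and sym: "\<And>i j. i < n \<Longrightarrow> j < n \<Longrightarrow> A $$ (i, j) = A $$ (j, i)"
    and ev: "eigenvalue (map_mat complex_of_real A) c"
  shows "c \<in> \<real>"
proof -
  obtain v where v: "v \<in> carrier_vec n" "v \<noteq> 0\<^sub>v n" "map_mat complex_of_real A *\<^sub>v v = c \<cdot>\<^sub>v v"
    using ev A by (auto simp: eigenvalue_def eigenvector_def)
  define x where "x i = vec_index v i" for i
  have row: "(\<Sum>j<n. complex_of_real (A $$ (i, j)) * x j) = c * x i" if i: "i < n" for i
  proof -
    have "vec_index (map_mat complex_of_real A *\<^sub>v v) i = vec_index (c \<cdot>\<^sub>v v) i" using v(3) by simp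
    then show ?thesis using i A v(1)
      by (simp add: scalar_prod_def x_def atLeast0LessThan)
  qed
  define S where "S = (\<Sum>i<n. \<Sum>j<n. cnj (x i) * complex_of_real (A $$ (i, j)) * x j)"
  have "S = c * (\<Sum>i<n. complex_of_real ((cmod (x i))\<^sup>2))"
    unfolding S_def sum_distrib_left
  proof (intro sum.cong refl)
    fix i assume "i \<in> {..<n}"
    then have "(\<Sum>j<n. cnj (x i) * complex_of_real (A $$ (i, j)) * x j) = cnj (x i) * (c * x i)"
      using row[of i] by (simp add: sum_distrib_left[symmetric] mult.assoc)
    also have "\<dots> = c * complex_of_real ((cmod (x i))\<^sup>2)"
      by (simp only: complex_norm_square) (simp add: mult_ac)
    finally show "(\<Sum>j<n. cnj (x i) * complex_of_real (A $$ (i, j)) * x j) = c * complex_of_real ((cmod (x i))\<^sup>2)" .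
  qed
  then have S: "S = c * complex_of_real (\<Sum>i<n. (cmod (x i))\<^sup>2)" by simp
  have "cnj S = (\<Sum>i<n. \<Sum>j<n. x i * complex_of_real (A $$ (i, j)) * cnj (x j))"
    by (simp add: S_def)
  also have "\<dots> = (\<Sum>j<n. \<Sum>i<n. x i * complex_of_real (A $$ (i, j)) * cnj (x j))"
    by (rule sum.swap)
  also have "\<dots> = S" unfolding S_def
    by (intro sum.cong refl) (simp add: sym mult_ac)
  finally have "cnj c * complex_of_real (\<Sum>i<n. (cmod (x i))\<^sup>2) = c * complex_of_real (\<Sum>i<n. (cmod (x i))\<^sup>2)"
    unfolding S by simp
  moreover have "(\<Sum>i<n. (cmod (x i))\<^sup>2) \<noteq> 0"
  proof
    assume "(\<Sum>i<n. (cmod (x i))\<^sup>2) = 0"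
    then have "\<forall>i\<in>{..<n}. (cmod (x i))\<^sup>2 = 0" by (subst (asm) sum_nonneg_eq_0_iff) auto
    then have "v = 0\<^sub>v n" using v(1) by (intro eq_vecI) (auto simp: x_def)
    then show False using v(2) by simp
  qed
  ultimately have "cnj c = c" by (metis mult_right_cancel of_real_eq_0_iff)
  then show ?thesis by (simp add: Reals_cnj_iff)
qed

lemma real_symmetric_char_poly:
  fixes A :: "real mat"
  assumes A: "A \<in> carrier_mat n n" and sym: "\<And>i j. i < n \<Longrightarrow> j < n \<Longrightarrow> A $$ (i, j) = A $$ (j, i)"
  obtains es where "char_poly A = (\<Prod>e\<leftarrow>es. [:- e, 1:])" "length es = n"
proof -
  interpret h: map_poly_inj_idom_hom complex_of_real ..
  let ?B = "map_mat complex_of_real A"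
  have B: "?B \<in> carrier_mat n n" using A by auto
  obtain cs where cs: "char_poly ?B = (\<Prod>a\<leftarrow>cs. [:- a, 1:])" "length cs = n"
    using char_poly_factorized[OF B] by auto
  have real: "c \<in> \<real>" if "c \<in> set cs" for c
  proof (rule real_symmetric_eigenvalue_real[OF A sym])
    have "poly (char_poly ?B) c = 0" unfolding cs(1) using that
      by (induction cs) (auto simp: poly_prod_list)
    then show "eigenvalue ?B c" using eigenvalue_root_char_poly[OF B] by simp
  qed
  define es where "es = map Re cs"
  have "map complex_of_real es = cs"
    unfolding es_def using real by (simp add: map_idI)
  then have "map_poly complex_of_real (\<Prod>e\<leftarrow>es. [:- e, 1:]) = (\<Prod>a\<leftarrow>cs. [:- a, 1:])"
    by (simp add: h.hom_prod_list o_def flip: \<open>map complex_of_real es = cs\<close>)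
  also have "\<dots> = map_poly complex_of_real (char_poly A)"
    unfolding cs(1)[symmetric] by (rule of_real_hom.char_poly_hom[OF A])
  finally have "char_poly A = (\<Prod>e\<leftarrow>es. [:- e, 1:])"
    by (simp add: h.eq_iff)
  then show ?thesis using that[of es] cs(2) by (simp add: es_def)
qed

lemma trace_mult_commute:
  fixes P Q :: "real mat"
  assumes "P \<in> carrier_mat n n" "Q \<in> carrier_mat n n"
  shows "(\<Sum>i<n. (P * Q) $$ (i, i)) = (\<Sum>i<n. (Q * P) $$ (i, i))"
proof -
  have "(\<Sum>i<n. (P * Q) $$ (i, i)) = (\<Sum>i<n. \<Sum>j<n. P $$ (i, j) * Q $$ (j, i))"
    using assms by (intro sum.cong refl) (simp add: scalar_prod_def atLeast0LessThan)
  also have "\<dots> = (\<Sum>j<n. \<Sum>i<n. Q $$ (j, i) * P $$ (i, j))"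
    by (subst sum.swap) (simp add: mult.commute)
  also have "\<dots> = (\<Sum>i<n. (Q * P) $$ (i, i))"
    using assms by (intro sum.cong refl) (simp add: scalar_prod_def atLeast0LessThan)
  finally show ?thesis .
qed

lemma upper_triangular_pow:
  fixes B :: "real mat"
  assumes B: "B \<in> carrier_mat n n" and ut: "upper_triangular B"
  shows "(\<forall>i<n. \<forall>j<i. (B ^\<^sub>m k) $$ (i, j) = 0) \<and> (\<forall>i<n. (B ^\<^sub>m k) $$ (i, i) = (B $$ (i, i)) ^ k)"
proof (induction k)
  case (Suc k)
  have C: "B ^\<^sub>m k \<in> carrier_mat n n" using B by auto
  have entry: "(B ^\<^sub>m Suc k) $$ (i, j) = (\<Sum>l<n. (B ^\<^sub>m k) $$ (i, l) * B $$ (l, j))" if "i < n" "j < n" for i j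
    using that B C by (simp add: scalar_prod_def atLeast0LessThan)
  have ut': "B $$ (l, j) = 0" if "j < l" "l < n" for l j
    using ut that B by auto
  show ?case
  proof (intro conjI allI impI)
    fix i j assume ij: "i < n" "j < i"
    then have "(B ^\<^sub>m k) $$ (i, l) * B $$ (l, j) = 0" if "l < n" for l
      using Suc ut'[of j l] that by (cases "l < i") auto
    then have "(\<Sum>l<n. (B ^\<^sub>m k) $$ (i, l) * B $$ (l, j)) = 0" by (intro sum.neutral) auto
    then show "(B ^\<^sub>m Suc k) $$ (i, j) = 0" using ij entry[of i j] by simp
  next
    fix i assume i: "i < n"
    have "(\<Sum>l<n. (B ^\<^sub>m k) $$ (i, l) * B $$ (l, i)) = (\<Sum>l<n. if l = i then (B $$ (i, i)) ^ k * B $$ (i, i) else 0)"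
    proof (intro sum.cong refl)
      fix l assume "l \<in> {..<n}"
      then show "(B ^\<^sub>m k) $$ (i, l) * B $$ (l, i) = (if l = i then (B $$ (i, i)) ^ k * B $$ (i, i) else 0)"
        using Suc i ut'[of i l] by (cases "l < i"; cases "l = i") auto
    qed
    then show "(B ^\<^sub>m Suc k) $$ (i, i) = (B $$ (i, i)) ^ Suc k"
      unfolding entry[OF i i] using i by simp
  qed
qed (use B in auto)

text \<open>Triangularization is enough: the trace is invariant under similarity, and powers of a
  triangular matrix have the powers of its diagonal on their diagonal.\<close>

lemma trace_pow_eigenvalues:
  fixes A :: "real mat"
  assumes A: "A \<in> carrier_mat n n" and es: "char_poly A = (\<Prod>e\<leftarrow>es. [:- e, 1:])" "length es = n"
  shows "(\<Sum>i<n. (A ^\<^sub>m k) $$ (i, i)) = (\<Sum>e\<leftarrow>es. e ^ k)"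
proof -
  obtain B P Q where BPQ: "schur_decomposition A es = (B, P, Q)" by (cases "schur_decomposition A es") auto
  from schur_decomposition[OF A es(1) BPQ]
  have sim: "similar_mat_wit A B P Q" and ut: "upper_triangular B" and diag: "diag_mat B = es" by auto
  note wit = similar_mat_witD2[OF A sim]
  have Bk: "B ^\<^sub>m k \<in> carrier_mat n n" using wit by auto
  have "(\<Sum>i<n. (A ^\<^sub>m k) $$ (i, i)) = (\<Sum>i<n. (P * (B ^\<^sub>m k * Q)) $$ (i, i))"
    using similar_mat_wit_pow_id[OF sim, of k] wit Bk by (simp add: assoc_mult_mat[of _ n n _ n _ n])
  also have "\<dots> = (\<Sum>i<n. (B ^\<^sub>m k * Q * P) $$ (i, i))"
    using wit Bk by (intro trace_mult_commute) auto
  also have "B ^\<^sub>m k * Q * P = B ^\<^sub>m k"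
    using wit Bk by (simp add: assoc_mult_mat[of _ n n _ n _ n])
  also have "(\<Sum>i<n. (B ^\<^sub>m k) $$ (i, i)) = (\<Sum>i<n. (es ! i) ^ k)"
    using upper_triangular_pow[OF wit(5) ut, of k] diag wit(5)
    by (intro sum.cong refl) (auto simp: diag_mat_def)
  also have "\<dots> = (\<Sum>e\<leftarrow>es. e ^ k)"
    using es(2) by (simp add: sum_list_sum_nth atLeast0LessThan)
  finally show ?thesis .
qed

lemma order_prod_linear: "Polynomial.order x (\<Prod>e\<leftarrow>es. [:- e, 1:]) = count_list es (x :: real)"
proof (induction es)
  case (Cons e es)
  have "(\<Prod>e\<leftarrow>es. [:- e, 1:]) \<noteq> 0" by (induction es) (auto simp del: mult_pCons_left)
  then have "Polynomial.order x (\<Prod>e\<leftarrow>e # es. [:- e, 1:]) = Polynomial.order x [:- e, 1:] + Polynomial.order x (\<Prod>e\<leftarrow>es. [:- e, 1:])"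
    by (simp add: order_mult del: mult_pCons_left)
  then show ?case using Cons by (simp add: order_linear')
qed (simp add: order_1_eq_0)

lemma eig_count_measure_integral:
  fixes \<phi> :: "real \<Rightarrow> real"
  assumes A: "A \<in> carrier_mat n n" and es: "char_poly A = (\<Prod>e\<leftarrow>es. [:- e, 1:])"
  shows "(\<integral>x. \<phi> x \<partial>eig_count_measure A) = (\<Sum>e\<leftarrow>es. \<phi> e) / real n"
proof -
  have dim: "dim_row A = n" using A by auto
  let ?f = "\<lambda>x. (real (count_list es x) / real n) * \<phi> x"
  have supp: "{x \<in> UNIV. ?f x \<noteq> 0} \<subseteq> set es"
    using count_notin[of _ es] by fastforce
  have "(\<integral>x. \<phi> x \<partial>eig_count_measure A) = (\<integral>x. ?f x \<partial>count_space UNIV)"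
    unfolding eig_count_measure_def es order_prod_linear dim
    by (subst integral_density) auto
  also have "\<dots> = (\<Sum>x | x \<in> UNIV \<and> ?f x \<noteq> 0. ?f x)"
    using finite_subset[OF supp] by (intro lebesgue_integral_count_space_finite_support) auto
  also have "\<dots> = (\<Sum>x\<in>set es. ?f x)"
    using supp by (intro sum.mono_neutral_left) auto
  also have "\<dots> = (\<Sum>x\<in>set es. real (count_list es x) * \<phi> x) / real n"
    by (simp add: sum_divide_distrib)
  also have "(\<Sum>x\<in>set es. real (count_list es x) * \<phi> x) = (\<Sum>e\<leftarrow>es. \<phi> e)"
  proof -
    have "S \<supseteq> set es \<Longrightarrow> finite S \<Longrightarrow> (\<Sum>x\<in>S. real (count_list es x) * \<phi> x) = (\<Sum>e\<leftarrow>es. \<phi> e)" for S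
    proof (induction es)
      case (Cons e es)
      have "(\<Sum>x\<in>S. real (count_list (e # es) x) * \<phi> x) = (\<Sum>x\<in>S. (if x = e then \<phi> x else 0) + real (count_list es x) * \<phi> x)"
        by (intro sum.cong) (auto simp: algebra_simps)
      then show ?case using Cons by (simp add: sum.distrib)
    qed auto
    then show ?thesis by auto
  qed
  finally show ?thesis .
qed

text \<open>\<open>eig_count_measure\<close> lives on the full power set; weak convergence is about its Borel version.\<close>

definition list_measure :: "real list \<Rightarrow> real measure" where
  "list_measure es = distr (uniform_count_measure {..<length es}) borel (\<lambda>i. es ! i)"

lemma list_measure_real_distribution:
  assumes "es \<noteq> []" shows "real_distribution (list_measure es)"
proof -
  interpret U: prob_space "uniform_count_measure {..<length es}"
    using assms by (intro prob_space_uniform_count_measure) auto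
  show ?thesis unfolding list_measure_def by (rule U.real_distribution_distr) auto
qed

lemma list_measure_integral:
  fixes \<phi> :: "real \<Rightarrow> real"
  assumes "\<phi> \<in> borel_measurable borel"
  shows "(\<integral>x. \<phi> x \<partial>list_measure es) = (\<Sum>e\<leftarrow>es. \<phi> e) / real (length es)"
  unfolding list_measure_def
  by (subst integral_distr)
     (use assms in \<open>auto simp: integral_uniform_count_measure sum_list_sum_nth atLeast0LessThan\<close>)

lemma list_measure_integrable:
  fixes \<phi> :: "real \<Rightarrow> real"
  assumes "\<phi> \<in> borel_measurable borel"
  shows "integrable (list_measure es) \<phi>"
  unfolding list_measure_def uniform_count_measure_def
  by (subst integrable_distr_eq) (use assms in \<open>auto intro!: integrable_point_measure_finite\<close>)

section \<open>The method of moments\<close>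

text \<open>Clipping acts only where |x| > R >= 1, and there |x|^s <= |x|^(2s+2) / R. The exponent
  on the right is even, so its integral is a moment.\<close>

lemma clip_power_diff:
  fixes x R :: real
  assumes R: "R \<ge> 1"
  shows "\<bar>x ^ s - (max (- R) (min R x)) ^ s\<bar> \<le> 2 * x ^ (2 * s + 2) / R"
proof (cases "\<bar>x\<bar> \<le> R")
  case True
  then have "max (- R) (min R x) = x" by auto
  moreover have "0 \<le> x ^ (2 * s + 2)" by (rule zero_le_even_power) simp
  then have "0 \<le> 2 * x ^ (2 * s + 2) / R" using R by (intro divide_nonneg_nonneg mult_nonneg_nonneg) simp_all
  ultimately show ?thesis by (simp only: diff_self abs_zero)
next
  case False
  then have xR: "\<bar>x\<bar> \<ge> R" "\<bar>x\<bar> \<ge> 1" using R by auto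
  have "\<bar>max (- R) (min R x)\<bar> \<le> \<bar>x\<bar>" using R by auto
  then have "\<bar>max (- R) (min R x)\<bar> ^ s \<le> \<bar>x\<bar> ^ s" by (intro power_mono) auto
  then have "\<bar>x ^ s - (max (- R) (min R x)) ^ s\<bar> \<le> 2 * \<bar>x\<bar> ^ s"
    using abs_triangle_ineq4[of "x ^ s" "(max (- R) (min R x)) ^ s"] by (simp add: power_abs)
  also have "\<bar>x\<bar> ^ s \<le> \<bar>x\<bar> ^ (2 * s + 2) / R"
  proof -
    have "\<bar>x\<bar> ^ s * R \<le> \<bar>x\<bar> ^ (2 * s + 1) * \<bar>x\<bar>"
      using xR R by (intro mult_mono power_increasing) auto
    also have "\<dots> = \<bar>x\<bar> ^ (2 * s + 2)" by (simp add: power_add)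
    finally show ?thesis using R by (subst pos_le_divide_eq) simp_all
  qed
  also have "\<bar>x\<bar> ^ (2 * s + 2) = x ^ (2 * s + 2)"
    by (rule power_even_abs) simp
  finally show ?thesis by simp
qed

lemma abs_power_le: "\<bar>x ^ s\<bar> \<le> 1 + (x :: real) ^ (2 * s)"
proof -
  have "0 \<le> (\<bar>x ^ s\<bar> - 1)\<^sup>2" by simp
  then have "2 * \<bar>x ^ s\<bar> \<le> 1 + (x ^ s)\<^sup>2" by (simp add: power2_diff)
  moreover have "(x ^ s)\<^sup>2 \<ge> 0" by simp
  ultimately show ?thesis by (simp add: power_mult[symmetric] mult.commute)
qed

lemma moments_tight:
  fixes \<mu> :: "nat \<Rightarrow> real measure"
  assumes rd: "\<And>n. real_distribution (\<mu> n)" and int: "\<And>n. integrable (\<mu> n) (\<lambda>x. x ^ 2)"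
    and B: "\<And>n. (\<integral>x. x ^ 2 \<partial>\<mu> n) \<le> B"
  shows "tight \<mu>"
  unfolding tight_def
proof (intro conjI allI impI rd)
  fix \<epsilon> :: real assume e: "\<epsilon> > 0"
  \<comment> \<open>Chosen so that the Chebyshev bound \<open>B / t\<^sup>2\<close> falls below
    \<epsilon>.\<close>
  define t where "t = sqrt ((\<bar>B\<bar> + 1) / \<epsilon>) + 1"
  have t0: "t > 0" using e by (simp add: t_def add_nonneg_pos)
  have "(\<bar>B\<bar> + 1) / \<epsilon> = (sqrt ((\<bar>B\<bar> + 1) / \<epsilon>))\<^sup>2" using e by simp
  also have "\<dots> < t\<^sup>2" using e unfolding t_def by (intro power_strict_mono) auto
  finally have t: "\<bar>B\<bar> + 1 < \<epsilon> * t\<^sup>2" using e by (simp add: field_simps)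
  have "measure (\<mu> n) {- t<..t} > 1 - \<epsilon>" for n
  proof -
    interpret real_distribution "\<mu> n" by (rule rd)
    have "prob {x \<in> space (\<mu> n). x ^ 2 \<ge> t\<^sup>2} \<le> (\<integral>x. x ^ 2 \<partial>\<mu> n) / t\<^sup>2"
      using t0 by (intro integral_Markov_inequality_measure[OF int, where A = "{}"]) auto
    also have "\<dots> \<le> B / t\<^sup>2" using B[of n] by (intro divide_right_mono) auto
    also have "\<dots> < \<epsilon>" using t t0 by (simp add: field_simps)
    finally have 1: "prob {x. x ^ 2 \<ge> t\<^sup>2} < \<epsilon>" by simp
    have "UNIV \<subseteq> {- t<..t} \<union> {x. x ^ 2 \<ge> t\<^sup>2}"
    proof
      fix x :: real
      have "t\<^sup>2 \<le> x ^ 2" if "t \<le> \<bar>x\<bar>" using that t0 abs_le_square_iff[of t x] by simp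
      then show "x \<in> {- t<..t} \<union> {x. x ^ 2 \<ge> t\<^sup>2}" by (cases "t \<le> \<bar>x\<bar>") auto
    qed
    then have "prob UNIV \<le> prob ({- t<..t} \<union> {x. x ^ 2 \<ge> t\<^sup>2})" by (intro finite_measure_mono) auto
    also have "\<dots> \<le> prob {- t<..t} + prob {x. x ^ 2 \<ge> t\<^sup>2}" by (intro measure_Un_le) auto
    finally show ?thesis using 1 prob_space by simp
  qed
  then show "\<exists>a b. a < b \<and> (\<forall>n. measure (\<mu> n) {a<..b} > 1 - \<epsilon>)"
    using t0 by (intro exI[of _ "- t"] exI[of _ t]) auto
qed

lemma convergent_bounded_above:
  fixes f :: "nat \<Rightarrow> real"
  assumes "f \<longlonglongrightarrow> l"
  obtains B where "\<And>n. f n \<le> B"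
proof -
  obtain B where "\<And>n. norm (f n) \<le> B"
    using convergent_imp_Bseq[OF convergentI[OF assms]] by (auto simp: Bseq_def)
  then have "\<And>n. f n \<le> B" by (metis abs_le_D1 real_norm_def)
  then show ?thesis by (rule that)
qed

text \<open>Weak convergence applies to bounded functions only. Fatou for the truncations of x^(2k)
  makes all powers integrable; then clipping at R changes an s-th moment by at most 2D/R, uniformly
  along the sequence and in the limit.\<close>

lemma weak_limit_moments:
  fixes \<nu> :: "nat \<Rightarrow> real measure" and \<sigma> :: "real measure"
  assumes rd: "\<And>n. real_distribution (\<nu> n)" and rs: "real_distribution \<sigma>"
    and wc: "weak_conv_m \<nu> \<sigma>"
    and int: "\<And>n s. integrable (\<nu> n) (\<lambda>x. x ^ s)"
    and lim: "\<And>s. (\<lambda>n. (\<integral>x. x ^ s \<partial>\<nu> n)) \<longlonglongrightarrow> m s"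
  shows "integrable \<sigma> (\<lambda>x. x ^ s) \<and> (\<integral>x. x ^ s \<partial>\<sigma>) = m s"
proof -
  interpret S: real_distribution \<sigma> by (rule rs)
  have rdn: "real_distribution (\<nu> n)" for n by (rule rd)
  have conv: "(\<lambda>n. (\<integral>x. f x \<partial>\<nu> n)) \<longlonglongrightarrow> (\<integral>x. f x \<partial>\<sigma>)"
    if "\<And>x. isCont f x" "\<And>x. norm (f x) \<le> B" for f :: "real \<Rightarrow> real" and B
    by (rule weak_conv_imp_integral_bdd_continuous_conv[OF rd rs wc that])
  have even_int: "integrable \<sigma> (\<lambda>x. x ^ (2 * k))" for k
  proof -
    obtain B where B: "\<And>n. (\<integral>x. x ^ (2 * k) \<partial>\<nu> n) \<le> B"
      using convergent_bounded_above[OF lim[of "2 * k"]] by blast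
    have trunc: "(\<integral>\<^sup>+x. ennreal (min (x ^ (2 * k)) (real R)) \<partial>\<sigma>) \<le> ennreal B" for R :: nat
    proof -
      have "(\<lambda>n. (\<integral>x. min (x ^ (2 * k)) (real R) \<partial>\<nu> n)) \<longlonglongrightarrow> (\<integral>x. min (x ^ (2 * k)) (real R) \<partial>\<sigma>)"
      proof (rule conv[of _ "real R"])
        show "isCont (\<lambda>x. min (x ^ (2 * k)) (real R)) x" for x :: real
          by (intro continuous_min continuous_intros)
        show "norm (min (x ^ (2 * k)) (real R)) \<le> real R" for x :: real
          using zero_le_even_power[of "2 * k" x] by (simp add: min_def)
      qed
      moreover have "(\<integral>x. min (x ^ (2 * k)) (real R) \<partial>\<nu> n) \<le> B" for n
      proof -
        interpret N: real_distribution "\<nu> n" by (rule rd)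
        have "(\<integral>x. min (x ^ (2 * k)) (real R) \<partial>\<nu> n) \<le> (\<integral>x. x ^ (2 * k) \<partial>\<nu> n)"
          by (intro integral_mono int N.integrable_const_bound[where B = "real R"])
             (auto simp: min_def zero_le_even_power)
        then show ?thesis using B[of n] by linarith
      qed
      ultimately have "(\<integral>x. min (x ^ (2 * k)) (real R) \<partial>\<sigma>) \<le> B"
        by (intro LIMSEQ_le_const2) auto
      then show ?thesis
        by (subst nn_integral_eq_integral)
           (auto intro!: S.integrable_const_bound[where B = "real R"] ennreal_leI simp: min_def zero_le_even_power)
    qed
    have "(\<integral>\<^sup>+x. ennreal (x ^ (2 * k)) \<partial>\<sigma>) = (\<integral>\<^sup>+x. liminf (\<lambda>R. ennreal (min (x ^ (2 * k)) (real R))) \<partial>\<sigma>)"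
    proof (intro nn_integral_cong)
      fix x :: real
      have "(\<lambda>R. ennreal (min (x ^ (2 * k)) (real R))) \<longlonglongrightarrow> ennreal (x ^ (2 * k))"
      proof (rule tendsto_eventually)
        obtain R0 where "x ^ (2 * k) \<le> real R0" using real_arch_simple by blast
        then show "\<forall>\<^sub>F R in sequentially. ennreal (min (x ^ (2 * k)) (real R)) = ennreal (x ^ (2 * k))"
          by (intro eventually_mono[OF eventually_ge_at_top[of R0]]) (auto simp: min_def)
      qed
      then show "ennreal (x ^ (2 * k)) = liminf (\<lambda>R. ennreal (min (x ^ (2 * k)) (real R)))"
        by (intro lim_imp_Liminf[symmetric]) simp_all
    qed
    also have "\<dots> \<le> liminf (\<lambda>R. \<integral>\<^sup>+x. ennreal (min (x ^ (2 * k)) (real R)) \<partial>\<sigma>)"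
      by (rule nn_integral_liminf) simp
    also have "\<dots> \<le> ennreal B"
      using trunc by (intro Liminf_le) (auto intro: always_eventually)
    finally have "(\<integral>\<^sup>+x. ennreal (x ^ (2 * k)) \<partial>\<sigma>) < \<infinity>"
      using ennreal_less_top le_less_trans by (metis infinity_ennreal_def)
    then show ?thesis
      by (intro integrableI_nonneg) (auto simp: zero_le_even_power)
  qed
  have s_int: "integrable \<sigma> (\<lambda>x. x ^ s)" for s
    by (rule Bochner_Integration.integrable_bound[of _ "\<lambda>x. 1 + x ^ (2 * s)"])
       (use even_int abs_power_le[of _ s] in \<open>auto intro!: Bochner_Integration.integrable_add simp: zero_le_even_power abs_of_nonneg\<close>)
  have "(\<integral>x. x ^ s \<partial>\<sigma>) = m s"
  proof (rule LIMSEQ_unique[OF _ lim])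
    define e where "e = 2 * s + 2"
    have ev: "even e" "e = 2 * (s + 1)" by (auto simp: e_def)
    obtain B where B: "\<And>n. (\<integral>x. x ^ e \<partial>\<nu> n) \<le> B"
      using convergent_bounded_above[OF lim[of e]] by blast
    \<comment> \<open>Bounds the moment of order 2s + 2 along the whole sequence and for the
      limit.\<close>
    define D where "D = \<bar>B\<bar> + \<bar>\<integral>x. x ^ e \<partial>\<sigma>\<bar> + 1"
    have close: "\<bar>(\<integral>x. x ^ s \<partial>\<mu>) - (\<integral>x. (max (- R) (min R x)) ^ s \<partial>\<mu>)\<bar> \<le> 2 * D / R"
      if "real_distribution \<mu>" "\<And>s. integrable \<mu> (\<lambda>x. x ^ s)" "(\<integral>x. x ^ e \<partial>\<mu>) \<le> D" "R \<ge> 1" for \<mu> R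
    proof -
      interpret P: real_distribution \<mu> by fact
      have bnd: "\<bar>max (- R) (min R x) ^ s\<bar> \<le> R ^ s" for x
        unfolding power_abs using that(4) by (intro power_mono) auto
      have ic: "integrable \<mu> (\<lambda>x. (max (- R) (min R x)) ^ s)"
        by (rule P.integrable_const_bound[where B = "R ^ s"]) (use bnd in auto)
      have "\<bar>(\<integral>x. x ^ s \<partial>\<mu>) - (\<integral>x. (max (- R) (min R x)) ^ s \<partial>\<mu>)\<bar>
          = \<bar>\<integral>x. x ^ s - (max (- R) (min R x)) ^ s \<partial>\<mu>\<bar>"
        using that ic by (subst Bochner_Integration.integral_diff) auto
      also have "\<dots> \<le> (\<integral>x. \<bar>x ^ s - (max (- R) (min R x)) ^ s\<bar> \<partial>\<mu>)" by (rule integral_abs_bound)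
      also have "\<dots> \<le> (\<integral>x. 2 * x ^ e / R \<partial>\<mu>)"
      proof (rule integral_mono)
        show "integrable \<mu> (\<lambda>x. 2 * x ^ e / R)" using that(2)[of e] by simp
        show "\<bar>x ^ s - max (- R) (min R x) ^ s\<bar> \<le> 2 * x ^ e / R" for x
          unfolding e_def by (rule clip_power_diff[OF that(4)])
      qed (use that(2)[of s] ic in auto)
      also have "\<dots> = 2 * (\<integral>x. x ^ e \<partial>\<mu>) / R" by simp
      also have "\<dots> \<le> 2 * D / R" using that by (intro divide_right_mono mult_left_mono) auto
      finally show ?thesis .
    qed
    show "(\<lambda>n. \<integral>x. x ^ s \<partial>\<nu> n) \<longlonglongrightarrow> (\<integral>x. x ^ s \<partial>\<sigma>)"
    proof (rule tendstoI)
      fix \<epsilon> :: real assume e0: "\<epsilon> > 0"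
      define R where "R = 6 * D / \<epsilon> + 1"
      have D: "D \<ge> 1" by (simp add: D_def)
      have R: "R \<ge> 1" "2 * D / R < \<epsilon> / 3" using D e0 by (auto simp: R_def field_simps)
      have "(\<lambda>n. (\<integral>x. (max (- R) (min R x)) ^ s \<partial>\<nu> n)) \<longlonglongrightarrow> (\<integral>x. (max (- R) (min R x)) ^ s \<partial>\<sigma>)"
      proof (rule conv[of _ "R ^ s"])
        show "norm (max (- R) (min R x) ^ s) \<le> R ^ s" for x
          unfolding norm_power using R by (intro power_mono) auto
      qed (auto intro!: continuous_intros)
      then have "\<forall>\<^sub>F n in sequentially. dist (\<integral>x. (max (- R) (min R x)) ^ s \<partial>\<nu> n) (\<integral>x. (max (- R) (min R x)) ^ s \<partial>\<sigma>) < \<epsilon> / 3"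
        using e0 by (intro tendstoD) auto
      then show "\<forall>\<^sub>F n in sequentially. dist (\<integral>x. x ^ s \<partial>\<nu> n) (\<integral>x. x ^ s \<partial>\<sigma>) < \<epsilon>"
      proof eventually_elim
        case (elim n)
        have "(\<integral>x. x ^ e \<partial>\<nu> n) \<le> D" using B[of n] by (simp add: D_def)
        then have 1: "\<bar>(\<integral>x. x ^ s \<partial>\<nu> n) - (\<integral>x. (max (- R) (min R x)) ^ s \<partial>\<nu> n)\<bar> \<le> 2 * D / R"
          using close[OF rd int _ R(1)] by simp
        have "(\<integral>x. x ^ e \<partial>\<sigma>) \<le> D" by (simp add: D_def)
        then have 2: "\<bar>(\<integral>x. x ^ s \<partial>\<sigma>) - (\<integral>x. (max (- R) (min R x)) ^ s \<partial>\<sigma>)\<bar> \<le> 2 * D / R"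
          using close[OF rs s_int _ R(1)] by simp
        show ?case using 1 2 elim R(2) unfolding dist_real_def by linarith
      qed
    qed
  qed
  then show ?thesis using s_int by simp
qed

lemma moment_method:
  fixes \<mu> :: "nat \<Rightarrow> real measure"
  assumes rd: "\<And>n. real_distribution (\<mu> n)"
    and int: "\<And>n s. integrable (\<mu> n) (\<lambda>x. x ^ s)"
    and lim: "\<And>s. (\<lambda>n. (\<integral>x. x ^ s \<partial>\<mu> n)) \<longlonglongrightarrow> m s"
  obtains r \<sigma> where "strict_mono r" "real_distribution \<sigma>" "weak_conv_m (\<mu> \<circ> r) \<sigma>"
    "\<And>s. integrable \<sigma> (\<lambda>x. x ^ s)" "\<And>s. (\<integral>x. x ^ s \<partial>\<sigma>) = m s"
proof -
  obtain B where B: "\<And>n. (\<integral>x. x ^ 2 \<partial>\<mu> n) \<le> B"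
    using convergent_bounded_above[OF lim[of 2]] by blast
  have "tight \<mu>" by (rule moments_tight[OF rd int B])
  then obtain r \<sigma> where r: "strict_mono (r :: nat \<Rightarrow> nat)" "real_distribution \<sigma>" "weak_conv_m (\<mu> \<circ> id \<circ> r) \<sigma>"
    using tight_imp_convergent_subsubsequence[of \<mu> id] by (auto simp: strict_mono_id)
  then have wc: "weak_conv_m (\<mu> \<circ> r) \<sigma>" by simp
  have "integrable \<sigma> (\<lambda>x. x ^ s) \<and> (\<integral>x. x ^ s \<partial>\<sigma>) = m s" for s
  proof (rule weak_limit_moments[OF _ r(2) wc])
    show "(\<lambda>n. \<integral>x. x ^ s \<partial>(\<mu> \<circ> r) n) \<longlonglongrightarrow> m s" for s
      using LIMSEQ_subseq_LIMSEQ[OF lim[of s] r(1)] by (simp add: o_def)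
  qed (auto intro: rd int)
  then show ?thesis using that r wc by blast
qed

section \<open>Determinacy of the moment problem\<close>

context
  fixes M :: "real measure"
  assumes rd: "real_distribution M" and int: "\<And>s. integrable M (\<lambda>x. x ^ s)"
begin

interpretation real_distribution M by (rule rd)

lemma integrable_power_iexp: "integrable M (\<lambda>x. complex_of_real (x ^ n) * iexp (t * x))"
proof (rule Bochner_Integration.integrable_bound[of _ "\<lambda>x. x ^ n"])
  show "AE x in M. norm (complex_of_real (x ^ n) * iexp (t * x)) \<le> norm (x ^ n)"
    by (simp add: norm_mult norm_power power_abs)
qed (auto intro: int)

text \<open>Up to the factor i^n, the n-th derivative of the characteristic function.\<close>

definition mchar :: "nat \<Rightarrow> real \<Rightarrow> complex" where
  "mchar n t = (CLINT x|M. complex_of_real (x ^ n) * iexp (t * x))"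

text \<open>The pointwise Taylor remainder of the exponential, integrated against x^n; the expansion
  is in h around an arbitrary t.\<close>

lemma mchar_taylor:
  "cmod (mchar n (t + h) - (\<Sum>k\<le>N. (\<i> * complex_of_real h) ^ k / fact k * mchar (n + k) t))
     \<le> \<bar>h\<bar> ^ Suc N / fact (Suc N) * (\<integral>x. \<bar>x\<bar> ^ (n + Suc N) \<partial>M)"
proof -
  define D where "D x = complex_of_real (x ^ n) * iexp (t * x) * (iexp (h * x) - (\<Sum>k\<le>N. (\<i> * complex_of_real (h * x)) ^ k / fact k))" for x
  have e: "complex_of_real (x ^ n) * iexp ((t + h) * x) - (\<Sum>k\<le>N. (\<i> * complex_of_real h) ^ k / fact k * (complex_of_real (x ^ (n + k)) * iexp (t * x))) = D x" for x
  proof -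
    have "iexp ((t + h) * x) = iexp (t * x) * iexp (h * x)"
      by (simp add: exp_add[symmetric] algebra_simps)
    then show ?thesis
      by (simp add: D_def right_diff_distrib sum_distrib_left power_mult_distrib power_add mult_ac)
  qed
  have i1: "integrable M (\<lambda>x. complex_of_real (x ^ n) * iexp ((t + h) * x))"
    by (rule integrable_power_iexp)
  have i2: "integrable M (\<lambda>x. (\<i> * complex_of_real h) ^ k / fact k * (complex_of_real (x ^ (n + k)) * iexp (t * x)))" for k
    by (intro integrable_mult_right integrable_power_iexp)
  have i3: "integrable M (\<lambda>x. \<Sum>k\<le>N. (\<i> * complex_of_real h) ^ k / fact k * (complex_of_real (x ^ (n + k)) * iexp (t * x)))"
    by (intro Bochner_Integration.integrable_sum i2)
  have "mchar n (t + h) - (\<Sum>k\<le>N. (\<i> * complex_of_real h) ^ k / fact k * mchar (n + k) t) = (CLINT x|M. D x)"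
    unfolding mchar_def e[symmetric]
    by (subst Bochner_Integration.integral_diff[OF i1 i3], subst Bochner_Integration.integral_sum[OF i2])
      (simp only: integral_mult_right_zero)
  also have "cmod \<dots> \<le> (\<integral>x. cmod (D x) \<partial>M)" by (rule integral_norm_bound)
  also have "\<dots> \<le> (\<integral>x. \<bar>h\<bar> ^ Suc N / fact (Suc N) * \<bar>x\<bar> ^ (n + Suc N) \<partial>M)"
  proof (rule integral_mono)
    have "integrable M (\<lambda>x. complex_of_real (x ^ n) * iexp ((t + h) * x) - (\<Sum>k\<le>N. (\<i> * complex_of_real h) ^ k / fact k * (complex_of_real (x ^ (n + k)) * iexp (t * x))))"
      by (intro Bochner_Integration.integrable_diff i1 i3)
    then show "integrable M (\<lambda>x. cmod (D x))" unfolding e by (rule integrable_norm)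
    have "integrable M (\<lambda>x. \<bar>x ^ (n + Suc N)\<bar>)" by (intro integrable_abs int)
    then show "integrable M (\<lambda>x. \<bar>h\<bar> ^ Suc N / fact (Suc N) * \<bar>x\<bar> ^ (n + Suc N))"
      unfolding power_abs by (rule integrable_mult_right)
    fix x
    have "cmod (D x) = \<bar>x\<bar> ^ n * cmod (iexp (h * x) - (\<Sum>k\<le>N. (\<i> * complex_of_real (h * x)) ^ k / fact k))"
      unfolding D_def norm_mult by (simp add: norm_power power_abs)
    also have "\<dots> \<le> \<bar>x\<bar> ^ n * (\<bar>h * x\<bar> ^ Suc N / fact (Suc N))"
      by (intro mult_left_mono iexp_approx1) auto
    also have "\<dots> = \<bar>h\<bar> ^ Suc N / fact (Suc N) * \<bar>x\<bar> ^ (n + Suc N)"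
      by (simp add: abs_mult power_mult_distrib power_add)
    finally show "cmod (D x) \<le> \<bar>h\<bar> ^ Suc N / fact (Suc N) * \<bar>x\<bar> ^ (n + Suc N)" .
  qed
  also have "\<dots> = \<bar>h\<bar> ^ Suc N / fact (Suc N) * (\<integral>x. \<bar>x\<bar> ^ (n + Suc N) \<partial>M)" by simp
  finally show ?thesis .
qed

end

lemma fact_add_le: "fact (n + k) \<le> (2 :: real) ^ (n + k) * fact n * fact k"
proof -
  have "fact n * fact k * ((n + k) choose n) = (fact (n + k) :: nat)"
    using binomial_fact_lemma[of n "n + k"] by simp
  moreover have "(n + k) choose n \<le> 2 ^ (n + k)" by (rule binomial_le_pow2)
  ultimately have "fact (n + k) \<le> fact n * fact k * (2 :: nat) ^ (n + k)"
    by (metis mult_le_mono2)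
  then have "real (fact (n + k)) \<le> real (fact n * fact k * 2 ^ (n + k))" by (rule of_nat_mono)
  then show ?thesis by (simp add: mult_ac)
qed

text \<open>The Taylor series of the derivatives of the characteristic function have a common radius of
  convergence, so equality propagates from \<open>0\<close> to the whole line in steps of fixed length.\<close>

lemma moments_determine:
  fixes M1 M2 :: "real measure" and B R :: real
  assumes rd: "real_distribution M1" "real_distribution M2"
    and int: "\<And>s. integrable M1 (\<lambda>x. x ^ s)" "\<And>s. integrable M2 (\<lambda>x. x ^ s)"
    and eq: "\<And>s. (\<integral>x. x ^ s \<partial>M1) = (\<integral>x. x ^ s \<partial>M2)"
    and R: "R > 0" and bound: "\<And>k. (\<integral>x. x ^ (2 * k) \<partial>M1) \<le> B * R ^ (2 * k) * fact (2 * k)"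
  shows "M1 = M2"
proof (rule Levy_uniqueness[OF rd])
  \<comment> \<open>The remainder is at most a constant times (2R|h|)^(N+1), where the 2 stems from
    \<open>fact_add_le\<close>. This \<delta> makes the base at most 1/2.\<close>
  define \<delta> where "\<delta> = 1 / (4 * R)"
  have B: "B \<ge> 0"
  proof -
    interpret real_distribution M1 by (rule rd)
    show ?thesis using bound[of 0] prob_space by simp
  qed
  have step: "mchar M1 n (t + h) = mchar M2 n (t + h)"
    if t: "\<And>n. mchar M1 n t = mchar M2 n t" and h: "\<bar>h\<bar> \<le> \<delta>" for n t h
  proof -
    have hR: "2 * R * \<bar>h\<bar> \<le> 1 / 2" using h R by (simp add: \<delta>_def field_simps)
    define K where "K = B * (2 * R) ^ n * fact n"
    have K: "K \<ge> 0" using B R by (simp add: K_def)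
    have rem: "\<bar>h\<bar> ^ Suc N / fact (Suc N) * (\<integral>x. \<bar>x\<bar> ^ (n + Suc N) \<partial>M) \<le> K * (1 / 2) ^ Suc N"
      if ev: "even (n + Suc N)" and M: "M = M1 \<or> M = M2" for N M
    proof -
      obtain k where k: "n + Suc N = 2 * k" using ev by (elim evenE)
      have "(\<integral>x. \<bar>x\<bar> ^ (n + Suc N) \<partial>M) = (\<integral>x. x ^ (2 * k) \<partial>M)"
        unfolding k by (intro Bochner_Integration.integral_cong refl) (simp add: power_even_abs)
      also have "\<dots> \<le> B * R ^ (n + Suc N) * fact (n + Suc N)"
        using bound[of k] M eq[of "2 * k"] k by auto
      also have "\<dots> \<le> B * R ^ (n + Suc N) * (2 ^ (n + Suc N) * fact n * fact (Suc N))"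
        using B R by (intro mult_left_mono fact_add_le) auto
      finally have "\<bar>h\<bar> ^ Suc N / fact (Suc N) * (\<integral>x. \<bar>x\<bar> ^ (n + Suc N) \<partial>M)
         \<le> \<bar>h\<bar> ^ Suc N / fact (Suc N) * (B * R ^ (n + Suc N) * (2 ^ (n + Suc N) * fact n * fact (Suc N)))"
        by (intro mult_left_mono) auto
      also have "\<dots> = K * (2 * R * \<bar>h\<bar>) ^ Suc N"
        by (simp add: K_def power_add power_mult_distrib mult_ac del: fact_Suc power_Suc add_Suc_right)
      also have "\<dots> \<le> K * (1 / 2) ^ Suc N"
        using K hR R by (intro mult_left_mono power_mono) auto
      finally show ?thesis .
    qed
    have diff: "cmod (mchar M1 n (t + h) - mchar M2 n (t + h)) \<le> 2 * K * (1 / 2) ^ j" for j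
    proof -
      \<comment> \<open>Makes n + N + 1 even, so that the absolute moment in the remainder is one of
        the bounded even moments.\<close>
      define N where "N = n + 2 * j + 1"
      have ev: "even (n + Suc N)" by (simp add: N_def)
      define P where "P = (\<Sum>k\<le>N. (\<i> * complex_of_real h) ^ k / fact k * mchar M1 (n + k) t)"
      have P2: "P = (\<Sum>k\<le>N. (\<i> * complex_of_real h) ^ k / fact k * mchar M2 (n + k) t)"
        unfolding P_def by (simp add: t)
      have 1: "cmod (mchar M1 n (t + h) - P) \<le> K * (1 / 2) ^ Suc N"
        unfolding P_def by (rule order_trans[OF mchar_taylor[OF rd(1) int(1)] rem[OF ev]]) simp
      have 2: "cmod (mchar M2 n (t + h) - P) \<le> K * (1 / 2) ^ Suc N"
        unfolding P2 by (rule order_trans[OF mchar_taylor[OF rd(2) int(2)] rem[OF ev]]) simp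
      have "cmod (mchar M1 n (t + h) - mchar M2 n (t + h))
          \<le> cmod (mchar M1 n (t + h) - P) + cmod (mchar M2 n (t + h) - P)"
        using norm_triangle_ineq4[of "mchar M1 n (t + h) - P" "mchar M2 n (t + h) - P"] by simp
      also have "\<dots> \<le> 2 * K * (1 / 2) ^ Suc N" using 1 2 by simp
      also have "\<dots> \<le> 2 * K * (1 / 2) ^ j"
        using K by (intro mult_left_mono power_decreasing) (auto simp: N_def)
      finally show ?thesis .
    qed
    have "(\<lambda>j. 2 * K * (1 / 2 :: real) ^ j) \<longlonglongrightarrow> 2 * K * 0"
      by (intro tendsto_mult tendsto_const LIMSEQ_power_zero) auto
    then have "cmod (mchar M1 n (t + h) - mchar M2 n (t + h)) \<le> 2 * K * 0"
      by (rule LIMSEQ_le_const) (use diff in auto)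
    then show ?thesis by simp
  qed
  have \<delta>: "\<delta> > 0" using R by (simp add: \<delta>_def)
  have all: "\<bar>t\<bar> \<le> real k * \<delta> \<Longrightarrow> mchar M1 n t = mchar M2 n t" for k n t
  proof (induction k arbitrary: n t)
    case 0
    then have "t = 0" by simp
    have "mchar M n 0 = complex_of_real (\<integral>x. x ^ n \<partial>M)" if "real_distribution M" "\<And>s. integrable M (\<lambda>x. x ^ s)" for M
      unfolding mchar_def[OF that] by (simp del: of_real_power)
    then show ?case using \<open>t = 0\<close> rd int eq by simp
  next
    case (Suc k)
    \<comment> \<open>The part of t to be covered by one last step of length at most
      \<delta>.\<close>
    define h where "h = max (- \<delta>) (min \<delta> t)"
    have "\<bar>t - h\<bar> \<le> real k * \<delta>" using Suc.prems \<delta> by (auto simp: h_def algebra_simps max_def min_def abs_if split: if_splits)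
    then have "mchar M1 n (t - h) = mchar M2 n (t - h)" for n by (rule Suc.IH)
    moreover have "\<bar>h\<bar> \<le> \<delta>" using \<delta> by (auto simp: h_def)
    ultimately have "mchar M1 n ((t - h) + h) = mchar M2 n ((t - h) + h)" by (rule step)
    then show ?case by simp
  qed
  show "char M1 = char M2"
  proof
    fix t
    obtain k where "\<bar>t\<bar> / \<delta> \<le> real k" using real_arch_simple by blast
    then have "\<bar>t\<bar> \<le> real k * \<delta>" using \<delta> by (simp add: field_simps)
    then have "mchar M1 0 t = mchar M2 0 t" by (rule all)
    then show "char M1 t = char M2 t"
      unfolding mchar_def[OF rd(1) int(1)] mchar_def[OF rd(2) int(2)] char_def by simp
  qed
qed

definition has_moments :: "(nat \<Rightarrow> real) \<Rightarrow> real measure \<Rightarrow> bool" where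
  "has_moments m \<nu> \<longleftrightarrow> real_distribution \<nu> \<and> (\<forall>s. integrable \<nu> (\<lambda>x. x ^ s)) \<and> (\<forall>s. (\<integral>x. x ^ s \<partial>\<nu>) = m s)"

text \<open>Otherwise there is a counterexample for every k. Their moments converge to
  \<open>m\<close>, so a subsequence converges weakly to a law with moments \<open>m\<close>, that
  is, to \<sigma>, and this contradicts the gap \<epsilon>. One k serves all measures, hence all
  sample points at once.\<close>

lemma moments_close_imp_integral_close:
  fixes \<sigma> :: "real measure" and \<phi> :: "real \<Rightarrow> real" and m :: "nat \<Rightarrow> real"
  assumes unique: "\<forall>\<nu>. has_moments m \<nu> \<longrightarrow> \<nu> = \<sigma>"
    and \<phi>: "continuous_on UNIV \<phi>" "bounded (range \<phi>)" and \<epsilon>: "\<epsilon> > 0"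
  shows "\<exists>k. \<forall>\<mu>. real_distribution \<mu> \<and> (\<forall>s. integrable \<mu> (\<lambda>x. x ^ s)) \<and>
      (\<forall>s\<le>k. \<bar>(\<integral>x. x ^ s \<partial>\<mu>) - m s\<bar> \<le> 1 / (real k + 1)) \<longrightarrow> \<bar>(\<integral>x. \<phi> x \<partial>\<mu>) - (\<integral>x. \<phi> x \<partial>\<sigma>)\<bar> \<le> \<epsilon>"
proof -
  define Bad where "Bad k \<mu> \<longleftrightarrow> real_distribution \<mu> \<and> (\<forall>s. integrable \<mu> (\<lambda>x. x ^ s)) \<and>
      (\<forall>s\<le>k. \<bar>(\<integral>x. x ^ s \<partial>\<mu>) - m s\<bar> \<le> 1 / (real k + 1)) \<and> \<bar>(\<integral>x. \<phi> x \<partial>\<mu>) - (\<integral>x. \<phi> x \<partial>\<sigma>)\<bar> > \<epsilon>" for k \<mu>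
  have "\<exists>k. \<forall>\<mu>. \<not> Bad k \<mu>"
  proof (rule ccontr)
    assume "\<not> ?thesis"
    then have "\<forall>k. \<exists>\<mu>. Bad k \<mu>" by blast
    then obtain \<mu> where bad: "Bad k (\<mu> k)" for k by metis
    have rd: "real_distribution (\<mu> k)" and int: "integrable (\<mu> k) (\<lambda>x. x ^ s)" for k s
      using bad[of k] unfolding Bad_def by blast+
    have lim: "(\<lambda>k. \<integral>x. x ^ s \<partial>\<mu> k) \<longlonglongrightarrow> m s" for s
    proof (rule LIM_zero_cancel, rule Lim_null_comparison)
      have "\<bar>(\<integral>x. x ^ s \<partial>\<mu> k) - m s\<bar> \<le> 1 / (real k + 1)" if "s \<le> k" for k
        using bad[of k] that unfolding Bad_def by blast
      then show "\<forall>\<^sub>F k in sequentially. norm ((\<integral>x. x ^ s \<partial>\<mu> k) - m s) \<le> 1 / (real k + 1)"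
        by (intro eventually_mono[OF eventually_ge_at_top[of s]]) simp
      show "(\<lambda>k. 1 / (real k + 1)) \<longlonglongrightarrow> 0"
        using LIMSEQ_inverse_real_of_nat by (simp add: inverse_eq_divide add.commute)
    qed
    obtain r \<tau> where r: "strict_mono r" "real_distribution \<tau>" "weak_conv_m (\<mu> \<circ> r) \<tau>"
      "\<And>s. integrable \<tau> (\<lambda>x. x ^ s)" "\<And>s. (\<integral>x. x ^ s \<partial>\<tau>) = m s"
      using moment_method[OF rd int lim] by blast
    have "has_moments m \<tau>" unfolding has_moments_def using r by simp
    then have \<tau>: "\<tau> = \<sigma>" using unique by simp
    obtain B where B: "\<And>x. norm (\<phi> x) \<le> B" using \<phi>(2) by (auto simp: bounded_iff)
    have "(\<lambda>k. \<integral>x. \<phi> x \<partial>(\<mu> \<circ> r) k) \<longlonglongrightarrow> (\<integral>x. \<phi> x \<partial>\<tau>)"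
    proof (rule weak_conv_imp_integral_bdd_continuous_conv[OF _ r(2,3)])
      show "isCont \<phi> x" for x using \<phi>(1) by (simp add: continuous_on_eq_continuous_at)
    qed (use B rd in auto)
    then have "\<forall>\<^sub>F k in sequentially. dist (\<integral>x. \<phi> x \<partial>(\<mu> \<circ> r) k) (\<integral>x. \<phi> x \<partial>\<tau>) < \<epsilon>"
      using \<epsilon> by (rule tendstoD)
    then obtain k where "dist (\<integral>x. \<phi> x \<partial>(\<mu> \<circ> r) k) (\<integral>x. \<phi> x \<partial>\<tau>) < \<epsilon>"
      by (auto simp: eventually_sequentially)
    then show False using bad[of "r k"] unfolding Bad_def \<tau> by (simp add: dist_real_def)
  qed
  then show ?thesis unfolding Bad_def not_le[symmetric] by blast
qed

section \<open>Expected traces and their variance\<close>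

text \<open>Walks without common edges are uncorrelated.\<close>

lemma multi_wt_append_disjoint:
  assumes "set es \<inter> set es' = {}"
  shows "multi_wt m (es @ es') = multi_wt m es * multi_wt m es'"
proof -
  have "multi_wt m (es @ es') = (\<Prod>e\<in>set es. m (count_list (es @ es') e)) * (\<Prod>e\<in>set es'. m (count_list (es @ es') e))"
    unfolding multi_wt_def using assms by (simp add: prod.union_disjoint)
  also have "(\<Prod>e\<in>set es. m (count_list (es @ es') e)) = multi_wt m es"
    unfolding multi_wt_def
  proof (intro prod.cong refl)
    fix e assume "e \<in> set es"
    then have "e \<notin> set es'" using assms by blast
    then show "m (count_list (es @ es') e) = m (count_list es e)" by (simp add: count_list_append count_notin)
  qed
  also have "(\<Prod>e\<in>set es'. m (count_list (es @ es') e)) = multi_wt m es'"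
    unfolding multi_wt_def
  proof (intro prod.cong refl)
    fix e assume "e \<in> set es'"
    then have "e \<notin> set es" using assms by blast
    then show "m (count_list (es @ es') e) = m (count_list es' e)" by (simp add: count_list_append count_notin)
  qed
  finally show ?thesis .
qed

locale matrix_model = prob_space M + bipartite_labels cls Vs
  for M :: "'w measure" and cls :: "nat \<Rightarrow> bool" and Vs :: "nat set" +
  fixes N :: nat and Z :: "nat \<times> nat \<Rightarrow> 'w \<Rightarrow> real" and m :: "nat \<Rightarrow> real"
  assumes Vs: "Vs = {1..N}" and N: "N \<ge> 1"
    and ind: "indep_vars (\<lambda>_. borel) Z {(i, j). 1 \<le> i \<and> i \<le> j \<and> j \<le> N}"
    and momZ: "\<And>i j. 1 \<le> i \<Longrightarrow> i \<le> j \<Longrightarrow> j \<le> N \<Longrightarrow> all_mom M (Z (i, j))"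
    and expZ: "\<And>i j k. 1 \<le> i \<Longrightarrow> i \<le> j \<Longrightarrow> j \<le> N \<Longrightarrow> expectation (\<lambda>\<omega>. Z (i, j) \<omega> ^ k) = m k"
begin

lemma Vs_iff: "x \<in> Vs \<longleftrightarrow> 1 \<le> x \<and> x \<le> N"
  by (simp add: Vs)

lemma card_Vs: "card Vs = N"
  by (simp add: Vs)

lemma sum_Vs: "(\<Sum>k<N. f k) = (\<Sum>y\<in>Vs. f (y - 1))"
  by (rule sum.reindex_bij_witness[of _ "\<lambda>y. y - 1" Suc]) (auto simp: Vs_iff)

abbreviation idx :: "(nat \<times> nat) set" where "idx \<equiv> {(i, j). 1 \<le> i \<and> i \<le> j \<and> j \<le> N}"

text \<open>With 1/N instead of p/N, the degree bound is immediate; the factor p goes into the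
  constant \<open>B\<close> of the moment bound.\<close>

sublocale LG: label_graph nb "1 / real N"
proof
  show "real (card (nb v)) * (1 / real N) \<le> 1" for v
  proof -
    have "card (nb v) \<le> card Vs" by (intro card_mono finV) (auto simp: nb_def)
    then show ?thesis using N by (simp add: Vs)
  qed
qed (use N finite_nb nb_symmetric in auto)

definition Am :: "'w \<Rightarrow> real mat" where
  "Am \<omega> = mat N N (\<lambda>(i, j). if cls (i + 1) \<noteq> cls (j + 1) then Z (pair_ed (i + 1) (j + 1)) \<omega> else 0)"

definition Tr :: "nat \<Rightarrow> 'w \<Rightarrow> real" where
  "Tr s \<omega> = (\<Sum>i<N. (Am \<omega> ^\<^sub>m s) $$ (i, i))"

lemma Am_carrier: "Am \<omega> \<in> carrier_mat N N"
  by (simp add: Am_def)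

lemma pow_entry_walks:
  assumes x0: "x0 \<in> Vs" and x: "x \<in> Vs"
  shows "(Am \<omega> ^\<^sub>m s) $$ (x0 - 1, x - 1)
     = (\<Sum>w\<in>walks nb x0 s. if hd w = x then walk_val pair_ed (\<lambda>e. Z e \<omega>) w else 0)"
proof -
  define V where "V s x = (if x \<in> Vs then (Am \<omega> ^\<^sub>m s) $$ (x0 - 1, x - 1) else 0)" for s x
  have "(\<Sum>w\<in>walks nb x0 s. if hd w = x then walk_val pair_ed (\<lambda>e. Z e \<omega>) w else 0) = V s x"
  proof (rule walk_sum_unique)
    show "V 0 x = (if x = x0 then 1 else 0)" for x
      using x0 Am_carrier[of \<omega>] by (auto simp: V_def Vs_iff)
    show "V (Suc n) x = (\<Sum>y\<in>nb x. Z (pair_ed x y) \<omega> * V n y)" for n x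
    proof (cases "x \<in> Vs")
      case True
      have C: "Am \<omega> ^\<^sub>m n \<in> carrier_mat N N" using Am_carrier by auto
      have "V (Suc n) x = (\<Sum>k<N. (Am \<omega> ^\<^sub>m n) $$ (x0 - 1, k) * Am \<omega> $$ (k, x - 1))"
        using True x0 C Am_carrier[of \<omega>] by (auto simp: V_def Vs_iff scalar_prod_def atLeast0LessThan)
      also have "\<dots> = (\<Sum>y\<in>Vs. (Am \<omega> ^\<^sub>m n) $$ (x0 - 1, y - 1) * Am \<omega> $$ (y - 1, x - 1))"
        by (rule sum_Vs)
      also have "\<dots> = (\<Sum>y\<in>Vs. if y \<in> nb x then Z (pair_ed x y) \<omega> * V n y else 0)"
      proof (intro sum.cong refl)
        fix y assume y: "y \<in> Vs"
        then have "y - 1 < N" "x - 1 < N" "y - 1 + 1 = y" "x - 1 + 1 = x" using True by (auto simp: Vs_iff)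
        then have "Am \<omega> $$ (y - 1, x - 1) = (if cls y \<noteq> cls x then Z (pair_ed y x) \<omega> else 0)"
          unfolding Am_def by (subst index_mat) (simp_all del: One_nat_def)
        then show "(Am \<omega> ^\<^sub>m n) $$ (x0 - 1, y - 1) * Am \<omega> $$ (y - 1, x - 1) = (if y \<in> nb x then Z (pair_ed x y) \<omega> * V n y else 0)"
          using True y by (simp add: V_def nb_def pair_ed_commute[of y x])
      qed
      also have "\<dots> = (\<Sum>y\<in>nb x. Z (pair_ed x y) \<omega> * V n y)"
        by (rule sum.mono_neutral_cong_right) (auto simp: nb_def finV)
      finally show ?thesis .
    qed (auto simp: V_def nb_def)
  qed (auto simp: finite_nb nb_symmetric)
  then show ?thesis using x by (simp add: V_def)
qed

definition closed :: "nat \<Rightarrow> nat \<Rightarrow> nat list set" where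
  "closed s x = {w \<in> walks nb x s. hd w = x}"

lemma finite_closed: "finite (closed s x)"
  unfolding closed_def by (rule finite_subset[OF _ finite_walks[of nb x s]]) (auto simp: finite_nb)

abbreviation val :: "'w \<Rightarrow> nat list \<Rightarrow> real" where
  "val \<omega> w \<equiv> walk_val pair_ed (\<lambda>e. Z e \<omega>) w"

lemma Tr_walks: "Tr s \<omega> = (\<Sum>x\<in>Vs. \<Sum>w\<in>closed s x. val \<omega> w)"
proof -
  have "Tr s \<omega> = (\<Sum>x\<in>Vs. (Am \<omega> ^\<^sub>m s) $$ (x - 1, x - 1))"
    unfolding Tr_def by (rule sum_Vs)
  also have "\<dots> = (\<Sum>x\<in>Vs. \<Sum>w\<in>closed s x. val \<omega> w)"
    by (intro sum.cong refl, subst pow_entry_walks)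
       (auto simp: closed_def sum.inter_filter finite_walks finite_nb)
  finally show ?thesis .
qed

lemma edges_idx: "w \<in> walks nb x s \<Longrightarrow> set (edges pair_ed w) \<subseteq> idx"
proof
  fix e assume w: "w \<in> walks nb x s" "e \<in> set (edges pair_ed w)"
  from edges_in_walk[OF w] obtain u v where "u \<in> nb v" "e = pair_ed u v" by blast
  then show "e \<in> idx" by (auto simp: nb_def pair_ed_def Vs_iff)
qed

lemma val_prod: "val \<omega> w = prod_list (map (\<lambda>e. Z e \<omega>) (edges pair_ed w))"
  by (simp add: walk_val_def)

lemma idx_mom: "e \<in> idx \<Longrightarrow> all_mom M (Z e)"
  using momZ by auto

lemma val_mom: "w \<in> walks nb x s \<Longrightarrow> all_mom M (\<lambda>\<omega>. val \<omega> w)"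
  unfolding val_prod using edges_idx idx_mom by (intro all_mom_prod_list) blast

lemma Tr_mom: "all_mom M (Tr s)"
  unfolding Tr_walks[abs_def] using val_mom by (intro all_mom_sum) (auto simp: closed_def)

lemma prod_expectation:
  "set es \<subseteq> idx \<Longrightarrow> expectation (\<lambda>\<omega>. prod_list (map (\<lambda>e. Z e \<omega>) es)) = multi_wt m es"
  using expZ by (intro expectation_prod_list[OF ind]) (auto intro: momZ)

lemma Tr_expectation: "expectation (Tr s) = (\<Sum>x\<in>Vs. \<Sum>w\<in>closed s x. multi_wt m (edges pair_ed w))"
proof -
  have "expectation (Tr s) = (\<Sum>x\<in>Vs. \<Sum>w\<in>closed s x. expectation (\<lambda>\<omega>. val \<omega> w))"
    unfolding Tr_walks[abs_def] using val_mom all_mom_integrable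
    by (subst Bochner_Integration.integral_sum, (auto simp: closed_def intro!: Bochner_Integration.integrable_sum)[1])
       (intro sum.cong refl Bochner_Integration.integral_sum, auto simp: closed_def)
  also have "\<dots> = (\<Sum>x\<in>Vs. \<Sum>w\<in>closed s x. multi_wt m (edges pair_ed w))"
    unfolding val_prod using edges_idx by (intro sum.cong refl prod_expectation) (auto simp: closed_def)
  finally show ?thesis .
qed

text \<open>\<open>multi_wt\<close> depends on the moments only, so independent copies of a matrix
  weight may be placed on the tree edges. The sum over closed walks then becomes the expected
  coefficient of G, and G is the sum of the powers L^r.\<close>

lemma tree_expectation:
  assumes x: "x \<in> Vs"
  shows "(\<Sum>t\<in>walks (tree_nb nb) [x] s. if hd t = [x] then multi_wt m (edges tree_ed t) else 0)
    = (if even s then \<Sum>r=0..s div 2. SF m (\<lambda>b. card (C (\<not> b))) (cls x) (card (C (\<not> cls x))) (s div 2) r else 0)"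
proof -
  \<comment> \<open>Serves only as a representative of the common moments.\<close>
  define Z1 where "Z1 = Z (1, 1)"
  have Z11: "all_mom M Z1" unfolding Z1_def using N by (intro momZ) auto
  have expZ1: "expectation (\<lambda>\<omega>. Z1 \<omega> ^ k) = m k" for k
    unfolding Z1_def using N by (intro expZ) auto
  have meas: "Z1 \<in> borel_measurable M" using Z11 by (simp add: all_mom_def)
  interpret TL: tree_law "distr M borel (Z1)"
  proof (rule tree_law.intro)
    show "integrable (distr M borel (Z1)) (\<lambda>x. x ^ k)" for k
      using Z11 by (subst integrable_distr_eq[OF meas]) (auto simp: all_mom_def)
    show "prob_space (distr M borel (Z1))" by (rule prob_space_distr[OF meas])
  qed simp
  have mnu: "TL.mnu = m"
    unfolding TL.mnu_def using expZ1 by (simp add: integral_distr[OF meas])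
  have wm: "all_mom TL.T (\<lambda>A. walk_val tree_ed A t)" for t
    unfolding walk_val_def by (rule TL.PT.all_mom_prod_list) (rule TL.coord_mom)
  have fin: "finite (walks (tree_nb nb) [x] s)"
    by (intro finite_walks finite_tree_nb finite_nb)
  have "(\<Sum>t\<in>walks (tree_nb nb) [x] s. if hd t = [x] then multi_wt m (edges tree_ed t) else 0)
      = (\<Sum>t\<in>walks (tree_nb nb) [x] s. \<integral>A. (if hd t = [x] then walk_val tree_ed A t else 0) \<partial>TL.T)"
  proof (intro sum.cong refl)
    fix t
    have "TL.PT.expectation (\<lambda>A. prod_list (map (\<lambda>e. A e) (edges tree_ed t))) = multi_wt m (edges tree_ed t)"
      by (rule TL.PT.expectation_prod_list[OF TL.indep_coord_borel])
         (auto simp: TL.coord_expectation mnu TL.coord_mom)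
    then show "(if hd t = [x] then multi_wt m (edges tree_ed t) else 0)
        = (\<integral>A. (if hd t = [x] then walk_val tree_ed A t else 0) \<partial>TL.T)"
      by (simp add: walk_val_def)
  qed
  also have "\<dots> = (\<integral>A. (\<Sum>t\<in>walks (tree_nb nb) [x] s. if hd t = [x] then walk_val tree_ed A t else 0) \<partial>TL.T)"
  proof (rule Bochner_Integration.integral_sum[symmetric])
    show "integrable TL.T (\<lambda>A. if hd t = [x] then walk_val tree_ed A t else 0)" for t
      by (cases "hd t = [x]") (auto intro: TL.PT.all_mom_integrable[OF wm])
  qed
  also have "\<dots> = (\<integral>A. (if even s then gcoef C (s div 2) (cls x) (Bsub A [x]) else 0) \<partial>TL.T)"
    by (simp only: tree_walk_sum[OF x])
  also have "\<dots> = (if even s then \<integral>A. gcoef C (s div 2) (cls x) (\<lambda>l. A (rev l @ [x])) \<partial>TL.T else 0)"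
    by (simp add: Bsub_def[abs_def])
  also have "(\<integral>A. gcoef C (s div 2) (cls x) (\<lambda>l. A (rev l @ [x])) \<partial>TL.T) = (\<integral>A. gcoef C (s div 2) (cls x) A \<partial>TL.T)"
    by (rule TL.shift_expectation) (use TL.gcoef_mom[where h = "\<lambda>l. l"] in \<open>auto simp: inj_on_def all_mom_def\<close>)
  also have "\<dots> = (\<Sum>r=0..s div 2. TL.eL C (cls x) (C (\<not> cls x)) (s div 2) r)"
    using TL.Gf_expectation[of 1 C "cls x" "s div 2"] by (simp add: Gf_def)
  also have "\<dots> = (\<Sum>r=0..s div 2. SF m (\<lambda>b. card (C (\<not> b))) (cls x) (card (C (\<not> cls x))) (s div 2) r)"
    by (simp only: TL.eL_eq_SF[OF finite_C finite_C] mnu)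
  finally show ?thesis .
qed

text \<open>Each of the N roots contributes an error of order 1/N, so the total error is bounded
  while the trace is of order N.\<close>

lemma Tr_expectation_approx:
  assumes m: "\<And>k. 1 \<le> k \<Longrightarrow> k \<le> s \<Longrightarrow> \<bar>m k\<bar> \<le> B * (1 / real N)" and B: "B \<ge> 1"
  shows "\<bar>expectation (Tr s) - (\<Sum>b\<in>UNIV. real (card (C b)) *
      (if even s then \<Sum>r=0..s div 2. SF m (\<lambda>b. card (C (\<not> b))) b (card (C (\<not> b))) (s div 2) r else 0))\<bar>
    \<le> 2 * B ^ s * (real s * fact (s + 2))"
proof -
  define G where "G b = (if even s then \<Sum>r=0..s div 2. SF m (\<lambda>b. card (C (\<not> b))) b (card (C (\<not> b))) (s div 2) r else 0)" for b
  have sumG: "(\<Sum>b\<in>UNIV. real (card (C b)) * G b) = (\<Sum>x\<in>Vs. G (cls x))"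
  proof -
    have "(\<Sum>x\<in>Vs. G (cls x)) = (\<Sum>b\<in>UNIV. \<Sum>x | x \<in> Vs \<and> cls x = b. G (cls x))"
      by (rule sum.group[symmetric]) (auto simp: finV)
    then show ?thesis by (simp add: C_def)
  qed
  have "\<bar>expectation (Tr s) - (\<Sum>x\<in>Vs. G (cls x))\<bar>
     = \<bar>\<Sum>x\<in>Vs. (\<Sum>w\<in>closed s x. multi_wt m (edges pair_ed w)) - G (cls x)\<bar>"
    by (simp add: Tr_expectation sum_subtractf)
  also have "\<dots> \<le> (\<Sum>x\<in>Vs. 2 * B ^ s * (real s * fact (s + 2)) * (1 / real N))"
  proof (rule order_trans[OF sum_abs], intro sum_mono)
    fix x assume x: "x \<in> Vs"
    have "(\<Sum>w\<in>closed s x. multi_wt m (edges pair_ed w)) = (\<Sum>w\<in>walks nb x s. if hd w = x then multi_wt m (edges pair_ed w) else 0)"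
      unfolding closed_def by (rule sum.inter_filter) (auto intro: finite_walks finite_nb)
    then show "\<bar>(\<Sum>w\<in>closed s x. multi_wt m (edges pair_ed w)) - G (cls x)\<bar> \<le> 2 * B ^ s * (real s * fact (s + 2)) * (1 / real N)"
      using LG.walks_vs_twalks[where m = m and n = s and B = B and x = x, OF m B] unfolding tree_expectation[OF x] G_def by simp
  qed
  also have "\<dots> = 2 * B ^ s * (real s * fact (s + 2))" using N by (simp add: card_Vs)
  finally show ?thesis unfolding sumG[unfolded G_def] G_def .
qed

text \<open>Only pairs of walks with a common vertex contribute. \<open>meeting_bound\<close> sums
  out the second walk without any factor N, and the start of the first walk gives the single
  remaining N.\<close>

lemma Tr_variance:
  assumes m: "\<And>k. 1 \<le> k \<Longrightarrow> k \<le> 2 * s \<Longrightarrow> \<bar>m k\<bar> \<le> B * (1 / real N)" and B: "B \<ge> 1"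
  shows "variance (Tr s) \<le> 2 * B ^ (2 * s) * pair_const (Suc s) s * fact (s + 2) * real N"
proof -
  define S where "S = Sigma Vs (closed s)"
  let ?E = "\<lambda>w. edges pair_ed w" and ?q = "1 / real N"
  let ?h = "\<lambda>w w'. if set w' \<inter> set w \<noteq> {} then ?q ^ card (set (?E w') \<union> set (?E w)) else 0"
  have finS: "finite S" unfolding S_def by (intro finite_SigmaI finite_closed finV)
  have TrS: "Tr s \<omega> = (\<Sum>(x, w)\<in>S. val \<omega> w)" for \<omega>
    unfolding Tr_walks S_def by (rule sum.Sigma) (auto intro: finite_closed finV)
  have ES: "expectation (Tr s) = (\<Sum>(x, w)\<in>S. multi_wt m (?E w))"
    unfolding Tr_expectation S_def by (rule sum.Sigma) (auto intro: finite_closed finV)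
  have wS: "snd a \<in> walks nb (fst a) s" if "a \<in> S" for a using that by (auto simp: S_def closed_def)
  have sq: "(Tr s \<omega>)\<^sup>2 = (\<Sum>a\<in>S. \<Sum>b\<in>S. val \<omega> (snd a) * val \<omega> (snd b))" for \<omega>
    unfolding TrS power2_eq_square sum_product by (simp add: case_prod_beta)
  have E2: "expectation (\<lambda>\<omega>. (Tr s \<omega>)\<^sup>2) = (\<Sum>a\<in>S. \<Sum>b\<in>S. multi_wt m (?E (snd a) @ ?E (snd b)))"
  proof -
    have mom2: "all_mom M (\<lambda>\<omega>. val \<omega> (snd a) * val \<omega> (snd b))" if ab: "a \<in> S" "b \<in> S" for a b
      by (intro all_mom_mult val_mom[OF wS[OF ab(1)]] val_mom[OF wS[OF ab(2)]])
    have "expectation (\<lambda>\<omega>. (Tr s \<omega>)\<^sup>2) = (\<Sum>a\<in>S. \<Sum>b\<in>S. expectation (\<lambda>\<omega>. val \<omega> (snd a) * val \<omega> (snd b)))"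
      unfolding sq using mom2 all_mom_integrable
      by (subst Bochner_Integration.integral_sum, (auto intro!: Bochner_Integration.integrable_sum)[1])
         (intro sum.cong refl Bochner_Integration.integral_sum, auto)
    also have "\<dots> = (\<Sum>a\<in>S. \<Sum>b\<in>S. multi_wt m (?E (snd a) @ ?E (snd b)))"
    proof (intro sum.cong refl)
      fix a b assume "a \<in> S" "b \<in> S"
      then have "set (?E (snd a) @ ?E (snd b)) \<subseteq> idx" using edges_idx[OF wS] by simp
      from prod_expectation[OF this]
      show "expectation (\<lambda>\<omega>. val \<omega> (snd a) * val \<omega> (snd b)) = multi_wt m (?E (snd a) @ ?E (snd b))"
        by (simp add: val_prod)
    qed
    finally show ?thesis .
  qed
  \<comment> \<open>Disjoint walks have no common edge and hence covariance 0. If they meet, the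
    joint weight and the product of weights are bounded separately; the latter has at least as many
    factors 1/N as the union has edges.\<close>
  have cov: "multi_wt m (?E w @ ?E w') - multi_wt m (?E w) * multi_wt m (?E w')
      \<le> 2 * B ^ (2 * s) * ?h w w'"
    if w: "w \<in> walks nb x s" and w': "w' \<in> walks nb x' s" for w w' x x'
  proof (cases "set w' \<inter> set w = {}")
    case True
    have "set (?E w) \<inter> set (?E w') = {}"
    proof (rule ccontr)
      assume "\<not> ?thesis"
      then obtain e where e: "e \<in> set (?E w)" "e \<in> set (?E w')" by blast
      obtain u v where uv: "u \<in> set w" "u \<in> nb v" "e = pair_ed u v" using edges_in_walk[OF w e(1)] by blast
      obtain u' v' where uv': "u' \<in> set w'" "v' \<in> set w'" "e = pair_ed u' v'" using edges_in_walk[OF w' e(2)] by blast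
      have "{u, v} = {u', v'}" using uv(3) uv'(3) pair_ed_eq_iff by metis
      then have "u \<in> set w'" using uv' by (auto simp: doubleton_eq_iff)
      then show False using True uv by blast
    qed
    then show ?thesis using True by (simp add: multi_wt_append_disjoint)
  next
    case False
    have len: "length (?E w) = s" "length (?E w') = s"
      using walks_length[OF w] walks_length[OF w'] by (simp_all add: length_edges)
    have q: "0 \<le> ?q" "?q \<le> 1" using N by auto
    have 1: "\<bar>multi_wt m (?E w @ ?E w')\<bar> \<le> B ^ (2 * s) * ?q ^ card (set (?E w') \<union> set (?E w))"
      using multi_wt_bound[of "?E w @ ?E w'" m B ?q] m B q len by (simp add: Un_commute mult_2)
    have a: "\<bar>multi_wt m (?E w)\<bar> \<le> B ^ s * ?q ^ card (set (?E w))"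
      using multi_wt_bound[of "?E w" m B ?q] m B q len by simp
    have b: "\<bar>multi_wt m (?E w')\<bar> \<le> B ^ s * ?q ^ card (set (?E w'))"
      using multi_wt_bound[of "?E w'" m B ?q] m B q len by simp
    have "\<bar>multi_wt m (?E w) * multi_wt m (?E w')\<bar> \<le> (B ^ s * ?q ^ card (set (?E w))) * (B ^ s * ?q ^ card (set (?E w')))"
      unfolding abs_mult using a b B q by (intro mult_mono) auto
    also have "\<dots> = B ^ (2 * s) * ?q ^ (card (set (?E w')) + card (set (?E w)))"
      unfolding mult_2 power_add by (simp only: mult_ac)
    also have "\<dots> \<le> B ^ (2 * s) * ?q ^ card (set (?E w') \<union> set (?E w))"
      using B q card_Un_le[of "set (?E w')" "set (?E w)"] by (intro mult_left_mono power_decreasing) auto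
    finally have 2: "\<bar>multi_wt m (?E w) * multi_wt m (?E w')\<bar> \<le> B ^ (2 * s) * ?q ^ card (set (?E w') \<union> set (?E w))" .
    show ?thesis using 1 2 False by (simp add: abs_le_iff)
  qed
  have "variance (Tr s) = expectation (\<lambda>\<omega>. (Tr s \<omega>)\<^sup>2) - (expectation (Tr s))\<^sup>2"
    by (rule variance_eq[OF all_mom_integrable[OF Tr_mom]]) (use Tr_mom[of s] in \<open>simp add: all_mom_def\<close>)
  also have "\<dots> = (\<Sum>a\<in>S. \<Sum>b\<in>S. multi_wt m (?E (snd a) @ ?E (snd b)) - multi_wt m (?E (snd a)) * multi_wt m (?E (snd b)))"
    unfolding E2 ES by (simp add: power2_eq_square sum_product case_prod_beta sum_subtractf)
  also have "\<dots> \<le> (\<Sum>a\<in>S. \<Sum>b\<in>S. 2 * B ^ (2 * s) * ?h (snd a) (snd b))"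
    using wS by (intro sum_mono cov)
  also have "\<dots> = (\<Sum>a\<in>S. 2 * B ^ (2 * s) * (\<Sum>b\<in>S. ?h (snd a) (snd b)))"
    by (simp add: sum_distrib_left)
  also have "\<dots> \<le> (\<Sum>a\<in>S. 2 * B ^ (2 * s) * (pair_const (Suc s) s * ?q ^ card (set (?E (snd a)))))"
  proof (intro sum_mono mult_left_mono)
    fix a assume a: "a \<in> S"
    have "(\<Sum>b\<in>S. ?h (snd a) (snd b)) = (\<Sum>x\<in>Vs. \<Sum>w\<in>closed s x. ?h (snd a) w)"
      unfolding S_def by (subst sum.Sigma) (auto intro: finite_closed finV simp: case_prod_beta)
    also have "\<dots> \<le> (\<Sum>x\<in>Vs. \<Sum>w\<in>walks nb x s. ?h (snd a) w)"
      by (intro sum_mono sum_mono2) (auto simp: closed_def intro: finite_walks finite_nb)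
    also have "\<dots> \<le> pair_const (Suc s) s * ?q ^ card (set (?E (snd a)))"
      using N by (intro LG.G.meeting_bound[OF finV _ wS[OF a]]) (simp add: card_Vs)
    finally show "(\<Sum>b\<in>S. ?h (snd a) (snd b)) \<le> pair_const (Suc s) s * ?q ^ card (set (?E (snd a)))" .
  qed (use B in auto)
  also have "\<dots> = 2 * B ^ (2 * s) * pair_const (Suc s) s * (\<Sum>a\<in>S. ?q ^ card (set (?E (snd a))))"
    by (simp add: sum_distrib_left mult_ac)
  also have "\<dots> \<le> 2 * B ^ (2 * s) * pair_const (Suc s) s * (fact (s + 2) * real N)"
  proof (intro mult_left_mono)
    have "(\<Sum>a\<in>S. ?q ^ card (set (?E (snd a)))) = (\<Sum>x\<in>Vs. \<Sum>w\<in>closed s x. ?q ^ card (set (?E w)))"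
      unfolding S_def by (subst sum.Sigma) (auto intro: finite_closed finV simp: case_prod_beta)
    also have "\<dots> \<le> (\<Sum>x\<in>Vs. \<Sum>w\<in>walks nb x s. ?q ^ card (set (?E w)))"
      by (intro sum_mono sum_mono2) (auto simp: closed_def intro: finite_walks finite_nb)
    also have "\<dots> \<le> (\<Sum>x\<in>Vs. fact (s + 2))" by (intro sum_mono LG.G.walk_bound)
    finally show "(\<Sum>a\<in>S. ?q ^ card (set (?E (snd a)))) \<le> fact (s + 2) * real N" by (simp add: mult.commute card_Vs)
  qed (use B pair_const_nonneg in auto)
  finally show ?thesis by (simp add: mult_ac)
qed

end

section \<open>The sparse bipartite model\<close>

text \<open>f^f / f! is a single term of the exponential series at f.\<close>

lemma self_power_le_exp_fact: "real f ^ f \<le> exp 1 ^ f * fact f"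
proof -
  have "(\<Sum>n\<in>{f}. inverse (fact n) *\<^sub>R real f ^ n) \<le> (\<Sum>n. inverse (fact n) *\<^sub>R real f ^ n)"
    by (rule sum_le_suminf[OF summable_exp_generic]) auto
  then have "real f ^ f / fact f \<le> exp (real f)" by (simp add: exp_def field_simps)
  also have "exp (real f) = exp 1 ^ f" by (simp add: exp_of_nat_mult[symmetric])
  finally show ?thesis by (simp add: field_simps)
qed

locale sparse_bipartite = prob_space M
  for M :: "'w measure" +
  fixes a :: "nat \<times> nat \<Rightarrow> 'w \<Rightarrow> real" and d :: "nat \<Rightarrow> nat \<times> nat \<Rightarrow> 'w \<Rightarrow> real"
    and p \<alpha> :: real and X :: "nat \<Rightarrow> real"
  assumes indep: "\<And>N. real N \<ge> p \<Longrightarrow>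
      indep_vars (\<lambda>_. borel) (\<lambda>k. case k of Inl ij \<Rightarrow> a ij | Inr ij \<Rightarrow> d N ij)
        (Inl ` {(i, j). 1 \<le> i \<and> i \<le> j} \<union> Inr ` {(i, j). 1 \<le> i \<and> i \<le> j \<and> j \<le> N})"
    and ident: "\<And>i j. 1 \<le> i \<Longrightarrow> i \<le> j \<Longrightarrow> distr M borel (a (i, j)) = distr M borel (a (1, 1))"
    and moments: "\<And>i j k. 1 \<le> i \<Longrightarrow> i \<le> j \<Longrightarrow> integrable M (\<lambda>\<omega>. a (i, j) \<omega> ^ k)"
    and X_def: "\<And>k. X k = expectation (\<lambda>\<omega>. a (1, 1) \<omega> ^ k)"
    and d1: "\<And>N i j. real N \<ge> p \<Longrightarrow> 1 \<le> i \<Longrightarrow> i \<le> j \<Longrightarrow> j \<le> N \<Longrightarrow>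
      prob {\<omega> \<in> space M. d N (i, j) \<omega> = 1} = p / real N"
    and d0: "\<And>N i j. real N \<ge> p \<Longrightarrow> 1 \<le> i \<Longrightarrow> i \<le> j \<Longrightarrow> j \<le> N \<Longrightarrow>
      prob {\<omega> \<in> space M. d N (i, j) \<omega> = 0} = 1 - p / real N"
    and p: "p > 0" and \<alpha>: "0 < \<alpha>" "\<alpha> < 1"
begin

definition cls :: "nat \<Rightarrow> nat \<Rightarrow> bool" where "cls N i \<longleftrightarrow> i \<in> {1..nat \<lfloor>\<alpha> * real N\<rfloor>}"

definition Zs :: "nat \<Rightarrow> nat \<times> nat \<Rightarrow> 'w \<Rightarrow> real" where "Zs N ij \<omega> = a ij \<omega> * d N ij \<omega>"

text \<open>Powers of a 0/1 variable coincide from order 1 on; order 0 is separate, since the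
  formula would give p/N there instead of 1.\<close>

definition mz :: "nat \<Rightarrow> nat \<Rightarrow> real" where "mz N k = (if k = 0 then 1 else p / real N * X k)"

definition AA :: "nat \<Rightarrow> 'w \<Rightarrow> real mat" where "AA N \<omega> = A_mat \<alpha> N (\<lambda>ij. a ij \<omega>) (\<lambda>ij. d N ij \<omega>)"

definition TrN :: "nat \<Rightarrow> nat \<Rightarrow> 'w \<Rightarrow> real" where "TrN N s \<omega> = (\<Sum>i<N. (AA N \<omega> ^\<^sub>m s) $$ (i, i))"

abbreviation dev :: "nat \<Rightarrow> nat \<Rightarrow> real \<Rightarrow> 'w set" where
  "dev N s \<delta> \<equiv> {\<omega> \<in> space M. \<bar>TrN N s \<omega> / real N - lim_moment p \<alpha> X s\<bar> > \<delta>}"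

definition cardC :: "nat \<Rightarrow> bool \<Rightarrow> nat" where
  "cardC N b = card (bipartite_labels.C (cls N) {1..N} b)"

text \<open>Collects all that is used of the eigenvalues: their number, integrals against the
  counting measure, and power sums.\<close>

definition eig_list :: "nat \<Rightarrow> 'w \<Rightarrow> real list \<Rightarrow> bool" where
  "eig_list N \<omega> es \<longleftrightarrow> length es = N \<and>
     (\<forall>\<phi> :: real \<Rightarrow> real. (\<integral>x. \<phi> x \<partial>eig_count_measure (AA N \<omega>)) = (\<Sum>e\<leftarrow>es. \<phi> e) / real N) \<and>
     (\<forall>s. (\<Sum>e\<leftarrow>es. e ^ s) = TrN N s \<omega>)"

lemma eig_listD:
  assumes "eig_list N \<omega> es"
  shows "length es = N" "(\<integral>x. \<phi> x \<partial>eig_count_measure (AA N \<omega>)) = (\<Sum>e\<leftarrow>es. \<phi> e :: real) / real N"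
    "(\<Sum>e\<leftarrow>es. e ^ s) = TrN N s \<omega>"
  using assms by (simp_all add: eig_list_def)

context
  fixes N :: nat
  assumes Np: "real N \<ge> p" and N1: "N \<ge> 1"
begin

lemma rv_a: "1 \<le> i \<Longrightarrow> i \<le> j \<Longrightarrow> random_variable borel (a (i, j))"
proof -
  assume ij: "1 \<le> i" "i \<le> j"
  have "Inl (i, j) \<in> Inl ` {(i, j). 1 \<le> i \<and> i \<le> j} \<union> Inr ` {(i, j). 1 \<le> i \<and> i \<le> j \<and> j \<le> N}"
    using ij by auto
  from bspec[OF conjunct1[OF indep[OF Np, unfolded indep_vars_def]] this] show ?thesis by simp
qed

lemma rv_d: "1 \<le> i \<Longrightarrow> i \<le> j \<Longrightarrow> j \<le> N \<Longrightarrow> random_variable borel (d N (i, j))"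
proof -
  assume ij: "1 \<le> i" "i \<le> j" "j \<le> N"
  have "Inr (i, j) \<in> Inl ` {(i, j). 1 \<le> i \<and> i \<le> j} \<union> Inr ` {(i, j). 1 \<le> i \<and> i \<le> j \<and> j \<le> N}"
    using ij by auto
  from bspec[OF conjunct1[OF indep[OF Np, unfolded indep_vars_def]] this] show ?thesis by simp
qed

lemma AE_d:
  assumes ij: "1 \<le> i" "i \<le> j" "j \<le> N"
  shows "AE \<omega> in M. d N (i, j) \<omega> = 0 \<or> d N (i, j) \<omega> = 1"
proof -
  note [measurable] = rv_d[OF ij]
  have "prob ({\<omega> \<in> space M. d N (i, j) \<omega> = 0} \<union> {\<omega> \<in> space M. d N (i, j) \<omega> = 1})
      = prob {\<omega> \<in> space M. d N (i, j) \<omega> = 0} + prob {\<omega> \<in> space M. d N (i, j) \<omega> = 1}"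
    by (rule finite_measure_Union) auto
  also have "\<dots> = 1" using d0[OF Np ij] d1[OF Np ij] by simp
  also have "{\<omega> \<in> space M. d N (i, j) \<omega> = 0} \<union> {\<omega> \<in> space M. d N (i, j) \<omega> = 1}
     = {\<omega> \<in> space M. d N (i, j) \<omega> = 0 \<or> d N (i, j) \<omega> = 1}" by auto
  finally show ?thesis by (subst (asm) prob_Collect_eq_1) auto
qed

lemma d_moments:
  assumes ij: "1 \<le> i" "i \<le> j" "j \<le> N"
  shows "all_mom M (d N (i, j))" "k \<ge> 1 \<Longrightarrow> expectation (\<lambda>\<omega>. d N (i, j) \<omega> ^ k) = p / real N"
proof -
  note [measurable] = rv_d[OF ij]
  show "all_mom M (d N (i, j))"
    unfolding all_mom_def
  proof (intro conjI allI)
    fix k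
    show "integrable M (\<lambda>\<omega>. d N (i, j) \<omega> ^ k)"
      by (rule integrable_const_bound[where B = 1]) (use AE_d[OF ij] in \<open>auto elim!: eventually_mono simp: power_0_left\<close>)
  qed simp
  assume k: "k \<ge> 1"
  have "expectation (\<lambda>\<omega>. d N (i, j) \<omega> ^ k) = expectation (indicator {\<omega> \<in> space M. d N (i, j) \<omega> = 1})"
    by (rule integral_cong_AE) (use AE_d[OF ij] k in \<open>auto elim!: eventually_mono simp: indicator_def split: if_splits\<close>)
  also have "\<dots> = p / real N" using d1[OF Np ij] by simp
  finally show "expectation (\<lambda>\<omega>. d N (i, j) \<omega> ^ k) = p / real N" .
qed

lemma a_moments:
  assumes ij: "1 \<le> i" "i \<le> j"
  shows "all_mom M (a (i, j))" "expectation (\<lambda>\<omega>. a (i, j) \<omega> ^ k) = X k"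
proof -
  show "all_mom M (a (i, j))" using rv_a[OF ij] moments[OF ij] by (simp add: all_mom_def)
  have "expectation (\<lambda>\<omega>. a (i, j) \<omega> ^ k) = (\<integral>x. x ^ k \<partial>distr M borel (a (i, j)))"
    by (rule integral_distr[OF rv_a[OF ij], symmetric]) simp
  also have "\<dots> = (\<integral>x. x ^ k \<partial>distr M borel (a (1, 1)))" by (simp only: ident[OF ij])
  also have "\<dots> = expectation (\<lambda>\<omega>. a (1, 1) \<omega> ^ k)"
    by (rule integral_distr[OF rv_a]) simp_all
  finally show "expectation (\<lambda>\<omega>. a (i, j) \<omega> ^ k) = X k" by (simp add: X_def)
qed

text \<open>The joint family is cut into the disjoint pairs {\<open>Inl ij\<close>,
  \<open>Inr ij\<close>}; functions of different pairs are independent, and within a pair the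
  moments multiply.\<close>

lemma model: "matrix_model M {1..N} N (Zs N) (mz N)"
proof (intro matrix_model.intro matrix_model_axioms.intro bipartite_labels.intro prob_space_axioms)
  let ?F = "\<lambda>k. case k of Inl ij \<Rightarrow> a ij | Inr ij \<Rightarrow> d N ij"
  let ?I = "Inl ` {(i, j). 1 \<le> i \<and> i \<le> j} \<union> Inr ` {(i, j). 1 \<le> i \<and> i \<le> j \<and> j \<le> N}"
  let ?K = "\<lambda>ij :: nat \<times> nat. {Inl ij, Inr ij}"
  let ?L = "{(i, j). 1 \<le> i \<and> i \<le> j \<and> j \<le> N}"
  have sub: "?K ij \<subseteq> ?I" if "ij \<in> ?L" for ij using that by auto
  have "indep_vars (\<lambda>ij. PiM (?K ij) (\<lambda>_. borel)) (\<lambda>ij \<omega>. restrict (\<lambda>k. ?F k \<omega>) (?K ij)) ?L"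
    by (rule indep_vars_restrict[OF indep[OF Np] sub]) (auto simp: disjoint_family_on_def)
  then have "indep_vars (\<lambda>_. borel) (\<lambda>ij \<omega>. (\<lambda>f. f (Inl ij) * f (Inr ij)) (restrict (\<lambda>k. ?F k \<omega>) (?K ij))) ?L"
    by (rule indep_vars_compose2) (auto intro!: borel_measurable_times measurable_component_singleton)
  then show "indep_vars (\<lambda>_. borel) (Zs N) ?L"
    by (simp add: Zs_def[abs_def])
  fix i j k assume ij: "1 \<le> i" "i \<le> j" "j \<le> N"
  note am = a_moments[OF ij(1,2)] and dm = d_moments[OF ij]
  show "all_mom M (Zs N (i, j))" unfolding Zs_def[abs_def] by (rule all_mom_mult[OF am(1) dm(1)])
  have "indep_vars (\<lambda>_. borel) ?F (?K (i, j))"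
    by (rule indep_vars_subset[OF indep[OF Np] sub]) (use ij in auto)
  then have "indep_vars (\<lambda>_. borel) (\<lambda>l \<omega>. ?F l \<omega> ^ k) (?K (i, j))"
    by (rule indep_vars_compose2[where Y = "\<lambda>_ x. x ^ k"]) simp
  then have "expectation (\<lambda>\<omega>. \<Prod>l\<in>?K (i, j). ?F l \<omega> ^ k) = (\<Prod>l\<in>?K (i, j). expectation (\<lambda>\<omega>. ?F l \<omega> ^ k))"
    using am(1) dm(1) by (intro indep_vars_lebesgue_integral) (auto simp: all_mom_def)
  then have "expectation (\<lambda>\<omega>. Zs N (i, j) \<omega> ^ k) = X k * expectation (\<lambda>\<omega>. d N (i, j) \<omega> ^ k)"
    by (simp add: Zs_def power_mult_distrib am(2))
  moreover have "X 0 = 1" unfolding X_def by (simp add: prob_space)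
  ultimately show "expectation (\<lambda>\<omega>. Zs N (i, j) \<omega> ^ k) = mz N k"
    using dm(2)[of k] by (cases "k = 0") (auto simp: mz_def prob_space)
qed (use N1 in auto)

interpretation MM: matrix_model M "cls N" "{1..N}" N "Zs N" "mz N"
  by (rule model)

lemma AA_eq: "AA N = MM.Am"
  by (rule ext, rule eq_matI)
     (auto simp: AA_def A_mat_def MM.Am_def A_entry_def Let_def cls_def Zs_def pair_ed_def)

lemma TrN_eq: "TrN N = MM.Tr"
  by (intro ext) (simp add: TrN_def MM.Tr_def AA_eq)

lemma TrN_mom: "all_mom M (TrN N s)"
  unfolding TrN_eq by (rule MM.Tr_mom)

lemma mz_bound:
  assumes "1 \<le> k" "k \<le> n"
  shows "\<bar>mz N k\<bar> \<le> (1 + p * (\<Sum>k\<le>n. \<bar>X k\<bar>)) * (1 / real N)"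
proof -
  have "\<bar>X k\<bar> \<le> (\<Sum>k\<le>n. \<bar>X k\<bar>)" using assms by (intro member_le_sum) auto
  then have "p * \<bar>X k\<bar> \<le> p * (\<Sum>k\<le>n. \<bar>X k\<bar>)" using p by (intro mult_left_mono) auto
  then have "p * \<bar>X k\<bar> / real N \<le> (1 + p * (\<Sum>k\<le>n. \<bar>X k\<bar>)) / real N"
    by (intro divide_right_mono) auto
  then show ?thesis using assms p by (simp add: mz_def abs_mult)
qed

lemma card_cls:
  "cardC N True = nat \<lfloor>\<alpha> * real N\<rfloor>"
  "cardC N False = N - nat \<lfloor>\<alpha> * real N\<rfloor>"
  "nat \<lfloor>\<alpha> * real N\<rfloor> \<le> N"
proof -
  have "\<alpha> * real N \<le> real N" using \<alpha> by (simp add: mult_left_le_one_le)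
  then have "\<lfloor>\<alpha> * real N\<rfloor> \<le> int N" by (metis floor_mono floor_of_nat)
  then show le: "nat \<lfloor>\<alpha> * real N\<rfloor> \<le> N" by simp
  have "bipartite_labels.C (cls N) {1..N} True = {1..nat \<lfloor>\<alpha> * real N\<rfloor>}"
    unfolding MM.C_def using le by (auto simp: cls_def)
  then show "cardC N True = nat \<lfloor>\<alpha> * real N\<rfloor>" unfolding cardC_def by simp
  have "bipartite_labels.C (cls N) {1..N} False = {nat \<lfloor>\<alpha> * real N\<rfloor> + 1..N}"
    unfolding MM.C_def using le by (auto simp: cls_def)
  then show "cardC N False = N - nat \<lfloor>\<alpha> * real N\<rfloor>" unfolding cardC_def by simp
qed

lemma TrN_expectation_approx:
  "\<bar>expectation (TrN N s) - (\<Sum>b\<in>UNIV. real (cardC N b) *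
      (if even s then \<Sum>r=0..s div 2. SF (mz N) (\<lambda>b. cardC N (\<not> b)) b
          (cardC N (\<not> b)) (s div 2) r else 0))\<bar>
    \<le> 2 * (1 + p * (\<Sum>k\<le>s. \<bar>X k\<bar>)) ^ s * (real s * fact (s + 2))"
  unfolding TrN_eq cardC_def using p
  by (intro MM.Tr_expectation_approx mz_bound) (auto intro!: mult_nonneg_nonneg sum_nonneg)

lemma TrN_variance:
  "variance (TrN N s) \<le> 2 * (1 + p * (\<Sum>k\<in>{..2 * s}. \<bar>X k\<bar>)) ^ (2 * s) * pair_const (Suc s) s * fact (s + 2) * real N"
  unfolding TrN_eq using p
  by (intro MM.Tr_variance mz_bound) (auto intro!: mult_nonneg_nonneg sum_nonneg)

lemma AA_eigenvalues:
  obtains es where "char_poly (AA N \<omega>) = (\<Prod>e\<leftarrow>es. [:- e, 1:])" "length es = N"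
proof -
  have sym: "AA N \<omega> $$ (i, j) = AA N \<omega> $$ (j, i)" if "i < N" "j < N" for i j
    using that by (auto simp: AA_def A_mat_def A_entry_def Let_def min.commute max.commute)
  have carrier: "AA N \<omega> \<in> carrier_mat N N" by (simp add: AA_def A_mat_def)
  show ?thesis
  proof (rule real_symmetric_char_poly[OF carrier])
    show "AA N \<omega> $$ (i, j) = AA N \<omega> $$ (j, i)" if "i < N" "j < N" for i j by (rule sym[OF that])
  qed (rule that)
qed

lemma eig_list: "\<exists>es. eig_list N \<omega> es"
proof -
  obtain es where es: "char_poly (AA N \<omega>) = (\<Prod>e\<leftarrow>es. [:- e, 1:])" "length es = N"
    by (rule AA_eigenvalues)
  have carrier: "AA N \<omega> \<in> carrier_mat N N" by (simp add: AA_def A_mat_def)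
  have "eig_list N \<omega> es"
    unfolding eig_list_def
    using es(2) eig_count_measure_integral[OF carrier es(1)] trace_pow_eigenvalues[OF carrier es]
    by (simp add: TrN_def)
  then show ?thesis ..
qed

text \<open>Weierstrass approximation on growing intervals makes the linear statistic a pointwise limit
  of linear combinations of traces.\<close>

lemma eig_integral_measurable:
  fixes \<phi> :: "real \<Rightarrow> real"
  assumes \<phi>: "continuous_on UNIV \<phi>"
  shows "(\<lambda>\<omega>. \<integral>x. \<phi> x \<partial>eig_count_measure (AA N \<omega>)) \<in> borel_measurable M"
proof -
  have "\<exists>g. real_polynomial_function g \<and> (\<forall>x\<in>{- real n..real n}. \<bar>\<phi> x - g x\<bar> < 1 / (real n + 1))" for n
  proof -
    obtain g where "real_polynomial_function g" "\<And>x. x \<in> {- real n..real n} \<Longrightarrow> \<bar>\<phi> x - g x\<bar> < 1 / (real n + 1)"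
      by (rule Stone_Weierstrass_real_polynomial_function[of "{- real n..real n}" \<phi> "1 / (real n + 1)"])
        (auto intro: continuous_on_subset[OF \<phi>])
    then show ?thesis by blast
  qed
  then obtain g where g: "\<And>n. real_polynomial_function (g n)"
    "\<And>n x. x \<in> {- real n..real n} \<Longrightarrow> \<bar>\<phi> x - g n x\<bar> < 1 / (real n + 1)" by metis
  have g_meas: "(\<lambda>\<omega>. \<integral>x. g n x \<partial>eig_count_measure (AA N \<omega>)) \<in> borel_measurable M" for n
  proof -
    obtain c k where c: "g n = (\<lambda>x. \<Sum>i\<le>k. c i * x ^ i)"
      using g(1)[of n] by (auto simp: real_polynomial_function_iff_sum)
    have "(\<integral>x. g n x \<partial>eig_count_measure (AA N \<omega>)) = (\<Sum>i\<le>k. c i * TrN N i \<omega>) / real N" for \<omega>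
    proof -
      obtain es where "eig_list N \<omega> es" using eig_list ..
      note es = eig_listD[OF this]
      have "(\<Sum>e\<leftarrow>es. \<Sum>i\<le>k. c i * e ^ i) = (\<Sum>i\<le>k. c i * (\<Sum>e\<leftarrow>es. e ^ i))"
        by (induction es) (simp_all add: sum.distrib distrib_left)
      then show ?thesis unfolding es(2) c es(3) by simp
    qed
    moreover have "(\<lambda>\<omega>. (\<Sum>i\<le>k. c i * TrN N i \<omega>) / real N) \<in> borel_measurable M"
      using TrN_mom by (intro borel_measurable_sum borel_measurable_times borel_measurable_divide) (auto simp: all_mom_def)
    ultimately show ?thesis by simp
  qed
  show ?thesis
  proof (rule borel_measurable_LIMSEQ_real[OF _ g_meas])
    fix \<omega>
    obtain es where "eig_list N \<omega> es" using eig_list ..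
    note es = eig_listD[OF this]
    \<comment> \<open>Every fixed number lies in [-n, n] from some n on. The eigenvalue list of one
      sample point is finite, so pointwise convergence is enough.\<close>
    have lim: "(\<lambda>n. g n e) \<longlonglongrightarrow> \<phi> e" for e
    proof (rule LIM_zero_cancel, rule Lim_null_comparison)
      obtain n0 where n0: "\<bar>e\<bar> \<le> real n0" using real_arch_simple by blast
      have "norm (g n e - \<phi> e) \<le> 1 / (real n + 1)" if "n0 \<le> n" for n
      proof -
        have "e \<in> {- real n..real n}" using n0 that by auto
        then show ?thesis using g(2)[of e n] by (simp add: abs_minus_commute)
      qed
      then show "\<forall>\<^sub>F n in sequentially. norm (g n e - \<phi> e) \<le> 1 / (real n + 1)"
        by (rule eventually_sequentiallyI)
      show "(\<lambda>n. 1 / (real n + 1)) \<longlonglongrightarrow> 0"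
        using LIMSEQ_inverse_real_of_nat by (simp add: inverse_eq_divide add.commute)
    qed
    have "(\<lambda>n. \<Sum>e\<leftarrow>es. g n e) \<longlonglongrightarrow> (\<Sum>e\<leftarrow>es. \<phi> e)"
      by (induction es) (auto intro!: tendsto_add lim)
    then show "(\<lambda>n. \<integral>x. g n x \<partial>eig_count_measure (AA N \<omega>)) \<longlonglongrightarrow> (\<integral>x. \<phi> x \<partial>eig_count_measure (AA N \<omega>))"
      unfolding es(2) using N1 by (intro tendsto_divide tendsto_const) auto
  qed
qed

end

lemma ev_N: "\<forall>\<^sub>F N in sequentially. real N \<ge> p \<and> N \<ge> 1"
proof -
  obtain n0 where "p \<le> real n0" using real_arch_simple by blast
  then show ?thesis by (intro eventually_sequentiallyI[of "max n0 1"]) auto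
qed

definition fr :: "bool \<Rightarrow> real" where "fr b = (if b then \<alpha> else 1 - \<alpha>)"

lemma cardC_lim: "(\<lambda>N. real (cardC N b) / real N) \<longlonglongrightarrow> fr b"
proof -
  have fl: "(\<lambda>N. real (nat \<lfloor>\<alpha> * real N\<rfloor>) / real N) \<longlonglongrightarrow> \<alpha>"
  proof (rule tendsto_sandwich)
    show "(\<lambda>N. \<alpha> - 1 / real N) \<longlonglongrightarrow> \<alpha>" using tendsto_diff[OF tendsto_const lim_1_over_n, of \<alpha>] by simp
    show "(\<lambda>N. \<alpha>) \<longlonglongrightarrow> \<alpha>" by simp
    have 1: "real (nat \<lfloor>\<alpha> * real N\<rfloor>) = of_int \<lfloor>\<alpha> * real N\<rfloor>" for N
      using \<alpha> by simp
    show "\<forall>\<^sub>F N in sequentially. \<alpha> - 1 / real N \<le> real (nat \<lfloor>\<alpha> * real N\<rfloor>) / real N"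
      using eventually_gt_at_top[of 0]
    proof eventually_elim
      case (elim N)
      have "\<alpha> * real N - 1 \<le> of_int \<lfloor>\<alpha> * real N\<rfloor>" by linarith
      then have "(\<alpha> * real N - 1) / real N \<le> of_int \<lfloor>\<alpha> * real N\<rfloor> / real N" by (rule divide_right_mono) simp
      then show ?case unfolding 1 using elim by (simp add: diff_divide_distrib)
    qed
    show "\<forall>\<^sub>F N in sequentially. real (nat \<lfloor>\<alpha> * real N\<rfloor>) / real N \<le> \<alpha>"
      using eventually_gt_at_top[of 0]
    proof eventually_elim
      case (elim N)
      have "of_int \<lfloor>\<alpha> * real N\<rfloor> \<le> \<alpha> * real N" by linarith
      then show ?case unfolding 1 using elim by (simp add: pos_divide_le_eq)
    qed
  qed
  show ?thesis
  proof (cases b)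
    case True
    show ?thesis
      by (rule Lim_transform_eventually[OF _ eventually_mono[OF ev_N]])
         (use fl True in \<open>auto simp: fr_def card_cls\<close>)
  next
    case False
    have "(\<lambda>N. 1 - real (nat \<lfloor>\<alpha> * real N\<rfloor>) / real N) \<longlonglongrightarrow> fr b"
      using tendsto_diff[OF tendsto_const fl, of 1] False by (simp add: fr_def)
    moreover have "\<forall>\<^sub>F N in sequentially. 1 - real (nat \<lfloor>\<alpha> * real N\<rfloor>) / real N = real (cardC N b) / real N"
      using ev_N
    proof eventually_elim
      case (elim N)
      then have "real (cardC N b) = real N - real (nat \<lfloor>\<alpha> * real N\<rfloor>)"
        using False card_cls[of N] by (simp add: of_nat_diff)
      then show ?case using elim by (simp add: diff_divide_distrib)
    qed
    ultimately show ?thesis by (rule Lim_transform_eventually)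
  qed
qed

text \<open>Averaging over the roots weights class b by its frequency, which tends to
  \<open>fr b\<close> and cancels the denominator in \<open>SF_tendsto\<close>. The bounded error of
  the trace vanishes after division by N.\<close>

lemma moment_lim: "(\<lambda>N. expectation (TrN N s) / real N) \<longlonglongrightarrow> lim_moment p \<alpha> X s"
proof -
  define G where "G N b = (if even s then \<Sum>r=0..s div 2. SF (mz N) (\<lambda>b. cardC N (\<not> b)) b (cardC N (\<not> b)) (s div 2) r else 0)" for N b
  have fr_pos: "fr b > 0" for b using \<alpha> by (simp add: fr_def)
  have SF_lim: "(\<lambda>N. SF (mz N) (\<lambda>b. cardC N (\<not> b)) b (cardC N (\<not> b)) l r) \<longlonglongrightarrow> Snum p \<alpha> X b l r / fr b" for b l r
  proof (rule SF_tendsto)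
    show "(\<lambda>N. real N * mz N (2 * f)) \<longlonglongrightarrow> p * X (2 * f)" if "f \<ge> 1" for f
      by (rule tendsto_eventually, rule eventually_mono[OF ev_N]) (use that in \<open>auto simp: mz_def\<close>)
    show "fr True = \<alpha>" "fr False = 1 - \<alpha>" by (simp_all add: fr_def)
    show "fr b > 0" for b by (rule fr_pos)
    show "(\<lambda>N. real (cardC N (\<not> b)) / real N) \<longlonglongrightarrow> fr (\<not> b)" for b by (rule cardC_lim)
    show "(\<lambda>N. real (cardC N (\<not> b)) / real N) \<longlonglongrightarrow> fr (\<not> b)" by (rule cardC_lim)
  qed
  have G_lim: "(\<lambda>N. G N b) \<longlonglongrightarrow> (if even s then \<Sum>r=0..s div 2. Snum p \<alpha> X b (s div 2) r / fr b else 0)" for b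
  proof (cases "even s")
    case True
    then show ?thesis unfolding G_def by (simp only: if_True) (intro tendsto_sum SF_lim)
  qed (simp add: G_def)
  have lim_eq: "(\<Sum>b\<in>UNIV. fr b * (if even s then \<Sum>r=0..s div 2. Snum p \<alpha> X b (s div 2) r / fr b else 0)) = lim_moment p \<alpha> X s"
  proof -
    have e: "fr b * (\<Sum>r=0..s div 2. Snum p \<alpha> X b (s div 2) r / fr b) = (\<Sum>r=0..s div 2. Snum p \<alpha> X b (s div 2) r)" for b
      using fr_pos[of b] by (simp add: sum_divide_distrib[symmetric])
    show ?thesis
    proof (cases "even s")
      case True
      then show ?thesis by (simp only: if_True e lim_moment_def UNIV_bool) (simp add: sum.distrib)
    next
      case False
      then show ?thesis by (simp only: if_False lim_moment_def mult_zero_right sum.neutral_const)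
    qed
  qed
  have main: "(\<lambda>N. \<Sum>b\<in>UNIV. real (cardC N b) / real N * G N b) \<longlonglongrightarrow> lim_moment p \<alpha> X s"
    unfolding lim_eq[symmetric] by (intro tendsto_sum tendsto_mult cardC_lim G_lim)
  define K where "K = 2 * (1 + p * (\<Sum>k\<le>s. \<bar>X k\<bar>)) ^ s * (real s * fact (s + 2))"
  have "(\<lambda>N. expectation (TrN N s) / real N - (\<Sum>b\<in>UNIV. real (cardC N b) / real N * G N b)) \<longlonglongrightarrow> 0"
  proof (rule Lim_null_comparison)
    show "(\<lambda>N. K * (1 / real N)) \<longlonglongrightarrow> 0" using tendsto_mult[OF tendsto_const lim_1_over_n, of K] by simp
    show "\<forall>\<^sub>F N in sequentially. norm (expectation (TrN N s) / real N - (\<Sum>b\<in>UNIV. real (cardC N b) / real N * G N b)) \<le> K * (1 / real N)"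
      using ev_N
    proof eventually_elim
      case (elim N)
      have "\<bar>expectation (TrN N s) - (\<Sum>b\<in>UNIV. real (cardC N b) * G N b)\<bar> \<le> K"
        unfolding K_def G_def using elim by (intro TrN_expectation_approx) auto
      then have "\<bar>expectation (TrN N s) - (\<Sum>b\<in>UNIV. real (cardC N b) * G N b)\<bar> / real N \<le> K / real N"
        by (rule divide_right_mono) simp
      moreover have "expectation (TrN N s) / real N - (\<Sum>b\<in>UNIV. real (cardC N b) / real N * G N b)
          = (expectation (TrN N s) - (\<Sum>b\<in>UNIV. real (cardC N b) * G N b)) / real N"
        by (simp add: diff_divide_distrib sum_divide_distrib)
      ultimately show ?case by (simp add: abs_divide)
    qed
  qed
  from tendsto_add[OF this main] show ?thesis by simp
qed

text \<open>Half of \<epsilon> covers the bias, the other half Chebyshev: a variance O(N) over a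
  squared distance of order N^2.\<close>

lemma moment_in_probability:
  assumes \<epsilon>: "\<epsilon> > 0"
  shows "(\<lambda>N. prob (dev N s \<epsilon>)) \<longlonglongrightarrow> 0"
proof (rule Lim_null_comparison)
  define K where "K = 2 * (1 + p * (\<Sum>k\<in>{..2 * s}. \<bar>X k\<bar>)) ^ (2 * s) * pair_const (Suc s) s * fact (s + 2)"
  show "(\<lambda>N. 4 * K / \<epsilon>\<^sup>2 * (1 / real N)) \<longlonglongrightarrow> 0"
    using tendsto_mult[OF tendsto_const lim_1_over_n, of "4 * K / \<epsilon>\<^sup>2"] by simp
  have "\<forall>\<^sub>F N in sequentially. dist (expectation (TrN N s) / real N) (lim_moment p \<alpha> X s) < \<epsilon> / 2"
    using \<epsilon> by (intro tendstoD[OF moment_lim]) auto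
  with ev_N show "\<forall>\<^sub>F N in sequentially. norm (prob (dev N s \<epsilon>)) \<le> 4 * K / \<epsilon>\<^sup>2 * (1 / real N)"
  proof eventually_elim
    case (elim N)
    then have N: "real N \<ge> p" "N \<ge> 1" by auto
    note mom = TrN_mom[OF N, of s]
    have [measurable]: "TrN N s \<in> borel_measurable M" using mom by (simp add: all_mom_def)
    have "prob (dev N s \<epsilon>)
        \<le> prob {\<omega> \<in> space M. \<epsilon> / 2 * real N \<le> \<bar>TrN N s \<omega> - expectation (TrN N s)\<bar>}"
    proof (rule finite_measure_mono)
      show "dev N s \<epsilon>
         \<subseteq> {\<omega> \<in> space M. \<epsilon> / 2 * real N \<le> \<bar>TrN N s \<omega> - expectation (TrN N s)\<bar>}"
      proof safe
        fix \<omega> assume "\<epsilon> < \<bar>TrN N s \<omega> / real N - lim_moment p \<alpha> X s\<bar>"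
        then have "\<epsilon> / 2 \<le> \<bar>TrN N s \<omega> / real N - expectation (TrN N s) / real N\<bar>"
          using elim(2) unfolding dist_real_def by linarith
        also have "\<dots> = \<bar>TrN N s \<omega> - expectation (TrN N s)\<bar> / real N"
          by (simp add: diff_divide_distrib[symmetric] abs_divide)
        finally show "\<epsilon> / 2 * real N \<le> \<bar>TrN N s \<omega> - expectation (TrN N s)\<bar>"
          using N by (simp add: pos_le_divide_eq)
      qed
    qed simp
    also have "\<dots> \<le> variance (TrN N s) / (\<epsilon> / 2 * real N)\<^sup>2"
      using mom N \<epsilon> by (intro Chebyshev_inequality) (auto simp: all_mom_def)
    also have "\<dots> \<le> (K * real N) / (\<epsilon> / 2 * real N)\<^sup>2"
      unfolding K_def by (intro divide_right_mono TrN_variance N) auto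
    also have "\<dots> = 4 * K / \<epsilon>\<^sup>2 * (1 / real N)"
      using N \<epsilon> by (simp add: power2_eq_square field_simps)
    finally show ?case by simp
  qed
qed

end

section \<open>Growth of moments, existence of the limit law and convergence\<close>

context sparse_bipartite
begin

lemma X_even_bound:
  assumes "\<exists>C::real. \<forall>m::nat. X (2 * m) \<le> (C * real m) ^ (2 * m)"
  shows "\<exists>c>0. \<forall>f. \<bar>X (2 * f)\<bar> \<le> c ^ f * (fact f)\<^sup>2"
proof -
  obtain D :: real where D: "\<And>m. X (2 * m) \<le> (D * real m) ^ (2 * m)" using assms by blast
  \<comment> \<open>From (D f)^(2f) and f^f <= e^f f!; the summand 1 only makes \<open>c\<close>
    positive.\<close>
  define c where "c = D\<^sup>2 * (exp 1)\<^sup>2 + 1"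
  have c: "c > 0" by (simp add: c_def add_nonneg_pos)
  have "\<bar>X (2 * f)\<bar> \<le> c ^ f * (fact f)\<^sup>2" for f
  proof -
    have "X (2 * f) \<ge> 0" unfolding X_def by (intro integral_nonneg_AE) (simp add: zero_le_even_power)
    then have "\<bar>X (2 * f)\<bar> \<le> (D * real f) ^ (2 * f)" using D[of f] by simp
    also have "\<dots> = (D\<^sup>2) ^ f * (real f ^ f)\<^sup>2"
      by (simp add: power_mult_distrib power_mult power2_eq_square)
    also have "\<dots> \<le> (D\<^sup>2) ^ f * (exp 1 ^ f * fact f)\<^sup>2"
      by (intro mult_left_mono power_mono self_power_le_exp_fact) auto
    also have "\<dots> = (D\<^sup>2 * (exp 1)\<^sup>2) ^ f * (fact f)\<^sup>2"
      by (simp add: power_mult_distrib power2_eq_square)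
    also have "\<dots> \<le> c ^ f * (fact f)\<^sup>2"
      unfolding c_def by (intro mult_right_mono power_mono) auto
    finally show ?thesis .
  qed
  then show ?thesis using c by (intro exI[of _ c]) simp
qed

text \<open>The sum over i costs k + 1 <= 2^k, and (k!)^2 <= (2k)!. Thus R^2 = 2K, and the growth is
  that of the moments of a law with exponential tails.\<close>

lemma lim_moment_bound:
  assumes "\<exists>C::real. \<forall>m::nat. X (2 * m) \<le> (C * real m) ^ (2 * m)"
  shows "\<exists>R>0. \<forall>k. lim_moment p \<alpha> X (2 * k) \<le> 2 * R ^ (2 * k) * fact (2 * k)"
proof -
  obtain c where c: "c > 0" "\<And>f. \<bar>X (2 * f)\<bar> \<le> c ^ f * (fact f)\<^sup>2"
    using X_even_bound[OF assms] by auto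
  define K where "K = c * (1 + 3 * p)"
  have K: "K > 0" using c p by (simp add: K_def)
  have S: "Snum p \<alpha> X b l r \<le> K ^ l * (fact l)\<^sup>2" for b l r
    using Snum_bound[of \<alpha> p c X K b l r] \<alpha> p c K_def by (simp add: abs_le_iff)
  have "lim_moment p \<alpha> X (2 * k) \<le> 2 * sqrt (2 * K) ^ (2 * k) * fact (2 * k)" for k
  proof -
    have "lim_moment p \<alpha> X (2 * k) = (\<Sum>i=0..k. Snum p \<alpha> X True k i + Snum p \<alpha> X False k i)"
      by (simp add: lim_moment_def)
    also have "\<dots> \<le> (\<Sum>i=0..k. 2 * (K ^ k * (fact k)\<^sup>2))"
    proof (rule sum_mono)
      fix i
      show "Snum p \<alpha> X True k i + Snum p \<alpha> X False k i \<le> 2 * (K ^ k * (fact k)\<^sup>2)"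
        using S[of True k i] S[of False k i] by linarith
    qed
    also have "\<dots> = 2 * (real (k + 1) * K ^ k * (fact k)\<^sup>2)" by simp
    also have "\<dots> \<le> 2 * (2 ^ k * K ^ k * fact (2 * k))"
    proof (intro mult_left_mono mult_mono)
      have "k + 1 \<le> 2 ^ k" by (induction k) auto
      then have "real (k + 1) \<le> real (2 ^ k)" by (rule of_nat_mono)
      then show "real (k + 1) \<le> 2 ^ k" by simp
      have "fact k * fact (2 * k - k) * ((2 * k) choose k) = (fact (2 * k) :: nat)"
        by (rule binomial_fact_lemma) simp
      moreover have "1 \<le> (2 * k) choose k" by (simp add: Suc_le_eq)
      ultimately have "fact k * fact k \<le> (fact (2 * k) :: nat)"
        using mult_le_mono2[of 1 "(2 * k) choose k" "fact k * fact k"] by simp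
      then have "real (fact k * fact k) \<le> real (fact (2 * k))" by (rule of_nat_mono)
      then show "(fact k)\<^sup>2 \<le> (fact (2 * k) :: real)" by (simp add: power2_eq_square)
    qed (use K in auto)
    also have "2 ^ k * K ^ k = sqrt (2 * K) ^ (2 * k)"
      using K by (simp add: power_mult power_mult_distrib)
    finally show ?thesis by simp
  qed
  then show ?thesis using K by (intro exI[of _ "sqrt (2 * K)"]) simp
qed

lemma eig_list_measure:
  fixes \<phi> :: "real \<Rightarrow> real"
  assumes es: "eig_list N \<omega> es" and N: "N \<ge> 1"
  shows "real_distribution (list_measure es)" "integrable (list_measure es) (\<lambda>x. x ^ s)"
    "(\<integral>x. x ^ s \<partial>list_measure es) = TrN N s \<omega> / real N"
    "\<phi> \<in> borel_measurable borel \<Longrightarrow> (\<integral>x. \<phi> x \<partial>list_measure es) = (\<integral>x. \<phi> x \<partial>eig_count_measure (AA N \<omega>))"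
proof -
  show "real_distribution (list_measure es)"
    using eig_listD(1)[OF es] N by (intro list_measure_real_distribution) auto
  show "integrable (list_measure es) (\<lambda>x. x ^ s)" by (rule list_measure_integrable) simp
  show "(\<integral>x. x ^ s \<partial>list_measure es) = TrN N s \<omega> / real N"
    by (subst list_measure_integral) (simp_all add: eig_listD[OF es])
  show "(\<integral>x. \<phi> x \<partial>list_measure es) = (\<integral>x. \<phi> x \<partial>eig_count_measure (AA N \<omega>))" if "\<phi> \<in> borel_measurable borel"
    by (subst list_measure_integral[OF that]) (simp add: eig_listD[OF es])
qed

lemma deviation_lim:
  "(\<lambda>N. \<Sum>s\<le>k. prob (dev N s (1 / (real k + 1)))) \<longlonglongrightarrow> 0"
proof -
  have "(\<lambda>N. \<Sum>s\<le>k. prob (dev N s (1 / (real k + 1)))) \<longlonglongrightarrow> (\<Sum>s\<le>k. 0)"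
    by (intro tendsto_sum moment_in_probability) simp
  then show ?thesis by simp
qed

lemma deviation_bound:
  assumes N: "real N \<ge> p" "N \<ge> 1"
    and S: "S \<subseteq> (\<Union>s\<le>k. dev N s \<delta>)"
  shows "prob S \<le> (\<Sum>s\<le>k. prob (dev N s \<delta>))"
proof -
  have "TrN N s \<in> borel_measurable M" for s using TrN_mom[OF N, of s] by (simp add: all_mom_def)
  then have sets: "dev N s \<delta> \<in> sets M" for s
    by measurable
  have "prob S \<le> prob (\<Union>s\<le>k. dev N s \<delta>)"
    using sets by (intro finite_measure_mono S) auto
  also have "\<dots> \<le> (\<Sum>s\<le>k. prob (dev N s \<delta>))"
    using sets by (intro measure_UNION_le) auto
  finally show ?thesis .
qed

text \<open>For large N the exceptional events together have probability below 1, so some sample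
  point avoids all of them; its eigenvalue measure is the witness.\<close>

lemma approximating_measure:
  "\<exists>\<mu>. real_distribution \<mu> \<and> (\<forall>s. integrable \<mu> (\<lambda>x. x ^ s)) \<and>
     (\<forall>s\<le>k. \<bar>(\<integral>x. x ^ s \<partial>\<mu>) - lim_moment p \<alpha> X s\<bar> \<le> 1 / (real k + 1))"
proof -
  have "\<forall>\<^sub>F N in sequentially. (\<Sum>s\<le>k. prob (dev N s (1 / (real k + 1)))) < 1"
    by (rule order_tendstoD(2)[OF deviation_lim]) simp
  with ev_N have "\<forall>\<^sub>F N in sequentially. real N \<ge> p \<and> N \<ge> 1 \<and>
      (\<Sum>s\<le>k. prob (dev N s (1 / (real k + 1)))) < 1"
    by eventually_elim simp
  then obtain N where N: "real N \<ge> p" "N \<ge> 1"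
    and lt: "(\<Sum>s\<le>k. prob (dev N s (1 / (real k + 1)))) < 1"
    by (auto simp: eventually_sequentially)
  have "\<not> space M \<subseteq> (\<Union>s\<le>k. dev N s (1 / (real k + 1)))"
    using deviation_bound[OF N, where S = "space M" and k = k and \<delta> = "1 / (real k + 1)"] lt prob_space by auto
  then obtain \<omega> where "\<omega> \<in> space M"
    "\<omega> \<notin> (\<Union>s\<le>k. dev N s (1 / (real k + 1)))"
    by blast
  then have \<omega>: "\<And>s. s \<le> k \<Longrightarrow> \<bar>TrN N s \<omega> / real N - lim_moment p \<alpha> X s\<bar> \<le> 1 / (real k + 1)"
    by (auto simp: not_less)
  obtain es where es: "eig_list N \<omega> es" using eig_list[OF N] ..
  show ?thesis
    using eig_list_measure[OF es N(2)] \<omega> by (intro exI[of _ "list_measure es"]) simp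
qed

text \<open>The k-th approximating measure matches the first k moments up to 1/(k+1), so all moments
  converge, and a weak subsequential limit has the desired moments.\<close>

lemma limit_measure:
  "\<exists>\<sigma>. has_moments (lim_moment p \<alpha> X) \<sigma>"
proof -
  obtain \<mu> where "\<forall>k. real_distribution (\<mu> k) \<and> (\<forall>s. integrable (\<mu> k) (\<lambda>x. x ^ s)) \<and>
     (\<forall>s\<le>k. \<bar>(\<integral>x. x ^ s \<partial>\<mu> k) - lim_moment p \<alpha> X s\<bar> \<le> 1 / (real k + 1))"
    using choice[OF allI[OF approximating_measure]] ..
  note \<mu> = spec[OF this]
  have lim: "(\<lambda>k. \<integral>x. x ^ s \<partial>\<mu> k) \<longlonglongrightarrow> lim_moment p \<alpha> X s" for s
  proof (rule LIM_zero_cancel, rule Lim_null_comparison)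
    show "\<forall>\<^sub>F k in sequentially. norm ((\<integral>x. x ^ s \<partial>\<mu> k) - lim_moment p \<alpha> X s) \<le> 1 / (real k + 1)"
      using \<mu> by (intro eventually_sequentiallyI[of s]) simp
    show "(\<lambda>k. 1 / (real k + 1)) \<longlonglongrightarrow> 0"
      using LIMSEQ_inverse_real_of_nat by (simp add: inverse_eq_divide add.commute)
  qed
  have rd: "real_distribution (\<mu> k)" and int: "integrable (\<mu> k) (\<lambda>x. x ^ s)" for k s
    using \<mu>[of k] by auto
  obtain r \<sigma> where \<sigma>: "strict_mono (r :: nat \<Rightarrow> nat)" "real_distribution \<sigma>" "weak_conv_m (\<mu> \<circ> r) \<sigma>"
    "\<And>s. integrable \<sigma> (\<lambda>x. x ^ s)" "\<And>s. (\<integral>x. x ^ s \<partial>\<sigma>) = lim_moment p \<alpha> X s"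
    using moment_method[OF rd int lim] by blast
  have "has_moments (lim_moment p \<alpha> X) \<sigma>" unfolding has_moments_def by (simp add: \<sigma>)
  then show ?thesis ..
qed

lemma moment_zero: "lim_moment p \<alpha> X 0 = 1"
  by (simp add: lim_moment_def Snum.simps)

text \<open>The order k depends on \<phi> and \<epsilon> only. If the integral deviates, then one of
  the moments up to k does, and the finitely many deviation probabilities tend to 0.\<close>

lemma convergence_in_probability:
  fixes \<phi> :: "real \<Rightarrow> real"
  assumes unique: "\<forall>\<nu>. has_moments (lim_moment p \<alpha> X) \<nu> \<longrightarrow> \<nu> = \<sigma>"
    and \<phi>: "continuous_on UNIV \<phi>" "bounded (range \<phi>)" and \<epsilon>: "\<epsilon> > 0"
  shows "(\<lambda>N. prob {\<omega> \<in> space M. \<bar>(\<integral>x. \<phi> x \<partial>eig_count_measure (AA N \<omega>)) - (\<integral>x. \<phi> x \<partial>\<sigma>)\<bar> > \<epsilon>}) \<longlonglongrightarrow> 0"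
proof -
  obtain k where k: "\<forall>\<mu>. real_distribution \<mu> \<and> (\<forall>s. integrable \<mu> (\<lambda>x. x ^ s)) \<and>
      (\<forall>s\<le>k. \<bar>(\<integral>x. x ^ s \<partial>\<mu>) - lim_moment p \<alpha> X s\<bar> \<le> 1 / (real k + 1)) \<longrightarrow>
      \<bar>(\<integral>x. \<phi> x \<partial>\<mu>) - (\<integral>x. \<phi> x \<partial>\<sigma>)\<bar> \<le> \<epsilon>"
    using moments_close_imp_integral_close[OF unique \<phi> \<epsilon>] ..
  have \<phi>b: "\<phi> \<in> borel_measurable borel" using \<phi>(1) by (rule borel_measurable_continuous_onI)
  show ?thesis
  proof (rule Lim_null_comparison[OF _ deviation_lim[of k]])
    show "\<forall>\<^sub>F N in sequentially. norm (prob {\<omega> \<in> space M. \<bar>(\<integral>x. \<phi> x \<partial>eig_count_measure (AA N \<omega>)) - (\<integral>x. \<phi> x \<partial>\<sigma>)\<bar> > \<epsilon>})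
      \<le> (\<Sum>s\<le>k. prob (dev N s (1 / (real k + 1))))"
      using ev_N
    proof eventually_elim
      case (elim N)
      then have N: "real N \<ge> p" "N \<ge> 1" by auto
      have "{\<omega> \<in> space M. \<bar>(\<integral>x. \<phi> x \<partial>eig_count_measure (AA N \<omega>)) - (\<integral>x. \<phi> x \<partial>\<sigma>)\<bar> > \<epsilon>}
         \<subseteq> (\<Union>s\<le>k. dev N s (1 / (real k + 1)))"
      proof (rule subsetI, rule ccontr)
        fix \<omega> assume \<omega>: "\<omega> \<in> {\<omega> \<in> space M. \<bar>(\<integral>x. \<phi> x \<partial>eig_count_measure (AA N \<omega>)) - (\<integral>x. \<phi> x \<partial>\<sigma>)\<bar> > \<epsilon>}"
          and "\<omega> \<notin> (\<Union>s\<le>k. dev N s (1 / (real k + 1)))"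
        then have close: "s \<le> k \<Longrightarrow> \<bar>TrN N s \<omega> / real N - lim_moment p \<alpha> X s\<bar> \<le> 1 / (real k + 1)" for s
          by (auto simp: not_less)
        obtain es where es: "eig_list N \<omega> es" using eig_list[OF N] ..
        note es' = eig_list_measure[OF es N(2)]
        have "\<bar>(\<integral>x. \<phi> x \<partial>list_measure es) - (\<integral>x. \<phi> x \<partial>\<sigma>)\<bar> \<le> \<epsilon>"
          by (rule k[rule_format]) (use es' close in auto)
        then show False using \<omega> unfolding es'(4)[OF \<phi>b] by simp
      qed
      from deviation_bound[OF N this] show ?case by simp
    qed
  qed
qed

end

text \<open>Uniqueness in the theorem ranges over all Borel measures. \<open>measure\<close> is 0 on
  sets of infinite mass by convention, so the value 1 forces total mass exactly 1.\<close>

lemma integrable_moments_real_distribution: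
  fixes \<nu> :: "real measure"
  assumes sets: "sets \<nu> = sets borel" and int: "integrable \<nu> (\<lambda>x. x ^ 0)" and one: "(\<integral>x. x ^ 0 \<partial>\<nu>) = 1"
  shows "real_distribution \<nu>"
proof -
  have sp: "space \<nu> = UNIV" using sets_eq_imp_space_eq[OF sets] by simp
  have "measure \<nu> (space \<nu>) = 1" using one by simp
  then have "emeasure \<nu> (space \<nu>) = 1"
    by (metis emeasure_eq_ennreal_measure ennreal_1 measure_def enn2real_top zero_neq_one)
  then have "prob_space \<nu>" by (rule prob_spaceI)
  then show ?thesis
    by (intro real_distribution.intro real_distribution_axioms.intro) (use sets sp in auto)
qed

theorem theorem1:
  fixes M :: "'w measure" and a :: "nat \<times> nat \<Rightarrow> 'w \<Rightarrow> real"
    and d :: "nat \<Rightarrow> nat \<times> nat \<Rightarrow> 'w \<Rightarrow> real"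
    and p \<alpha> :: real and X :: "nat \<Rightarrow> real"
  assumes "prob_space M"
    and indep: "\<And>N. real N \<ge> p \<Longrightarrow>
      prob_space.indep_vars M (\<lambda>_. borel)
        (\<lambda>k. case k of Inl ij \<Rightarrow> a ij | Inr ij \<Rightarrow> d N ij)
        (Inl ` {(i, j). 1 \<le> i \<and> i \<le> j} \<union> Inr ` {(i, j). 1 \<le> i \<and> i \<le> j \<and> j \<le> N})"
    and ident: "\<And>i j. 1 \<le> i \<Longrightarrow> i \<le> j \<Longrightarrow> distr M borel (a (i, j)) = distr M borel (a (1, 1))"
    and moments: "\<And>i j k. 1 \<le> i \<Longrightarrow> i \<le> j \<Longrightarrow> integrable M (\<lambda>\<omega>. a (i, j) \<omega> ^ k)"
    and X_def: "\<And>k. X k = prob_space.expectation M (\<lambda>\<omega>. a (1, 1) \<omega> ^ k)"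
    and d1: "\<And>N i j. real N \<ge> p \<Longrightarrow> 1 \<le> i \<Longrightarrow> i \<le> j \<Longrightarrow> j \<le> N \<Longrightarrow>
      measure M {\<omega> \<in> space M. d N (i, j) \<omega> = 1} = p / real N"
    and d0: "\<And>N i j. real N \<ge> p \<Longrightarrow> 1 \<le> i \<Longrightarrow> i \<le> j \<Longrightarrow> j \<le> N \<Longrightarrow>
      measure M {\<omega> \<in> space M. d N (i, j) \<omega> = 0} = 1 - p / real N"
    and "p > 0" and "0 < \<alpha>" and "\<alpha> < 1"
    and growth: "\<exists>C::real. \<forall>m::nat. X (2 * m) \<le> (C * real m) ^ (2 * m)"
  shows "\<exists>\<sigma> :: real measure.
      sets \<sigma> = sets borel \<and>
      (\<forall>s. integrable \<sigma> (\<lambda>x. x ^ s) \<and> (\<integral>x. x ^ s \<partial>\<sigma>) = lim_moment p \<alpha> X s) \<and>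
      (\<forall>\<nu> :: real measure. sets \<nu> = sets borel \<and>
         (\<forall>s. integrable \<nu> (\<lambda>x. x ^ s) \<and> (\<integral>x. x ^ s \<partial>\<nu>) = lim_moment p \<alpha> X s) \<longrightarrow> \<nu> = \<sigma>) \<and>
      (\<forall>\<phi> :: real \<Rightarrow> real. continuous_on UNIV \<phi> \<and> bounded (range \<phi>) \<longrightarrow>
         (\<forall>\<epsilon>>0.
            (\<forall>\<^sub>F N in sequentially.
               {\<omega> \<in> space M. \<bar>(\<integral>x. \<phi> x \<partial>eig_count_measure
                    (A_mat \<alpha> N (\<lambda>ij. a ij \<omega>) (\<lambda>ij. d N ij \<omega>))) - (\<integral>x. \<phi> x \<partial>\<sigma>)\<bar> > \<epsilon>}
                 \<in> sets M) \<and>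
            (\<lambda>N. measure M {\<omega> \<in> space M. \<bar>(\<integral>x. \<phi> x \<partial>eig_count_measure
                    (A_mat \<alpha> N (\<lambda>ij. a ij \<omega>) (\<lambda>ij. d N ij \<omega>))) - (\<integral>x. \<phi> x \<partial>\<sigma>)\<bar> > \<epsilon>})
              \<longlonglongrightarrow> 0))"
proof -
  interpret prob_space M by fact
  interpret SB: sparse_bipartite M a d p \<alpha> X
    by (intro sparse_bipartite.intro sparse_bipartite_axioms.intro) (use assms in blast)+
  obtain \<sigma> where "has_moments (lim_moment p \<alpha> X) \<sigma>" using SB.limit_measure ..
  then have \<sigma>: "real_distribution \<sigma>" "\<And>s. integrable \<sigma> (\<lambda>x. x ^ s)"
    "\<And>s. (\<integral>x. x ^ s \<partial>\<sigma>) = lim_moment p \<alpha> X s"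
    unfolding has_moments_def by auto
  obtain R where R: "R > 0" "\<forall>k. lim_moment p \<alpha> X (2 * k) \<le> 2 * R ^ (2 * k) * fact (2 * k)"
    using SB.lim_moment_bound[OF growth] by auto
  have unique: "\<forall>\<nu>. has_moments (lim_moment p \<alpha> X) \<nu> \<longrightarrow> \<nu> = \<sigma>"
  proof (intro allI impI)
    fix \<nu> assume "has_moments (lim_moment p \<alpha> X) \<nu>"
    then have \<nu>: "real_distribution \<nu>" "\<And>s. integrable \<nu> (\<lambda>x. x ^ s)"
      "\<And>s. (\<integral>x. x ^ s \<partial>\<nu>) = lim_moment p \<alpha> X s"
      unfolding has_moments_def by auto
    show "\<nu> = \<sigma>"
    proof (rule moments_determine[OF \<nu>(1) \<sigma>(1) \<nu>(2) \<sigma>(2) _ R(1)])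
      show "(\<integral>x. x ^ s \<partial>\<nu>) = (\<integral>x. x ^ s \<partial>\<sigma>)" for s unfolding \<nu>(3) \<sigma>(3) ..
      show "(\<integral>x. x ^ (2 * k) \<partial>\<nu>) \<le> 2 * R ^ (2 * k) * fact (2 * k)" for k
        unfolding \<nu>(3) by (rule R(2)[rule_format])
    qed
  qed
  show ?thesis
  proof (intro exI[of _ \<sigma>] conjI allI impI)
    show "sets \<sigma> = sets borel" using \<sigma>(1) by (simp add: real_distribution.events_eq_borel)
    show "integrable \<sigma> (\<lambda>x. x ^ s)" for s by (rule \<sigma>(2))
    show "(\<integral>x. x ^ s \<partial>\<sigma>) = lim_moment p \<alpha> X s" for s by (rule \<sigma>(3))
    show "\<nu> = \<sigma>" if \<nu>: "sets \<nu> = sets borel \<and> (\<forall>s. integrable \<nu> (\<lambda>x. x ^ s) \<and> (\<integral>x. x ^ s \<partial>\<nu>) = lim_moment p \<alpha> X s)"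
      for \<nu> :: "real measure"
    proof (rule unique[rule_format])
      have "integrable \<nu> (\<lambda>x. x ^ 0)" "(\<integral>x. x ^ 0 \<partial>\<nu>) = 1" using \<nu> SB.moment_zero by metis+
      then have "real_distribution \<nu>" using \<nu> by (intro integrable_moments_real_distribution) auto
      then show "has_moments (lim_moment p \<alpha> X) \<nu>" using \<nu> by (simp add: has_moments_def)
    qed
    fix \<phi> :: "real \<Rightarrow> real" and \<epsilon> :: real
    assume \<phi>: "continuous_on UNIV \<phi> \<and> bounded (range \<phi>)" and \<epsilon>: "\<epsilon> > 0"
    show "(\<lambda>N. measure M {\<omega> \<in> space M. \<bar>(\<integral>x. \<phi> x \<partial>eig_count_measure
                    (A_mat \<alpha> N (\<lambda>ij. a ij \<omega>) (\<lambda>ij. d N ij \<omega>))) - (\<integral>x. \<phi> x \<partial>\<sigma>)\<bar> > \<epsilon>})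
              \<longlonglongrightarrow> 0"
      using SB.convergence_in_probability[OF unique _ _ \<epsilon>, of \<phi>] \<phi> unfolding SB.AA_def by simp
    show "\<forall>\<^sub>F N in sequentially.
               {\<omega> \<in> space M. \<bar>(\<integral>x. \<phi> x \<partial>eig_count_measure
                    (A_mat \<alpha> N (\<lambda>ij. a ij \<omega>) (\<lambda>ij. d N ij \<omega>))) - (\<integral>x. \<phi> x \<partial>\<sigma>)\<bar> > \<epsilon>}
                 \<in> sets M"
      using SB.ev_N
    proof eventually_elim
      case (elim N)
      then have [measurable]: "(\<lambda>\<omega>. \<integral>x. \<phi> x \<partial>eig_count_measure (SB.AA N \<omega>)) \<in> borel_measurable M"
        using \<phi> by (intro SB.eig_integral_measurable) auto
      show ?case unfolding SB.AA_def[symmetric] by measurable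
    qed
  qed
qed

end
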